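(* There exist a constant $\epsilon_1>0$ and a fixed small radius $0<\rho^+<\frac12$ such that the following holds. Let $0<q_-<q^+$ be given constants, and set $\rho^-:=\frac{\rho^+}{5}\left(\frac{q_-}{q^+}\right)^2$, so that $0<\rho^-<\rho^+<\frac12$. There is a constant $c_4>0$, depending only on $q_-/q^+$, such that whenever $F:\overline{\mathbb{D}}\to\mathbb{R}$ is a not identically zero function, continuous on $\overline{\mathbb{D}}$, which solves $$\Delta F+qF=0\quad\text{in }\mathbb{D},$$ with real-valued potential $q\in C^\infty(\mathbb{D})$ satisfying $\|q\|_\infty=\sup_{\mathbb{D}}|q|<\epsilon_1$, one has $$\log\frac{\sup_{\rho^+\mathbb{D}}|F|}{\sup_{\rho^-\mathbb{D}}|F|}\le c_4\big(1+|Z_F(\mathbb{S}^1)|\big),$$ where $|Z_F(\mathbb{S}^1)|$ is the number of zeros of $F$ on the unit circle $\mathbb{S}^1$.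
   Context: $\mathbb{D}$ is the open unit disk in $\mathbb{R}^2$, $r\mathbb{D}$ the concentric disk of radius $r$, $\Delta$ the flat Laplacian. In the application, $q_-$ and $q^+$ are lower and upper bounds of the conformal factors of the metric of a closed surface in a finite atlas of conformal charts. If $F$ has infinitely many zeros on $\mathbb{S}^1$, the right-hand side is understood as $+\infty$. *)

theory Defs
  imports "HOL-Analysis.Analysis"
begin

definition partial_deriv :: "'a::euclidean_space \<Rightarrow> ('a \<Rightarrow> real) \<Rightarrow> 'a \<Rightarrow> real"
  where "partial_deriv b f x = frechet_derivative f (at x) b"

(* Intended for open S only: the derivatives are full derivatives of a function on the whole
   type, and at a point of an open S they depend only on the values of f on S. *)
fun Ck_on :: "nat \<Rightarrow> ('a::euclidean_space \<Rightarrow> real) \<Rightarrow> 'a set \<Rightarrow> bool" where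
  "Ck_on 0 f S \<longleftrightarrow> continuous_on S f"
| "Ck_on (Suc k) f S \<longleftrightarrow>
     (\<forall>x\<in>S. f differentiable (at x)) \<and> (\<forall>b\<in>Basis. Ck_on k (partial_deriv b f) S)"

definition smooth_on :: "('a::euclidean_space \<Rightarrow> real) \<Rightarrow> 'a set \<Rightarrow> bool"
  where "smooth_on f S \<longleftrightarrow> (\<forall>k. Ck_on k f S)"

definition laplacian :: "('a::euclidean_space \<Rightarrow> real) \<Rightarrow> 'a \<Rightarrow> real"
  where "laplacian f x = (\<Sum>b\<in>Basis. partial_deriv b (partial_deriv b f) x)"

(* Classical solutions. For smooth q, elliptic regularity makes every continuous
   distributional solution smooth, so asking for C^2 excludes nothing. *)
definition solves_schroedinger_on ::
    "('a::euclidean_space \<Rightarrow> real) \<Rightarrow> ('a \<Rightarrow> real) \<Rightarrow> 'a set \<Rightarrow> bool"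
  where "solves_schroedinger_on q F S \<longleftrightarrow>
     Ck_on 2 F S \<and> (\<forall>x\<in>S. laplacian F x + q x * F x = 0)"

(* Extended-real valued, so that an unbounded function has supremum infinity. *)
definition sup_norm_on :: "('a \<Rightarrow> real) \<Rightarrow> 'a set \<Rightarrow> ereal"
  where "sup_norm_on f S = (SUP x\<in>S. ereal \<bar>f x\<bar>)"

definition zero_set :: "('a \<Rightarrow> real) \<Rightarrow> 'a set \<Rightarrow> 'a set"
  where "zero_set f S = {x \<in> S. f x = 0}"

(* card alone would be 0 on an infinite set. *)
definition num_elements :: "'a set \<Rightarrow> ereal"
  where "num_elements A = (if finite A then ereal (real (card A)) else \<infinity>)"

end

theory Submission
  imports Defs "HOL-Complex_Analysis.Complex_Analysis"
begin

text \<open>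
The mechanism is that, up to a bounded factor, the solution $F$ is the real part of a holomorphic
function $H$, and that the signs of $F$ on the unit circle are the signs of the real part of a
holomorphic function there. For such a function the growth is controlled by the number of sign
changes.

Choose a positive solution $\varphi$ of the same equation, close to 1 because the potential is
small. Then $\varphi\nabla F - F\nabla\varphi$ is divergence free, hence is a rotated gradient
$\nabla v$, and $W = \varphi F + i v$ satisfies
$\bar\partial W = b\,(W + \bar W)$ with $b = \bar\partial\varphi/\varphi$ small. So
$\bar\partial\log W$ is bounded, and if $\bar\partial s = \bar\partial W / W$ then $e^{-s}W$ is a
holomorphic function $H_0$ (the similarity principle of Bers and Vekua). A holomorphic $K$ whose imaginary part on the
circle is that of $s$ makes $e^{s-K}$ positive there, so $F$ and the real part of $H = e^K H_0$
have the same sign at each point of the circle.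

Let $P$ be a trigonometric polynomial of degree $m$ with $P F \ge 0$ on the circle, built from
$2m$ of the zeros of $F$. The mean of $|P\,\mathrm{Re}\,H|$ equals the mean of $P\,\mathrm{Re}\,H$, which
is a combination of the Taylor coefficients of $H$ up to order $m$, hence at most $\delta^{-m}$ times the
supremum of $|H|$ on the disc of radius $\delta$. This mean, together with the Taylor coefficients up to order
$m$, bounds all Taylor coefficients of $z^m P H$, and dividing by $z^m P$ costs only $16^m$ on the half disc
(\<open>few_sign_changes_bound\<close>, an argument in the spirit of Robertson and Gelfond). Returning from $H$ to $F$ costs
absolute constants, since $v$ is bounded on a small disc by $F$ on the disc of twice the radius.

Every object other than $F$ itself is a polynomial in $z$ and $\bar z$, or is built from
polynomials, and solves its equation up to an error $\tau$ that tends to 0 in the end.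
Poisson and $\bar\partial$ equations with polynomial right-hand side are solved
monomial by monomial (\<open>zpoly_Poisson\<close>, \<open>zpoly_dbar\<close>), their bounds come from the maximum
principle, and Weierstrass approximation supplies the polynomial right-hand sides. The result of
these steps is \<open>holomorphic_representation\<close>. The behaviour at the boundary is dealt with
by replacing $F(x)$ by $F(rx)$ and letting $r$ tend to 1: signs on the circle are
then wrong by a small amount only, which is why \<open>few_sign_changes_bound\<close> allows an error
in the sign condition. Positivity of the supremum on the small disc is unique continuation,
which follows from the same representation because a bounded holomorphic function that is tiny
on a small disc is small on all larger discs inside the disc of boundedness.
\<close>

section \<open>Polynomials in z and its conjugate\<close>

text \<open>The Wirtinger operators $\partial$ and $\bar\partial$: a real-differentiable function has the
differential \<open>\<lambda>h. dz f z * h + db f z * cnj h\<close>, and $4\,\partial\bar\partial$ is the Laplacian.\<close>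

definition dz :: "(complex \<Rightarrow> complex) \<Rightarrow> complex \<Rightarrow> complex"
  where "dz f z = (frechet_derivative f (at z) 1 - \<i> * frechet_derivative f (at z) \<i>) / 2"

definition db :: "(complex \<Rightarrow> complex) \<Rightarrow> complex \<Rightarrow> complex"
  where "db f z = (frechet_derivative f (at z) 1 + \<i> * frechet_derivative f (at z) \<i>) / 2"

lemma wirtinger_unique:
  assumes "(f has_derivative (\<lambda>h. a * h + b * cnj h)) (at z)"
  shows "dz f z = a" "db f z = b"
proof -
  have "frechet_derivative f (at z) = (\<lambda>h. a * h + b * cnj h)"
    using frechet_derivative_at[OF assms] by simp
  then show "dz f z = a" "db f z = b"
    by (simp_all add: dz_def db_def algebra_simps)
qed

text \<open>The complex polynomials in $x$ and $y$. In the coordinates $z$ and $\bar z$ both Wirtinger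
operators, and right inverses of them, act on single monomials.\<close>

inductive zpoly :: "(complex \<Rightarrow> complex) \<Rightarrow> bool" where
  monom: "zpoly (\<lambda>z. c * z ^ j * cnj z ^ k)"
| add: "zpoly f \<Longrightarrow> zpoly g \<Longrightarrow> zpoly (\<lambda>z. f z + g z)"

lemma zpoly_const [simp, intro]: "zpoly (\<lambda>z. c)"
  using zpoly.monom[of c 0 0] by simp

lemma zpoly_id [simp, intro]: "zpoly (\<lambda>z. z)"
  using zpoly.monom[of 1 1 0] by simp

lemma zpoly_cmult:
  assumes "zpoly f" shows "zpoly (\<lambda>z. a * f z)"
  using assms
proof induction
  case (monom c j k)
  show ?case using zpoly.monom[of "a * c" j k] by (simp add: mult.assoc)
next
  case (add f g)
  then show ?case using zpoly.add by (simp add: algebra_simps)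
qed

lemma zpoly_mult_monom:
  assumes "zpoly f" shows "zpoly (\<lambda>z. f z * (c * z ^ j * cnj z ^ k))"
  using assms
proof induction
  case (monom d i l)
  show ?case using zpoly.monom[of "d * c" "i + j" "l + k"] by (simp add: power_add algebra_simps)
next
  case (add f g)
  then show ?case using zpoly.add by (simp add: algebra_simps)
qed

lemma zpoly_mult [intro]:
  assumes "zpoly f" "zpoly g" shows "zpoly (\<lambda>z. f z * g z)"
  using assms(2,1)
proof induction
  case (monom c j k)
  then show ?case by (rule zpoly_mult_monom)
next
  case (add f1 g1)
  then show ?case using zpoly.add by (simp add: algebra_simps)
qed

lemma zpoly_cnj [intro]:
  assumes "zpoly f" shows "zpoly (\<lambda>z. cnj (f z))"
  using assms
proof induction
  case (monom c j k)
  show ?case using zpoly.monom[of "cnj c" k j] by (simp add: algebra_simps)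
next
  case (add f g)
  then show ?case using zpoly.add by simp
qed

lemma zpoly_diff [intro]:
  assumes "zpoly f" "zpoly g" shows "zpoly (\<lambda>z. f z - g z)"
  using zpoly.add[OF assms(1) zpoly_cmult[OF assms(2), of "-1"]] by simp

lemma zpoly_Re [intro]:
  assumes "zpoly f" shows "zpoly (\<lambda>z. of_real (Re (f z)))"
proof -
  have "(\<lambda>z. of_real (Re (f z))) = (\<lambda>z. (1/2) * (f z + cnj (f z)))"
    by (auto simp: complex_eq_iff)
  then show ?thesis using zpoly_cmult[OF zpoly.add[OF assms zpoly_cnj[OF assms]], of "1/2"] by simp
qed

lemma zpoly_power: "zpoly f \<Longrightarrow> zpoly (\<lambda>z. f z ^ n)"
  by (induction n) auto

lemma zpoly_sum: "(\<And>i. i \<in> A \<Longrightarrow> zpoly (f i)) \<Longrightarrow> zpoly (\<lambda>z. \<Sum>i\<in>A. f i z)"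
  by (induction A rule: infinite_finite_induct) (auto intro!: zpoly.add)

lemma monom_wirtinger:
  "((\<lambda>z. c * z ^ j * cnj z ^ k) has_derivative
     (\<lambda>h. (c * of_nat j * z ^ (j-1) * cnj z ^ k) * h + (c * of_nat k * z ^ j * cnj z ^ (k-1)) * cnj h)) (at z)"
  by (rule derivative_eq_intros refl | simp add: algebra_simps)+

lemma dz_monom: "dz (\<lambda>z. c * z ^ j * cnj z ^ k) = (\<lambda>z. c * of_nat j * z ^ (j-1) * cnj z ^ k)"
  using wirtinger_unique(1)[OF monom_wirtinger] by blast

lemma db_monom: "db (\<lambda>z. c * z ^ j * cnj z ^ k) = (\<lambda>z. c * of_nat k * z ^ j * cnj z ^ (k-1))"
  using wirtinger_unique(2)[OF monom_wirtinger] by blast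

lemma add_wirtinger:
  assumes "(f has_derivative (\<lambda>h. a * h + b * cnj h)) (at z)"
    "(g has_derivative (\<lambda>h. c * h + d * cnj h)) (at z)"
  shows "((\<lambda>z. f z + g z) has_derivative (\<lambda>h. (a + c) * h + (b + d) * cnj h)) (at z)"
  using has_derivative_add[OF assms] by (simp add: algebra_simps)

lemma zpoly_wirtinger:
  assumes "zpoly f"
  shows "(f has_derivative (\<lambda>h. dz f z * h + db f z * cnj h)) (at z)"
  using assms
proof (induction)
  case (monom c j k)
  then show ?case unfolding dz_monom db_monom by (rule monom_wirtinger)
next
  case (add f g)
  note A = add_wirtinger[OF add.IH]
  show ?case using A wirtinger_unique[OF A] by simp
qed

lemma
  assumes "zpoly f" "zpoly g"
  shows dz_add: "dz (\<lambda>z. f z + g z) = (\<lambda>z. dz f z + dz g z)"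
    and db_add: "db (\<lambda>z. f z + g z) = (\<lambda>z. db f z + db g z)"
  using wirtinger_unique[OF add_wirtinger[OF assms[THEN zpoly_wirtinger]]] by blast+

lemma
  assumes f: "zpoly f" and g: "zpoly g"
  shows dz_mult: "dz (\<lambda>z. f z * g z) = (\<lambda>z. dz f z * g z + f z * dz g z)"
    and db_mult: "db (\<lambda>z. f z * g z) = (\<lambda>z. db f z * g z + f z * db g z)"
proof -
  have "((\<lambda>z. f z * g z) has_derivative (\<lambda>h. (dz f z * g z + f z * dz g z) * h
      + (db f z * g z + f z * db g z) * cnj h)) (at z)" for z
    using has_derivative_mult[OF f[THEN zpoly_wirtinger] g[THEN zpoly_wirtinger]]
    by (simp add: algebra_simps)
  from wirtinger_unique[OF this]
  show "dz (\<lambda>z. f z * g z) = (\<lambda>z. dz f z * g z + f z * dz g z)"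
    "db (\<lambda>z. f z * g z) = (\<lambda>z. db f z * g z + f z * db g z)" by blast+
qed

lemma dz_const [simp]: "dz (\<lambda>z. c) = (\<lambda>z. 0)" and db_const [simp]: "db (\<lambda>z. c) = (\<lambda>z. 0)"
  using dz_monom[of c 0 0] db_monom[of c 0 0] by simp_all

lemma dz_cmult: "zpoly f \<Longrightarrow> dz (\<lambda>z. c * f z) = (\<lambda>z. c * dz f z)"
  and db_cmult: "zpoly f \<Longrightarrow> db (\<lambda>z. c * f z) = (\<lambda>z. c * db f z)"
  using dz_mult[of "\<lambda>z. c" f] db_mult[of "\<lambda>z. c" f] by simp_all

lemma
  assumes "zpoly f" "zpoly g"
  shows dz_diff: "dz (\<lambda>z. f z - g z) = (\<lambda>z. dz f z - dz g z)"
    and db_diff: "db (\<lambda>z. f z - g z) = (\<lambda>z. db f z - db g z)"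
  using dz_add[OF assms(1) zpoly_cmult[OF assms(2), of "-1"]]
    db_add[OF assms(1) zpoly_cmult[OF assms(2), of "-1"]]
  by (simp_all add: dz_cmult[OF assms(2), of "-1", simplified] db_cmult[OF assms(2), of "-1", simplified])

lemma
  assumes f: "zpoly f"
  shows dz_cnj: "dz (\<lambda>z. cnj (f z)) = (\<lambda>z. cnj (db f z))"
    and db_cnj: "db (\<lambda>z. cnj (f z)) = (\<lambda>z. cnj (dz f z))"
proof -
  have "((\<lambda>z. cnj (f z)) has_derivative (\<lambda>h. cnj (db f z) * h + cnj (dz f z) * cnj h)) (at z)" for z
    using has_derivative_cnj[OF f[THEN zpoly_wirtinger]]
    by (simp add: algebra_simps)
  from wirtinger_unique[OF this]
  show "dz (\<lambda>z. cnj (f z)) = (\<lambda>z. cnj (db f z))" "db (\<lambda>z. cnj (f z)) = (\<lambda>z. cnj (dz f z))" by blast+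
qed

lemma zpoly_dz [intro]: "zpoly f \<Longrightarrow> zpoly (dz f)"
  by (induction rule: zpoly.induct) (auto simp: dz_monom dz_add intro: zpoly.intros)

lemma zpoly_db [intro]: "zpoly f \<Longrightarrow> zpoly (db f)"
  by (induction rule: zpoly.induct) (auto simp: db_monom db_add intro: zpoly.intros)

lemma db_dz_commute: "zpoly f \<Longrightarrow> db (dz f) = dz (db f)"
proof (induction rule: zpoly.induct)
  case (monom c j k)
  show ?case by (auto simp: db_monom dz_monom fun_eq_iff)
next
  case (add f g)
  then show ?case by (simp add: dz_add db_add zpoly_dz zpoly_db)
qed

lemma zpoly_continuous: "zpoly f \<Longrightarrow> continuous_on S f"
  by (induction rule: zpoly.induct) (auto intro!: continuous_intros)

lemma zpoly_dz_antiderivative: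
  assumes "zpoly f" shows "\<exists>g. zpoly g \<and> dz g = f"
  using assms
proof induction
  case (monom c j k)
  show ?case
    by (rule exI[of _ "\<lambda>z. (c / of_nat (Suc j)) * z ^ Suc j * cnj z ^ k"])
      (simp only: zpoly.monom dz_monom simp_thms, simp del: of_nat_Suc)
next
  case (add f g)
  then obtain u w where "zpoly u" "dz u = f" "zpoly w" "dz w = g" by blast
  then show ?case by (intro exI[of _ "\<lambda>z. u z + w z"]) (simp add: dz_add zpoly.add)
qed

lemma db_zero_holomorphic:
  assumes "zpoly f" "\<And>z. db f z = 0"
  shows "f holomorphic_on S"
proof -
  have "(f has_field_derivative dz f z) (at z)" for z
    using zpoly_wirtinger[OF assms(1), of z] assms(2)
    by (simp add: has_field_derivative_def)
  then show ?thesis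
    by (meson DERIV_subset UNIV_I field_differentiable_def holomorphic_on_def
        field_differentiable_at_within)
qed

lemma zpoly_bound:
  assumes "zpoly f" shows "\<exists>B n. \<forall>z. cmod z \<ge> 1 \<longrightarrow> cmod (f z) \<le> B * cmod z ^ n"
  using assms
proof induction
  case (monom c j k)
  show ?case
    by (rule exI[of _ "cmod c"], rule exI[of _ "j + k"]) (auto simp: norm_mult norm_power power_add)
next
  case (add f g)
  then obtain B n C m where "\<And>z. cmod z \<ge> 1 \<Longrightarrow> cmod (f z) \<le> B * cmod z ^ n"
    "\<And>z. cmod z \<ge> 1 \<Longrightarrow> cmod (g z) \<le> C * cmod z ^ m" by metis
  then have 1: "cmod z \<ge> 1 \<Longrightarrow> cmod (f z) \<le> \<bar>B\<bar> * cmod z ^ (max n m)"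
     "cmod z \<ge> 1 \<Longrightarrow> cmod (g z) \<le> \<bar>C\<bar> * cmod z ^ (max n m)" for z
    by (smt (verit, best) power_increasing max.cobounded1 max.cobounded2 mult_mono zero_le_power norm_ge_zero)+
  show ?case
    apply (rule exI[of _ "\<bar>B\<bar> + \<bar>C\<bar>"], rule exI[of _ "max n m"])
    using 1 norm_triangle_ineq by (smt (verit) distrib_right)
qed

text \<open>By Liouville's theorem for functions of polynomial growth, a holomorphic \<open>zpoly\<close> is a polynomial
in $z$ alone, and that can be integrated term by term.\<close>

lemma zpoly_holomorphic_antiderivative:
  assumes f: "zpoly f" and 0: "\<And>z. db f z = 0"
  shows "\<exists>g. zpoly g \<and> dz g = f \<and> (\<forall>z. db g z = 0)"
proof -
  obtain B n where Bn: "\<And>z. cmod z \<ge> 1 \<Longrightarrow> cmod (f z) \<le> B * cmod z ^ n"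
    using zpoly_bound[OF f] by metis
  have *: "f z = (\<Sum>k\<le>n. ((deriv ^^ k) f 0 / fact k) * z ^ k)" for z
    by (rule Liouville_polynomial[OF db_zero_holomorphic[OF f 0], where A = 1 and B = B])
      (use Bn in auto)
  define a where "a k = (deriv ^^ k) f 0 / fact k" for k
  define g where "g z = (\<Sum>k\<le>n. (a k / of_nat (Suc k)) * z ^ Suc k * cnj z ^ 0)" for z
  have "(g has_derivative (\<lambda>h. (\<Sum>k\<le>n. a k * z ^ k) * h + 0 * cnj h)) (at z)" for z
  proof -
    have "((\<lambda>z. (a k / of_nat (Suc k)) * z ^ Suc k * cnj z ^ 0) has_derivative (\<lambda>h. a k * z ^ k * h)) (at z)" for k
      using monom_wirtinger[of "a k / of_nat (Suc k)" "Suc k" 0 z] by (simp del: of_nat_Suc power_Suc)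
    then show ?thesis unfolding g_def
      using has_derivative_sum[of "{..n}" "\<lambda>k z. (a k / of_nat (Suc k)) * z ^ Suc k * cnj z ^ 0" "\<lambda>k h. a k * z ^ k * h" "at z"]
      by (simp add: sum_distrib_right)
  qed
  from wirtinger_unique[OF this] have "dz g = f" "\<forall>z. db g z = 0"
    using * by (auto simp: a_def fun_eq_iff)
  moreover have "zpoly g"
    unfolding g_def by (intro zpoly_sum zpoly.monom)
  ultimately show ?thesis by blast
qed

lemma real_polynomial_zpoly:
  fixes p :: "complex \<Rightarrow> real"
  assumes "real_polynomial_function p" shows "zpoly (\<lambda>z. of_real (p z))"
  using assms
proof induction
  case (linear f)
  have *: "f z = Re z * f 1 + Im z * f \<i>" for z
  proof -
    have "f z = f (Re z *\<^sub>R 1 + Im z *\<^sub>R \<i>)"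
      by (metis complex_eq scaleR_conv_of_real mult.right_neutral mult.commute)
    then show ?thesis
      by (simp add: bounded_linear.linear[OF linear] linear_add linear_scale)
  qed
  have "complex_of_real (f z) = of_real (f 1) * of_real (Re z) + of_real (f \<i>) * of_real (Re (- \<i> * z))" for z
    using *[of z] by (simp add: mult.commute)
  then have "(\<lambda>z. complex_of_real (f z)) =
     (\<lambda>z. of_real (f 1) * of_real (Re z) + of_real (f \<i>) * of_real (Re (- \<i> * z)))" by blast
  moreover have "zpoly \<dots>"
    by (intro zpoly.add zpoly_cmult zpoly_Re zpoly_id)
  ultimately show ?case by simp
next
  case (const c)
  show ?case by simp
next
  case (add f g)
  then show ?case using zpoly.add by simp
next
  case (mult f g)
  then show ?case using zpoly_mult by simp
qed

lemma zpoly_dense: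
  assumes "compact S" "continuous_on S f" "e > 0"
  shows "\<exists>g. zpoly g \<and> (\<forall>z\<in>S. cmod (f z - g z) \<le> e)"
proof -
  obtain g where g: "polynomial_function g" "\<And>x. x \<in> S \<Longrightarrow> norm (f x - g x) < e"
    using Stone_Weierstrass_polynomial_function[OF assms] by blast
  have "real_polynomial_function (\<lambda>z. Re (g z))" "real_polynomial_function (\<lambda>z. Im (g z))"
    using g(1) bounded_linear_Re bounded_linear_Im unfolding polynomial_function_def o_def by blast+
  from this[THEN real_polynomial_zpoly]
  have "zpoly (\<lambda>z. of_real (Re (g z)) + \<i> * of_real (Im (g z)))"
    by (intro zpoly.add zpoly_cmult)
  moreover have "(\<lambda>z. of_real (Re (g z)) + \<i> * of_real (Im (g z))) = g"
    by (auto simp: complex_eq_iff fun_eq_iff)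
  ultimately have "zpoly g" by simp
  then show ?thesis using g(2) less_imp_le by blast
qed

lemma zpoly_dense_real:
  fixes f :: "complex \<Rightarrow> real"
  assumes "compact S" "continuous_on S f" "e > 0"
  shows "\<exists>g. zpoly g \<and> (\<forall>z. Im (g z) = 0) \<and> (\<forall>z\<in>S. \<bar>f z - Re (g z)\<bar> \<le> e)"
proof -
  have "continuous_on S (\<lambda>z. complex_of_real (f z))" using assms(2) by (intro continuous_intros)
  from zpoly_dense[OF assms(1) this assms(3)] obtain g where
    g: "zpoly g" "\<And>z. z \<in> S \<Longrightarrow> cmod (of_real (f z) - g z) \<le> e" by blast
  show ?thesis
  proof (intro exI[of _ "\<lambda>z. of_real (Re (g z))"] conjI ballI)
    show "\<bar>f z - Re (complex_of_real (Re (g z)))\<bar> \<le> e" if "z \<in> S" for z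
      using g(2)[OF that] abs_Re_le_cmod[of "of_real (f z) - g z"] by simp
  qed (use g in auto)
qed

lemma circle_monom:
  assumes "cmod z = 1"
  shows "z ^ j * cnj z ^ k = (if k \<le> j then z ^ (j - k) else cnj z ^ (k - j))"
proof -
  have 1: "z * cnj z = 1" using complex_norm_square[of z] assms by simp
  show ?thesis
  proof (cases "k \<le> j")
    case True
    then have "z ^ j = z ^ (j - k) * z ^ k" by (simp flip: power_add)
    then show ?thesis using True 1 by (simp add: mult.assoc flip: power_mult_distrib)
  next
    case False
    then have "cnj z ^ k = cnj z ^ j * cnj z ^ (k - j)" by (simp flip: power_add)
    then have "z ^ j * cnj z ^ k = (z * cnj z) ^ j * cnj z ^ (k - j)"
      by (simp only: power_mult_distrib mult.assoc)
    then show ?thesis using False 1 by simp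
  qed
qed

text \<open>On the circle $\bar z = 1/z$, so each monomial restricts to a power of $z$ or of $\bar z$, and
these powers are harmonic.\<close>

lemma harmonic_extension:
  assumes "zpoly g"
  shows "\<exists>u. zpoly u \<and> (\<forall>z. dz (db u) z = 0) \<and> (\<forall>z. cmod z = 1 \<longrightarrow> u z = g z)"
  using assms
proof induction
  case (monom c j k)
  show ?case
  proof (cases "k \<le> j")
    case True
    have "dz (db (\<lambda>z. c * z ^ (j-k) * cnj z ^ 0)) = (\<lambda>z. 0)"
      unfolding db_monom by simp
    with True show ?thesis
      using zpoly.monom[of c "j - k" 0]
      by (intro exI[of _ "\<lambda>z. c * z ^ (j-k) * cnj z ^ 0"]) (auto simp: mult.assoc circle_monom)
  next
    case False
    have "dz (db (\<lambda>z. c * z ^ 0 * cnj z ^ (k-j))) = (\<lambda>z. 0)"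
      unfolding db_monom dz_monom by simp
    with False show ?thesis
      using zpoly.monom[of c 0 "k - j"]
      by (intro exI[of _ "\<lambda>z. c * z ^ 0 * cnj z ^ (k-j)"]) (auto simp: mult.assoc circle_monom)
  qed
next
  case (add f g)
  then obtain u w where "zpoly u \<and> (\<forall>z. dz (db u) z = 0) \<and> (\<forall>z. cmod z = 1 \<longrightarrow> u z = f z)"
    "zpoly w \<and> (\<forall>z. dz (db w) z = 0) \<and> (\<forall>z. cmod z = 1 \<longrightarrow> w z = g z)" by blast
  then show ?case
    by (intro exI[of _ "\<lambda>z. u z + w z"]) (auto simp: zpoly.add db_add dz_add zpoly_db)
qed

lemma zpoly_Laplace_antiderivative:
  assumes "zpoly p" shows "\<exists>u. zpoly u \<and> (\<forall>z. 4 * dz (db u) z = p z)"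
proof -
  obtain g where g: "zpoly g" "dz g = p" using zpoly_dz_antiderivative[OF assms] by blast
  obtain h where h: "zpoly h" "dz h = (\<lambda>z. cnj (g z))"
    using zpoly_dz_antiderivative[OF zpoly_cnj[OF g(1)]] by blast
  have "db (\<lambda>z. cnj (h z)) = g" using h by (simp add: db_cnj)
  then have "db (\<lambda>z. (1/4) * cnj (h z)) = (\<lambda>z. (1/4) * g z)"
    by (simp only: db_cmult[OF zpoly_cnj[OF h(1)]])
  then have "4 * dz (db (\<lambda>z. (1/4) * cnj (h z))) z = p z" for z
    using g by (simp only: dz_cmult[OF g(1)]) simp
  then show ?thesis using zpoly_cmult[OF zpoly_cnj[OF h(1)], of "1/4"] by blast
qed

lemma zpoly_Dirichlet:
  assumes p: "zpoly p" and g: "zpoly g"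
  shows "\<exists>u. zpoly u \<and> (\<forall>z. 4 * dz (db u) z = p z) \<and> (\<forall>z. cmod z = 1 \<longrightarrow> u z = g z)"
proof -
  obtain u where u: "zpoly u" "\<And>z. 4 * dz (db u) z = p z" using zpoly_Laplace_antiderivative[OF p] by blast
  obtain w where w: "zpoly w" "\<And>z. dz (db w) z = 0" "\<And>z. cmod z = 1 \<Longrightarrow> w z = g z - u z"
    using harmonic_extension[OF zpoly_diff[OF g u(1)]] by blast
  show ?thesis
    by (rule exI[of _ "\<lambda>z. u z + w z"]) (use u w in \<open>auto simp: db_add dz_add zpoly_db zpoly.add\<close>)
qed

lemma lap_Re:
  assumes "zpoly u"
  shows "dz (db (\<lambda>z. of_real (Re (u z)))) z = of_real (Re (dz (db u) z))"
proof -
  have *: "(\<lambda>z. of_real (Re (u z))) = (\<lambda>z. (1/2) * (u z + cnj (u z)))"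
    by (simp add: complex_add_cnj)
  note u = assms zpoly_cnj[OF assms]
  note v = zpoly_db[OF assms] zpoly_cnj[OF zpoly_dz[OF assms]]
  have 1: "db (\<lambda>z. (1/2) * (u z + cnj (u z))) = (\<lambda>z. (1/2) * (db u z + cnj (dz u z)))"
    by (simp only: db_cmult[OF zpoly.add[OF u]] db_add[OF u] db_cnj[OF assms])
  have 2: "dz (\<lambda>z. (1/2) * (db u z + cnj (dz u z))) = (\<lambda>z. (1/2) * (dz (db u) z + cnj (db (dz u) z)))"
    by (simp only: dz_cmult[OF zpoly.add[OF v]] dz_add[OF v] dz_cnj[OF zpoly_dz[OF assms]])
  show ?thesis unfolding * 1 2 db_dz_commute[OF assms] by (simp only: complex_add_cnj) simp
qed

lemma zpoly_Dirichlet_real: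
  assumes p: "zpoly p" and g: "zpoly g" and "\<And>z. Im (p z) = 0" "\<And>z. Im (g z) = 0"
  shows "\<exists>u. zpoly u \<and> (\<forall>z. Im (u z) = 0) \<and> (\<forall>z. 4 * dz (db u) z = p z)
    \<and> (\<forall>z. cmod z = 1 \<longrightarrow> u z = g z)"
proof -
  obtain u where u: "zpoly u" "\<And>z. 4 * dz (db u) z = p z" "\<And>z. cmod z = 1 \<Longrightarrow> u z = g z"
    using zpoly_Dirichlet[OF p g] by blast
  have "4 * of_real (Re (dz (db u) z)) = p z" for z
    using u(2)[of z] assms(3)[of z] by (simp add: complex_eq_iff flip: u(2))
  moreover have "of_real (Re (u z)) = g z" if "cmod z = 1" for z
    using u(3)[OF that] assms(4)[of z] by (simp add: complex_eq_iff)
  ultimately show ?thesis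
    using zpoly_Re[OF u(1)] lap_Re[OF u(1)] by (intro exI[of _ "\<lambda>z. of_real (Re (u z))"]) simp
qed

section \<open>Maximum principle and interior gradient bounds\<close>

definition second_deriv :: "(real \<Rightarrow> real) \<Rightarrow> real \<Rightarrow> bool" where
  "second_deriv g a \<longleftrightarrow>
     (\<exists>g'. (\<forall>\<^sub>F t in nhds 0. (g has_real_derivative g' t) (at t)) \<and> (g' has_real_derivative a) (at 0))"

text \<open>The Laplacian at a point through the second derivatives along the two coordinate lines. This is
all that the maximum principle needs, and it applies alike to a \<open>zpoly\<close> and to a solution that is
only twice differentiable.\<close>

definition has_lap :: "(complex \<Rightarrow> real) \<Rightarrow> complex \<Rightarrow> real \<Rightarrow> bool" where
  "has_lap u z L \<longleftrightarrow>
     (\<exists>a b. second_deriv (\<lambda>t. u (z + of_real t)) a \<and> second_deriv (\<lambda>t. u (z + \<i> * of_real t)) b \<and> L = a + b)"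

lemma isCont_filterlim_nhds: "isCont f x \<Longrightarrow> filterlim f (nhds (f x)) (nhds x)"
  by (simp add: isCont_def tendsto_at_iff_tendsto_nhds)

lemma second_deriv_add:
  assumes "second_deriv g a" "second_deriv h b"
  shows "second_deriv (\<lambda>t. g t + h t) (a + b)"
proof -
  obtain g' h' where
    g: "\<forall>\<^sub>F t in nhds 0. (g has_real_derivative g' t) (at t)" "(g' has_real_derivative a) (at 0)" and
    h: "\<forall>\<^sub>F t in nhds 0. (h has_real_derivative h' t) (at t)" "(h' has_real_derivative b) (at 0)"
    using assms unfolding second_deriv_def by blast
  have "\<forall>\<^sub>F t in nhds 0. ((\<lambda>t. g t + h t) has_real_derivative (g' t + h' t)) (at t)"
    using g(1) h(1) by eventually_elim (rule DERIV_add)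
  moreover have "((\<lambda>t. g' t + h' t) has_real_derivative (a + b)) (at 0)"
    by (intro DERIV_add g h)
  ultimately show ?thesis unfolding second_deriv_def by (intro exI conjI)
qed

lemma second_deriv_cmult:
  assumes "second_deriv g a"
  shows "second_deriv (\<lambda>t. c * g t) (c * a)"
proof -
  obtain g' where
    g: "\<forall>\<^sub>F t in nhds 0. (g has_real_derivative g' t) (at t)" "(g' has_real_derivative a) (at 0)"
    using assms unfolding second_deriv_def by blast
  have "\<forall>\<^sub>F t in nhds 0. ((\<lambda>t. c * g t) has_real_derivative (c * g' t)) (at t)"
    using g(1) by eventually_elim (rule DERIV_cmult)
  moreover have "((\<lambda>t. c * g' t) has_real_derivative (c * a)) (at 0)"
    by (intro DERIV_cmult g)
  ultimately show ?thesis unfolding second_deriv_def by (intro exI conjI)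
qed

lemma second_deriv_scale:
  assumes "second_deriv g a"
  shows "second_deriv (\<lambda>t. g (r * t)) (r\<^sup>2 * a)"
proof -
  obtain g' where
    g: "\<forall>\<^sub>F t in nhds 0. (g has_real_derivative g' t) (at t)" "(g' has_real_derivative a) (at 0)"
    using assms unfolding second_deriv_def by blast
  have "filterlim (\<lambda>t. r * t) (nhds 0) (nhds 0)"
    using isCont_filterlim_nhds[of 0 "\<lambda>t. r * t"] by simp
  from eventually_compose_filterlim[OF g(1) this]
  have "\<forall>\<^sub>F t in nhds 0. (g has_real_derivative g' (r * t)) (at (r * t))" .
  then have "\<forall>\<^sub>F t in nhds 0. ((\<lambda>t. g (r * t)) has_real_derivative (r * g' (r * t))) (at t)"
  proof eventually_elim
    case (elim t)
    have "((\<lambda>t. r * t) has_real_derivative r) (at t)"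
      by (auto intro!: derivative_eq_intros)
    from DERIV_chain2[of g, OF elim this] show ?case by (simp add: mult.commute)
  qed
  moreover have "((\<lambda>t. r * g' (r * t)) has_real_derivative (r\<^sup>2 * a)) (at 0)"
  proof -
    have "((\<lambda>t. r * t) has_real_derivative r) (at 0)"
      by (auto intro!: derivative_eq_intros)
    moreover have "(g' has_real_derivative a) (at (r * 0))" using g(2) by simp
    ultimately have "((\<lambda>t. g' (r * t)) has_real_derivative (a * r)) (at 0)"
      using DERIV_chain2 by blast
    from DERIV_cmult[OF this, of r] show ?thesis by (simp add: power2_eq_square mult_ac)
  qed
  ultimately show ?thesis unfolding second_deriv_def by (intro exI conjI)
qed

lemma second_deriv_quadratic:
  assumes "\<And>t. g t = A + B * t + C * t\<^sup>2"
  shows "second_deriv g (2 * C)"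
proof -
  have g: "g = (\<lambda>t. A + B * t + C * t\<^sup>2)" using assms by blast
  have "(g has_real_derivative (B + 2 * C * t)) (at t)" for t
    unfolding g by (auto intro!: derivative_eq_intros)
  moreover have "((\<lambda>t. B + 2 * C * t) has_real_derivative (2 * C)) (at 0)"
    by (auto intro!: derivative_eq_intros)
  ultimately show ?thesis unfolding second_deriv_def by (intro exI conjI always_eventually allI)
qed

lemma second_deriv_local_max:
  assumes "second_deriv g a" "\<forall>\<^sub>F t in nhds 0. g t \<le> g 0"
  shows "a \<le> 0"
proof (rule ccontr)
  assume "\<not> a \<le> 0"
  obtain g' where
    g: "\<forall>\<^sub>F t in nhds 0. (g has_real_derivative g' t) (at t)" "(g' has_real_derivative a) (at 0)"
    using assms unfolding second_deriv_def by blast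
  obtain d where d: "d > 0" "\<And>t. \<bar>t\<bar> < d \<Longrightarrow> (g has_real_derivative g' t) (at t)"
     "\<And>t. \<bar>t\<bar> < d \<Longrightarrow> g t \<le> g 0"
    using eventually_conj[OF g(1) assms(2)] unfolding eventually_nhds_metric by (auto simp: dist_real_def)
  have "g' 0 = 0"
    by (rule DERIV_local_max[OF d(2) d(1)]) (use d in auto)
  obtain e where e: "e > 0" "\<And>h. 0 < h \<Longrightarrow> h < e \<Longrightarrow> g' 0 < g' (0 + h)"
    using DERIV_pos_inc_right[OF g(2)] \<open>\<not> a \<le> 0\<close> by (metis linorder_not_le)
  define t where "t = min d e / 2"
  have t: "0 < t" "t < d" "t < e" using d e by (auto simp: t_def)
  have "\<exists>z. 0 < z \<and> z < t \<and> g t - g 0 = (t - 0) * g' z"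
    by (rule MVT2) (use t d in auto)
  then obtain z where z: "0 < z" "z < t" "g t - g 0 = t * g' z" by auto
  have "g' z > 0" using e(2)[of z] z t \<open>g' 0 = 0\<close> by auto
  then have "g t > g 0" using z t by (metis diff_gt_0_iff_gt mult_pos_pos)
  moreover have "g t \<le> g 0" using d(3)[of t] t by auto
  ultimately show False by simp
qed

lemma has_lap_add:
  assumes "has_lap u z L" "has_lap v z M" shows "has_lap (\<lambda>z. u z + v z) z (L + M)"
proof -
  obtain a b c d where
    "second_deriv (\<lambda>t. u (z + of_real t)) a" "second_deriv (\<lambda>t. u (z + \<i> * of_real t)) b" "L = a + b"
    "second_deriv (\<lambda>t. v (z + of_real t)) c" "second_deriv (\<lambda>t. v (z + \<i> * of_real t)) d" "M = c + d"
    using assms unfolding has_lap_def by blast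
  then show ?thesis unfolding has_lap_def
    by (intro exI[of _ "a + c"] exI[of _ "b + d"]) (simp add: second_deriv_add)
qed

lemma has_lap_cmult:
  assumes "has_lap u z L" shows "has_lap (\<lambda>z. c * u z) z (c * L)"
  using assms second_deriv_cmult[of _ _ c] unfolding has_lap_def by (metis distrib_left)

lemma has_lap_diff:
  assumes "has_lap u z L" "has_lap v z M" shows "has_lap (\<lambda>z. u z - v z) z (L - M)"
  using has_lap_add[OF assms(1) has_lap_cmult[OF assms(2), of "-1"]] by simp

lemma has_lap_reflect:
  assumes "has_lap u (- cnj z) L" shows "has_lap (\<lambda>z. u (- cnj z)) z L"
proof -
  obtain a b where
    a: "second_deriv (\<lambda>t. u (- cnj z + of_real t)) a" and
    b: "second_deriv (\<lambda>t. u (- cnj z + \<i> * of_real t)) b" and L: "L = a + b"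
    using assms unfolding has_lap_def by blast
  have "(\<lambda>t. u (- cnj (z + of_real t))) = (\<lambda>t. u (- cnj z + of_real (- 1 * t)))"
    "(\<lambda>t. u (- cnj (z + \<i> * of_real t))) = (\<lambda>t. u (- cnj z + \<i> * of_real t))"
    by (auto simp: fun_eq_iff intro!: arg_cong[of _ _ u])
  then show ?thesis unfolding has_lap_def
    using second_deriv_scale[OF a, of "-1"] b L by auto
qed

lemma has_lap_quadratic:
  assumes "\<And>z. u z = A + B * Re z + C * Im z + D * (Re z)\<^sup>2 + E * (Im z)\<^sup>2"
  shows "has_lap u z (2 * D + 2 * E)"
proof -
  have "second_deriv (\<lambda>t. u (z + of_real t)) (2 * D)"
    by (rule second_deriv_quadratic[of _ "A + B * Re z + C * Im z + D * (Re z)\<^sup>2 + E * (Im z)\<^sup>2" "B + 2 * D * Re z"])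
      (simp add: assms power2_eq_square algebra_simps)
  moreover have "second_deriv (\<lambda>t. u (z + \<i> * of_real t)) (2 * E)"
    by (rule second_deriv_quadratic[of _ "A + B * Re z + C * Im z + D * (Re z)\<^sup>2 + E * (Im z)\<^sup>2" "C + 2 * E * Im z"])
      (simp add: assms power2_eq_square algebra_simps)
  ultimately show ?thesis unfolding has_lap_def by blast
qed

lemma max_principle_strict:
  assumes K: "compact K" "continuous_on K u"
    and lap: "\<And>z. z \<in> interior K \<Longrightarrow> \<exists>L>0. has_lap u z L"
    and bd: "\<And>z. z \<in> K - interior K \<Longrightarrow> u z \<le> b"
    and z: "z \<in> K"
  shows "u z \<le> b"
proof -
  obtain w where w: "w \<in> K" "\<And>y. y \<in> K \<Longrightarrow> u y \<le> u w"
    using continuous_attains_sup[OF K(1) _ K(2)] z by blast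
  have "w \<notin> interior K"
  proof
    assume wi: "w \<in> interior K"
    then obtain a c where ac: "second_deriv (\<lambda>t. u (w + of_real t)) a"
      "second_deriv (\<lambda>t. u (w + \<i> * of_real t)) c" "a + c > 0"
      using lap[of w] unfolding has_lap_def by auto
    have ev: "\<forall>\<^sub>F y in nhds w. u y \<le> u w"
      using eventually_nhds_in_open[OF open_interior wi] w interior_subset
      by (auto elim!: eventually_mono)
    have "filterlim (\<lambda>t. w + of_real t) (nhds w) (nhds 0)"
      "filterlim (\<lambda>t. w + \<i> * of_real t) (nhds w) (nhds 0)"
      using isCont_filterlim_nhds[of 0 "\<lambda>t. w + of_real t"]
        isCont_filterlim_nhds[of 0 "\<lambda>t. w + \<i> * of_real t"] by simp_all
    from this[THEN eventually_compose_filterlim[OF ev]]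
    have "a \<le> 0" "c \<le> 0"
      using second_deriv_local_max[OF ac(1)] second_deriv_local_max[OF ac(2)] by auto
    with ac show False by simp
  qed
  then show ?thesis using bd[of w] w z by force
qed

text \<open>A small multiple of $|z|^2$ makes the Laplacian strictly positive.\<close>

lemma max_principle:
  assumes K: "compact K" "continuous_on K u"
    and lap: "\<And>z. z \<in> interior K \<Longrightarrow> \<exists>L\<ge>0. has_lap u z L"
    and bd: "\<And>z. z \<in> K - interior K \<Longrightarrow> u z \<le> b"
    and z: "z \<in> K"
  shows "u z \<le> b"
proof -
  obtain R where R: "\<And>z. z \<in> K \<Longrightarrow> cmod z \<le> R"
    using compact_imp_bounded[OF K(1)] unfolding bounded_iff by blast
  have sq: "(cmod y)\<^sup>2 \<le> R\<^sup>2" if "y \<in> K" for y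
    using R[OF that] by (simp add: power_mono)
  have "u z \<le> b + e * R\<^sup>2" if e: "e > 0" for e
  proof -
    have "u z + e * (cmod z)\<^sup>2 \<le> b + e * R\<^sup>2"
    proof (rule max_principle_strict[OF K(1) _ _ _ z])
      show "continuous_on K (\<lambda>z. u z + e * (cmod z)\<^sup>2)" by (intro continuous_intros K)
      show "\<exists>L>0. has_lap (\<lambda>z. u z + e * (cmod z)\<^sup>2) y L" if "y \<in> interior K" for y
      proof -
        obtain L where L: "L \<ge> 0" "has_lap u y L" using lap[OF \<open>y \<in> interior K\<close>] by blast
        have "has_lap (\<lambda>z. e * (cmod z)\<^sup>2) y (2 * e + 2 * e)"
          by (rule has_lap_quadratic[of _ 0 0 0]) (simp add: cmod_power2 algebra_simps)
        from has_lap_add[OF L(2) this] show ?thesis using L(1) e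
          by (intro exI[of _ "L + (2 * e + 2 * e)"]) auto
      qed
      show "u y + e * (cmod y)\<^sup>2 \<le> b + e * R\<^sup>2" if "y \<in> K - interior K" for y
        using bd[OF that] sq[of y] that e by (simp add: add_mono)
    qed
    moreover have "e * (cmod z)\<^sup>2 \<ge> 0" using e by simp
    ultimately show ?thesis by linarith
  qed
  then have "u z \<le> b + e" if "e > 0" for e
    using that \<open>\<And>e. 0 < e \<Longrightarrow> u z \<le> b + e * R\<^sup>2\<close>[of "e / (R\<^sup>2 + 1)"]
    by (smt (verit, ccfv_SIG) divide_pos_pos mult.commute mult_imp_div_pos_le mult_left_mono power2_less_0 times_divide_eq_right zero_le_power2)
  then show ?thesis by (meson field_le_epsilon)
qed

text \<open>The part of $u$ that is odd in $x$ vanishes on the imaginary axis. On the right half disc it is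
dominated by the barrier $M(y^2 + 2x - x^2) + N x(1-x)/2$, whose Laplacian is $-N$ and which is at
least $M$ on the arc. Both vanish at 0, so their slopes there are ordered.\<close>

lemma half_disc_gradient_bound:
  assumes cont: "continuous_on (cball 0 1) u"
    and M: "\<And>z. z \<in> cball 0 1 \<Longrightarrow> \<bar>u z\<bar> \<le> M"
    and lap: "\<And>z. z \<in> ball 0 1 \<Longrightarrow> \<exists>L. has_lap u z L \<and> \<bar>L\<bar> \<le> N"
    and D: "((\<lambda>t. u (of_real t)) has_real_derivative D) (at 0)"
  shows "D \<le> 2 * M + N / 2"
proof -
  define K where "K = cball (0::complex) 1 \<inter> {z. 0 \<le> Re z}"
  \<comment> \<open>\<open>psi\<close> is the barrier, \<open>g\<close> the odd part of \<open>u\<close> in the real direction minus the barrier\<close>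
  define psi where "psi z = M * ((Im z)\<^sup>2 + 2 * Re z - (Re z)\<^sup>2) + N * (Re z * (1 - Re z)) / 2" for z
  define g where "g z = (1/2) * (u z - u (- cnj z)) - psi z" for z
  have M0: "M \<ge> 0" using M[of 0] by auto
  have N0: "N \<ge> 0" using lap[of 0] by force
  have "closed {z. 0 \<le> Re z}"
    using closed_halfspace_Re_ge[of 0] by simp
  then have cK: "compact K" unfolding K_def by (intro compact_Int_closed) auto
  have iK: "interior K \<subseteq> ball 0 1"
    using interior_mono[of K "cball 0 1"] unfolding K_def by (auto simp: interior_cball)
  have rng: "- cnj z \<in> cball 0 1 \<longleftrightarrow> z \<in> cball 0 1" "- cnj z \<in> ball 0 1 \<longleftrightarrow> z \<in> ball 0 1" for z
    by auto
  have cont2: "continuous_on (cball 0 1) (\<lambda>z. u (- cnj z))"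
    by (rule continuous_on_compose2[OF cont]) (auto intro!: continuous_intros)
  have g_le: "g z \<le> 0" if "z \<in> K" for z
  proof (rule max_principle[OF cK _ _ _ that])
    show "continuous_on K g" unfolding g_def psi_def
      by (intro continuous_intros continuous_on_subset[OF cont] continuous_on_subset[OF cont2])
        (auto simp: K_def)
    show "\<exists>L\<ge>0. has_lap g z L" if "z \<in> interior K" for z
    proof -
      have zb: "z \<in> ball 0 1" using that iK by blast
      obtain L where L: "has_lap u z L" "\<bar>L\<bar> \<le> N" using lap[OF zb] by blast
      obtain L' where L': "has_lap u (- cnj z) L'" "\<bar>L'\<bar> \<le> N" using lap rng(2) zb by blast
      have psi: "has_lap psi z (2 * (- M - N / 2) + 2 * M)"
        by (rule has_lap_quadratic[of _ 0 "2 * M + N / 2" 0])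
          (simp add: psi_def field_simps power2_eq_square)
      have "has_lap g z ((1/2) * (L - L') - (2 * (- M - N / 2) + 2 * M))"
        unfolding g_def
        by (intro has_lap_diff has_lap_cmult L has_lap_reflect L' psi)
      moreover have "(1/2) * (L - L') - (2 * (- M - N / 2) + 2 * M) \<ge> 0" using L(2) L'(2) by argo
      ultimately show ?thesis by blast
    qed
    show "g z \<le> 0" if z: "z \<in> K - interior K" for z
    proof -
      have z1: "cmod z \<le> 1" "Re z \<ge> 0" using z by (auto simp: K_def)
      have x1: "Re z \<le> 1" using z1 complex_Re_le_cmod[of z] by linarith
      have "cmod z = 1 \<or> Re z = 0"
      proof (rule ccontr)
        assume *: "\<not> ?thesis"
        have "open (ball (0::complex) 1 \<inter> {z. 0 < Re z})"
          using open_halfspace_Re_gt[of 0] by (intro open_Int) auto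
        moreover have "z \<in> ball 0 1 \<inter> {z. 0 < Re z}" using * z1 by auto
        moreover have "ball 0 1 \<inter> {z. 0 < Re z} \<subseteq> K" unfolding K_def by auto
        ultimately have "z \<in> interior K" by (meson interior_maximal subsetD)
        then show False using z by blast
      qed
      moreover have "N * (Re z * (1 - Re z)) / 2 \<ge> 0" using N0 z1 x1 by simp
      moreover have "(1/2) * (u z - u (- cnj z)) \<le> M"
        using M[of z] M[of "- cnj z"] z1 by auto
      moreover have ?thesis if "cmod z = 1" "(1/2) * (u z - u (- cnj z)) \<le> M"
          "N * (Re z * (1 - Re z)) / 2 \<ge> 0"
      proof -
        have "(Im z)\<^sup>2 = 1 - (Re z)\<^sup>2"
          using that cmod_power2[of z] by simp
        then have "(Im z)\<^sup>2 + 2 * Re z - (Re z)\<^sup>2 = 1 + 2 * (Re z * (1 - Re z))"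
          by (simp add: algebra_simps power2_eq_square)
        also have "\<dots> \<ge> 1" using z1 x1 by simp
        finally have "M * ((Im z)\<^sup>2 + 2 * Re z - (Re z)\<^sup>2) \<ge> M"
          using M0 mult_left_mono by fastforce
        then show ?thesis using that unfolding g_def psi_def by linarith
      qed
      moreover have ?thesis if "Re z = 0"
      proof -
        have "- cnj z = z" using that by (simp add: complex_eq_iff)
        then show ?thesis using that M0 by (simp add: g_def psi_def)
      qed
      ultimately show ?thesis by blast
    qed
  qed
  define r where "r t = psi (of_real t) - (1/2) * (u (of_real t) - u (of_real (- t)))" for t
  have "((\<lambda>t. u (of_real (-t))) has_real_derivative (- D)) (at 0)"
    using DERIV_mirror[of "\<lambda>t. u (of_real t)" D 0] D by simp
  then have "(r has_real_derivative ((2 * M + N / 2) - (1/2) * (D - (-D)))) (at 0)"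
    unfolding r_def psi_def by (auto intro!: derivative_eq_intros D simp: field_simps)
  then have r': "(r has_real_derivative (2 * M + N / 2 - D)) (at 0)" by simp
  show ?thesis
  proof (rule ccontr)
    assume "\<not> ?thesis"
    then have "2 * M + N / 2 - D < 0" by simp
    from DERIV_neg_dec_right[OF r' this] obtain d where
      d: "d > 0" "\<And>h. 0 < h \<Longrightarrow> h < d \<Longrightarrow> r (0 + h) < r 0" by (auto simp: algebra_simps)
    define h where "h = min d 1 / 2"
    have h: "0 < h" "h < d" "h < 1" using d by (auto simp: h_def)
    have "r h < 0" using d(2)[OF h(1,2)] by (simp add: r_def psi_def)
    moreover have "r h = - g (of_real h)" by (simp add: r_def g_def)
    moreover have "of_real h \<in> K" using h by (simp add: K_def)
    ultimately show False using g_le[of "of_real h"] by simp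
  qed
qed

lemma zpoly_affine:
  assumes "zpoly f" shows "zpoly (\<lambda>z. f (a + b * z))"
  using assms
proof induction
  case (monom c j k)
  have "zpoly (\<lambda>z. (a + b * z) ^ j)" by (intro zpoly_power zpoly.add zpoly_cmult zpoly_const zpoly_id)
  moreover have "zpoly (\<lambda>z. cnj (a + b * z) ^ k)"
    by (intro zpoly_power zpoly_cnj zpoly.add zpoly_cmult zpoly_const zpoly_id)
  ultimately show ?case by (intro zpoly_mult zpoly_const)
next
  case (add f g)
  then show ?case using zpoly.add by blast
qed

lemma
  assumes f: "zpoly f"
  shows dz_affine: "dz (\<lambda>z. f (a + b * z)) = (\<lambda>z. b * dz f (a + b * z))"
    and db_affine: "db (\<lambda>z. f (a + b * z)) = (\<lambda>z. cnj b * db f (a + b * z))"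
proof -
  have "((\<lambda>z. f (a + b * z)) has_derivative
     (\<lambda>h. (b * dz f (a + b * z)) * h + (cnj b * db f (a + b * z)) * cnj h)) (at z)" for z
  proof -
    have 1: "((\<lambda>z. a + b * z) has_derivative (\<lambda>h. b * h)) (at z)"
      by (auto intro!: derivative_eq_intros)
    show ?thesis
      using has_derivative_compose[OF 1 zpoly_wirtinger[OF f]] by (simp add: algebra_simps)
  qed
  from wirtinger_unique[OF this]
  show "dz (\<lambda>z. f (a + b * z)) = (\<lambda>z. b * dz f (a + b * z))"
    "db (\<lambda>z. f (a + b * z)) = (\<lambda>z. cnj b * db f (a + b * z))" by blast+
qed

lemma zpoly_line_derivative:
  assumes "zpoly f"
  shows "((\<lambda>t. Re (f (z + c * of_real t))) has_real_derivative
    Re (c * dz f (z + c * of_real t) + cnj c * db f (z + c * of_real t))) (at t)"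
proof -
  have 1: "((\<lambda>t. z + c * of_real t) has_derivative (\<lambda>h. c * of_real h)) (at t)"
    by (auto intro!: derivative_eq_intros)
  from has_derivative_Re[OF has_derivative_compose[OF 1 zpoly_wirtinger[OF assms]]]
  show ?thesis unfolding has_field_derivative_def
    by (rule has_derivative_eq_rhs) (simp add: fun_eq_iff algebra_simps)
qed

lemma zpoly_has_lap:
  assumes "zpoly f"
  shows "has_lap (\<lambda>z. Re (f z)) z (Re (4 * dz (db f) z))"
proof -
  have *: "second_deriv (\<lambda>t. Re (f (z + c * of_real t)))
     (Re (c * (c * dz (dz f) z + cnj c * db (dz f) z) + cnj c * (c * dz (db f) z + cnj c * db (db f) z)))" for c
  proof -
    have "zpoly (\<lambda>w. c * dz f w + cnj c * db f w)"
      by (intro zpoly.add zpoly_cmult zpoly_dz zpoly_db assms)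
    from zpoly_line_derivative[OF this, of z c 0]
    have "((\<lambda>t. Re (c * dz f (z + c * of_real t) + cnj c * db f (z + c * of_real t))) has_real_derivative
       Re (c * (c * dz (dz f) z + cnj c * dz (db f) z) + cnj c * (c * db (dz f) z + cnj c * db (db f) z))) (at 0)"
      using assms
      by (simp add: dz_add db_add zpoly_cmult zpoly_dz zpoly_db dz_cmult db_cmult)
    then show ?thesis
      unfolding second_deriv_def using zpoly_line_derivative[OF assms, of z c]
      by (intro exI[of _ "\<lambda>t. Re (c * dz f (z + c * of_real t) + cnj c * db f (z + c * of_real t))"])
        (simp add: algebra_simps)
  qed
  show ?thesis unfolding has_lap_def
    using *[of 1] *[of \<i>]
    by (intro exI conjI) (simp only: mult_1, assumption, simp add: db_dz_commute[OF assms])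
qed

lemma norm_le_rotations:
  assumes "\<And>c. cmod c = 1 \<Longrightarrow> Re (c * w) \<le> B"
  shows "cmod w \<le> B"
proof (cases "w = 0")
  case True
  then show ?thesis using assms[of 1] by simp
next
  case False
  have "cnj w / of_real (cmod w) * w = of_real (cmod w)"
    using False by (simp add: field_simps power2_eq_square flip: complex_norm_square of_real_mult)
  then show ?thesis using assms[of "cnj w / of_real (cmod w)"] False by (simp add: norm_divide)
qed

text \<open>The bound for derivatives in one direction, applied to all rotations of $U$ in the target and
to two rotations in the source, controls $\partial U \pm \bar\partial U$.\<close>

lemma zpoly_gradient_bound:
  assumes U: "zpoly U" and d: "d > 0"
    and M: "\<And>z. z \<in> cball z0 d \<Longrightarrow> cmod (U z) \<le> M"
    and N: "\<And>z. z \<in> cball z0 d \<Longrightarrow> cmod (4 * dz (db U) z) \<le> N"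
  shows "cmod (dz U z0) \<le> 2 * M / d + N * d / 2" "cmod (db U z0) \<le> 2 * M / d + N * d / 2"
proof -
  have *: "cmod (e * dz U z0 + cnj e * db U z0) \<le> 2 * M / d + N * d / 2" if e: "cmod e = 1" for e
  proof (rule norm_le_rotations)
    fix c :: complex assume c: "cmod c = 1"
    define V where "V z = c * U (z0 + (e * of_real d) * z)" for z
    have V: "zpoly V" unfolding V_def by (intro zpoly_cmult zpoly_affine U)
    have dbV: "db V = (\<lambda>z. c * (cnj (e * of_real d) * db U (z0 + (e * of_real d) * z)))"
      unfolding V_def using db_cmult[OF zpoly_affine[OF U]] db_affine[OF U] by simp
    have dzV: "dz V = (\<lambda>z. c * ((e * of_real d) * dz U (z0 + (e * of_real d) * z)))"
      unfolding V_def using dz_cmult[OF zpoly_affine[OF U]] dz_affine[OF U] by simp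
    have lapV: "dz (db V) = (\<lambda>z. c * (cnj (e * of_real d) * ((e * of_real d) * dz (db U) (z0 + (e * of_real d) * z))))"
      unfolding dbV using U
      by (simp only: dz_cmult[OF zpoly_cmult[OF zpoly_affine[OF zpoly_db[OF U]]]]
          dz_cmult[OF zpoly_affine[OF zpoly_db[OF U]]] dz_affine[OF zpoly_db[OF U]])
    have rng: "z0 + (e * of_real d) * z \<in> cball z0 d" if "z \<in> cball 0 1" for z
      using that d e by (simp add: dist_norm norm_mult mult_left_le)
    have "Re (dz V 0 + db V 0) \<le> 2 * M + (N * d\<^sup>2) / 2"
    proof (rule half_disc_gradient_bound)
      show "continuous_on (cball 0 1) (\<lambda>z. Re (V z))"
        by (intro continuous_intros zpoly_continuous V)
      show "\<bar>Re (V z)\<bar> \<le> M" if "z \<in> cball 0 1" for z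
      proof -
        have "\<bar>Re (V z)\<bar> \<le> cmod (V z)" by (rule abs_Re_le_cmod)
        also have "\<dots> \<le> M" unfolding V_def using M[OF rng[OF that]] c by (simp add: norm_mult)
        finally show ?thesis .
      qed
      show "\<exists>L. has_lap (\<lambda>z. Re (V z)) z L \<and> \<bar>L\<bar> \<le> N * d\<^sup>2" if "z \<in> ball 0 1" for z
      proof (intro exI conjI)
        show "has_lap (\<lambda>z. Re (V z)) z (Re (4 * dz (db V) z))" by (rule zpoly_has_lap[OF V])
        have "\<bar>Re (4 * dz (db V) z)\<bar> \<le> cmod (4 * dz (db V) z)" by (rule abs_Re_le_cmod)
        also have "\<dots> = d\<^sup>2 * cmod (4 * dz (db U) (z0 + (e * of_real d) * z))"
          unfolding lapV using c e d by (simp add: norm_mult power2_eq_square)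
        also have "\<dots> \<le> d\<^sup>2 * N"
          using that by (intro mult_left_mono N rng) auto
        finally show "\<bar>Re (4 * dz (db V) z)\<bar> \<le> N * d\<^sup>2" by (simp add: mult.commute)
      qed
      show "((\<lambda>t. Re (V (complex_of_real t))) has_real_derivative Re (dz V 0 + db V 0)) (at 0)"
        using zpoly_line_derivative[OF V, of 0 1 0] by simp
    qed
    moreover have "Re (dz V 0 + db V 0) = d * Re (c * (e * dz U z0 + cnj e * db U z0))"
      unfolding dzV dbV by (simp add: algebra_simps)
    ultimately have "d * Re (c * (e * dz U z0 + cnj e * db U z0)) \<le> 2 * M + (N * d\<^sup>2) / 2" by simp
    then show "Re (c * (e * dz U z0 + cnj e * db U z0)) \<le> 2 * M / d + N * d / 2"
      using d by (simp add: field_simps power2_eq_square)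
  qed
  define B where "B = 2 * M / d + N * d / 2"
  have 1: "cmod (dz U z0 + db U z0) \<le> B" using *[of 1] by (simp add: B_def)
  have "\<i> * dz U z0 + cnj \<i> * db U z0 = \<i> * (dz U z0 - db U z0)" by (simp add: algebra_simps)
  then have 2: "cmod (dz U z0 - db U z0) \<le> B" using *[of \<i>] by (simp add: norm_mult B_def)
  have "2 * dz U z0 = (dz U z0 + db U z0) + (dz U z0 - db U z0)"
       "2 * db U z0 = (dz U z0 + db U z0) - (dz U z0 - db U z0)" by simp_all
  then have "cmod (2 * dz U z0) \<le> B + B" "cmod (2 * db U z0) \<le> B + B"
    using norm_triangle_mono[OF 1 2] norm_triangle_ineq4[of "dz U z0 + db U z0" "dz U z0 - db U z0"] 1 2 by auto
  then show "cmod (dz U z0) \<le> 2 * M / d + N * d / 2" "cmod (db U z0) \<le> 2 * M / d + N * d / 2"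
    unfolding B_def[symmetric] by (simp_all add: norm_mult)
qed

section \<open>The Poisson equation and approximate pseudoanalytic functions\<close>

text \<open>The barrier is $N(1-|z|^2)/4$, the solution of $\Delta w = -N$ with zero boundary values.\<close>

lemma disc_comparison:
  assumes cont: "continuous_on (cball 0 1) u"
    and lap: "\<And>z. z \<in> ball 0 1 \<Longrightarrow> \<exists>L. has_lap u z L \<and> \<bar>L\<bar> \<le> N"
    and bd: "\<And>z. cmod z = 1 \<Longrightarrow> u z \<le> b"
    and z: "cmod z \<le> 1"
  shows "u z \<le> b + N * (1 - (cmod z)\<^sup>2) / 4"
proof -
  define w where "w z = u z - N * (1 - (cmod z)\<^sup>2) / 4" for z
  have "w z \<le> b"
  proof (rule max_principle[of "cball 0 1"])
    show "continuous_on (cball 0 1) w" unfolding w_def by (auto intro!: continuous_intros cont)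
    show "\<exists>L\<ge>0. has_lap w y L" if "y \<in> interior (cball 0 1)" for y
    proof -
      have "y \<in> ball 0 1" using that by simp
      then obtain L where L: "has_lap u y L" "\<bar>L\<bar> \<le> N" using lap by blast
      have "has_lap (\<lambda>z. N * (1 - (cmod z)\<^sup>2) / 4) y (2 * (- N / 4) + 2 * (- N / 4))"
        by (rule has_lap_quadratic[of _ "N / 4" 0 0]) (simp add: cmod_power2 field_simps)
      from has_lap_diff[OF L(1) this] have "has_lap w y (L + N)" by (simp add: w_def[abs_def])
      then show ?thesis using L(2) by (intro exI[of _ "L + N"]) auto
    qed
  qed (use bd z in \<open>auto simp: w_def\<close>)
  then show ?thesis by (simp add: w_def)
qed

lemma zero_boundary_bound:
  assumes u: "zpoly u" and bd: "\<And>z. cmod z = 1 \<Longrightarrow> u z = 0"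
    and N: "\<And>z. cmod z \<le> 1 \<Longrightarrow> cmod (4 * dz (db u) z) \<le> N"
    and z: "cmod z \<le> 1"
  shows "cmod (u z) \<le> N * (1 - (cmod z)\<^sup>2) / 4"
proof (rule norm_le_rotations)
  fix c :: complex assume c: "cmod c = 1"
  have cu: "zpoly (\<lambda>z. c * u z)" by (intro zpoly_cmult u)
  have l: "dz (db (\<lambda>z. c * u z)) = (\<lambda>z. c * dz (db u) z)"
    using u by (simp add: db_cmult dz_cmult zpoly_db)
  have "Re (c * u z) \<le> 0 + N * (1 - (cmod z)\<^sup>2) / 4"
  proof (rule disc_comparison[OF _ _ _ z])
    show "continuous_on (cball 0 1) (\<lambda>z. Re (c * u z))"
      by (intro continuous_intros zpoly_continuous u)
    show "\<exists>L. has_lap (\<lambda>z. Re (c * u z)) y L \<and> \<bar>L\<bar> \<le> N" if "y \<in> ball 0 1" for y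
    proof (intro exI conjI)
      show "has_lap (\<lambda>z. Re (c * u z)) y (Re (4 * dz (db (\<lambda>z. c * u z)) y))"
        by (rule zpoly_has_lap[OF cu])
      have "\<bar>Re (4 * dz (db (\<lambda>z. c * u z)) y)\<bar> \<le> cmod (4 * dz (db (\<lambda>z. c * u z)) y)"
        by (rule abs_Re_le_cmod)
      also have "\<dots> = cmod (4 * dz (db u) y)" unfolding l using c by (simp add: norm_mult)
      also have "\<dots> \<le> N" using N that by simp
      finally show "\<bar>Re (4 * dz (db (\<lambda>z. c * u z)) y)\<bar> \<le> N" .
    qed
  qed (simp add: bd)
  then show "Re (c * u z) \<le> N * (1 - (cmod z)\<^sup>2) / 4" by simp
qed

text \<open>Since $u$ vanishes on the circle, $|u| \le N d$ on the disc of radius $d = 1-|z|$ about $z$;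
so the factor $1/d$ of the interior gradient bound cancels, and the bound
holds up to the boundary.\<close>

lemma zero_boundary_gradient_bound:
  assumes u: "zpoly u" and bd: "\<And>z. cmod z = 1 \<Longrightarrow> u z = 0"
    and N: "\<And>z. cmod z \<le> 1 \<Longrightarrow> cmod (4 * dz (db u) z) \<le> N"
    and z: "cmod z \<le> 1"
  shows "cmod (dz u z) \<le> 3 * N" "cmod (db u z) \<le> 3 * N"
proof -
  have N0: "N \<ge> 0" using N[of 0] order_trans[OF norm_ge_zero] by fastforce
  have int: "cmod (dz u z) \<le> 3 * N \<and> cmod (db u z) \<le> 3 * N" if z: "z \<in> ball 0 1" for z
  proof -
    define d where "d = 1 - cmod z"
    have d: "0 < d" "d \<le> 1" using z by (auto simp: d_def)
    have 1: "cmod y \<le> 1" "cmod y \<ge> 1 - 2 * d" if "y \<in> cball z d" for y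
      using that norm_triangle_ineq2[of y z] norm_triangle_ineq2[of z y]
      by (auto simp: d_def dist_norm norm_minus_commute)
    have 2: "cmod (u y) \<le> N * d" if "y \<in> cball z d" for y
    proof -
      have "1 - (cmod y)\<^sup>2 = (1 - cmod y) * (1 + cmod y)" by (simp add: power2_eq_square algebra_simps)
      also have "\<dots> \<le> (2 * d) * 2" using 1[OF that] d by (intro mult_mono) auto
      finally have "N * (1 - (cmod y)\<^sup>2) \<le> N * (4 * d)" using N0 by (intro mult_left_mono) auto
      then show ?thesis using zero_boundary_bound[OF u bd N 1(1)[OF that]] by simp
    qed
    have "2 * (N * d) / d + N * d / 2 \<le> 3 * N"
      using d N0 mult_left_mono[of d 1 N] by simp
    with zpoly_gradient_bound[OF u d(1), of z "N * d" N, OF 2 N[OF 1(1)]] show ?thesis by linarith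
  qed
  have cl: "z \<in> closure (ball 0 1)" using z by simp
  show "cmod (dz u z) \<le> 3 * N" "cmod (db u z) \<le> 3 * N"
    by (rule continuous_on_closure_norm_le[OF zpoly_continuous _ cl]; use int u in blast)+
qed

lemma zpoly_Poisson:
  assumes p: "zpoly p" and N: "\<And>z. cmod z \<le> 1 \<Longrightarrow> cmod (p z) \<le> N"
  obtains u where "zpoly u" "\<And>z. 4 * dz (db u) z = p z" "(\<forall>z. Im (p z) = 0) \<longrightarrow> (\<forall>z. Im (u z) = 0)"
    "\<And>z. cmod z \<le> 1 \<Longrightarrow> cmod (u z) \<le> N / 4"
    "\<And>z. cmod z \<le> 1 \<Longrightarrow> cmod (dz u z) \<le> 3 * N"
    "\<And>z. cmod z \<le> 1 \<Longrightarrow> cmod (db u z) \<le> 3 * N"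
proof -
  obtain u where u: "zpoly u" "\<And>z. 4 * dz (db u) z = p z" "\<And>z. cmod z = 1 \<Longrightarrow> u z = 0"
     "(\<forall>z. Im (p z) = 0) \<longrightarrow> (\<forall>z. Im (u z) = 0)"
    using zpoly_Dirichlet[OF p zpoly_const[of 0]] zpoly_Dirichlet_real[OF p zpoly_const[of 0]]
    by (metis zero_complex.simps(2))
  have N': "cmod (4 * dz (db u) z) \<le> N" if "cmod z \<le> 1" for z
    using N[OF that] unfolding u(2) .
  have N0: "N \<ge> 0" using N[of 0] order_trans[OF norm_ge_zero] by fastforce
  have "cmod (u z) \<le> N / 4" if "cmod z \<le> 1" for z
  proof -
    have "N * (1 - (cmod z)\<^sup>2) \<le> N * 1" using N0 by (intro mult_left_mono) auto
    then show ?thesis using zero_boundary_bound[OF u(1,3) N' that] by simp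
  qed
  with that u zero_boundary_gradient_bound[OF u(1,3) N'] show ?thesis by blast
qed

lemma zpoly_dbar:
  assumes p: "zpoly p" and N: "\<And>z. cmod z \<le> 1 \<Longrightarrow> cmod (p z) \<le> N"
  obtains s where "zpoly s" "\<And>z. db s z = p z" "\<And>z. cmod z \<le> 1 \<Longrightarrow> cmod (s z) \<le> 12 * N"
proof -
  obtain u where u: "zpoly u" "\<And>z. 4 * dz (db u) z = p z" "\<And>z. cmod z \<le> 1 \<Longrightarrow> cmod (dz u z) \<le> 3 * N"
    using zpoly_Poisson[OF p N] by metis
  show ?thesis
  proof (rule that[of "\<lambda>z. 4 * dz u z"])
    show "db (\<lambda>z. 4 * dz u z) z = p z" for z
      using u(2) by (simp add: db_cmult[OF zpoly_dz[OF u(1)]] db_dz_commute[OF u(1)])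
    show "cmod (4 * dz u z) \<le> 12 * N" if "cmod z \<le> 1" for z
      using u(3)[OF that] by (simp add: norm_mult)
  qed (intro zpoly_cmult zpoly_dz u)
qed

text \<open>An iteration from the constant 1: subtracting a $w$ with $\Delta w$ close to the residual leaves the
residual $-qw$, up to the approximation error. This at least halves the residual, because
$|w|$ is at most about a quarter of it and $|q| \le 1/2$. The corrections add up to a
geometric series.\<close>

lemma approx_positive_solution_step:
  fixes q :: "complex \<Rightarrow> real"
  assumes cont: "continuous_on (cball 0 1) q" and q: "\<And>z. cmod z \<le> 1 \<Longrightarrow> \<bar>q z\<bar> \<le> e"
    and e: "0 < e" "e \<le> 1/2"
  shows "\<exists>\<phi>. zpoly \<phi> \<and> (\<forall>z. Im (\<phi> z) = 0) \<and> (\<forall>z. cmod z \<le> 1 \<longrightarrow>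
     cmod (\<phi> z - 1) \<le> e - e / 2 ^ n \<and> cmod (db \<phi> z) \<le> 8 * (e - e / 2 ^ n) \<and>
     \<bar>Re (4 * dz (db \<phi>) z) + q z * Re (\<phi> z)\<bar> \<le> e / 2 ^ n)"
proof (induction n)
  case 0
  show ?case by (rule exI[of _ "\<lambda>z. 1"]) (use q in auto)
next
  case (Suc n)
  define \<rho> where "\<rho> = e / 2 ^ n"
  have \<rho>: "\<rho> > 0" using e by (simp add: \<rho>_def)
  obtain \<phi> where \<phi>: "zpoly \<phi>" "\<And>z. Im (\<phi> z) = 0" and \<phi>b: "\<And>z. cmod z \<le> 1 \<Longrightarrow>
     cmod (\<phi> z - 1) \<le> e - \<rho> \<and> cmod (db \<phi> z) \<le> 8 * (e - \<rho>) \<and>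
     \<bar>Re (4 * dz (db \<phi>) z) + q z * Re (\<phi> z)\<bar> \<le> \<rho>"
    using Suc unfolding \<rho>_def by blast
  define r where "r z = Re (4 * dz (db \<phi>) z) + q z * Re (\<phi> z)" for z
  have "continuous_on (cball 0 1) r" unfolding r_def
    by (intro continuous_intros cont zpoly_continuous zpoly_dz zpoly_db \<phi>)
  from zpoly_dense_real[OF compact_cball this, of "\<rho> / 8"] \<rho>
  obtain p where p: "zpoly p" "\<And>z. Im (p z) = 0" "\<And>z. cmod z \<le> 1 \<Longrightarrow> \<bar>r z - Re (p z)\<bar> \<le> \<rho> / 8"
    by auto
  have "cmod (p z) \<le> 9 * \<rho> / 8" if "cmod z \<le> 1" for z
  proof -
    have "cmod (p z) = \<bar>Re (p z)\<bar>" using p(2) by (simp add: cmod_def)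
    also have "\<dots> \<le> \<bar>r z\<bar> + \<bar>r z - Re (p z)\<bar>" by linarith
    also have "\<dots> \<le> \<rho> + \<rho> / 8" using p(3)[OF that] \<phi>b[OF that] unfolding r_def by linarith
    finally show ?thesis by simp
  qed
  from zpoly_Poisson[OF p(1) this] p(2)
  obtain w where w: "zpoly w" "\<And>z. 4 * dz (db w) z = p z" "\<And>z. Im (w z) = 0"
    "\<And>z. cmod z \<le> 1 \<Longrightarrow> cmod (w z) \<le> 9 * \<rho> / 8 / 4"
    "\<And>z. cmod z \<le> 1 \<Longrightarrow> cmod (db w z) \<le> 3 * (9 * \<rho> / 8)" by metis
  have half: "e / 2 ^ Suc n = \<rho> / 2" by (simp add: \<rho>_def)
  show ?case unfolding half
  proof (intro exI[of _ "\<lambda>z. \<phi> z - w z"] conjI allI impI)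
    fix z :: complex assume z: "cmod z \<le> 1"
    show "cmod (\<phi> z - w z - 1) \<le> e - \<rho> / 2"
      using \<phi>b[OF z] w(4)[OF z] norm_triangle_ineq4[of "\<phi> z - 1" "w z"] \<rho> by (simp add: algebra_simps)
    show "cmod (db (\<lambda>z. \<phi> z - w z) z) \<le> 8 * (e - \<rho> / 2)"
      using \<phi>b[OF z] w(5)[OF z] norm_triangle_ineq4[of "db \<phi> z" "db w z"] \<rho>
      by (simp add: db_diff \<phi> w)
    have lap: "4 * dz (db (\<lambda>z. \<phi> z - w z)) z = 4 * dz (db \<phi>) z - p z"
      by (simp add: db_diff dz_diff zpoly_db \<phi> w(1) flip: w(2))
    have "Re (4 * dz (db (\<lambda>z. \<phi> z - w z)) z) + q z * Re (\<phi> z - w z)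
       = (r z - Re (p z)) - q z * Re (w z)"
      unfolding lap r_def by (simp add: algebra_simps)
    moreover have "\<bar>q z * Re (w z)\<bar> \<le> e * (9 * \<rho> / 8 / 4)"
      using q[OF z] order_trans[OF abs_Re_le_cmod w(4)[OF z]] unfolding abs_mult
      by (intro mult_mono) (use e in auto)
    moreover have "e * (9 * \<rho> / 8 / 4) \<le> (1/2) * (9 * \<rho> / 8 / 4)"
      using e \<rho> by (intro mult_right_mono) auto
    ultimately show "\<bar>Re (4 * dz (db (\<lambda>z. \<phi> z - w z)) z) + q z * Re (\<phi> z - w z)\<bar> \<le> \<rho> / 2"
      using p(3)[OF z] \<rho> by linarith
  qed (use \<phi> w in auto)
qed

lemma approx_positive_solution:
  fixes q :: "complex \<Rightarrow> real"
  assumes cont: "continuous_on (cball 0 1) q" and q: "\<And>z. cmod z \<le> 1 \<Longrightarrow> \<bar>q z\<bar> \<le> e"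
    and e: "0 < e" "e \<le> 1/2" and \<tau>: "\<tau> > 0"
  obtains \<phi> where "zpoly \<phi>" "\<And>z. Im (\<phi> z) = 0" "\<And>z. cmod z \<le> 1 \<Longrightarrow> cmod (\<phi> z - 1) \<le> e"
    "\<And>z. cmod z \<le> 1 \<Longrightarrow> cmod (db \<phi> z) \<le> 8 * e"
    "\<And>z. cmod z \<le> 1 \<Longrightarrow> \<bar>Re (4 * dz (db \<phi>) z) + q z * Re (\<phi> z)\<bar> \<le> \<tau>"
proof -
  obtain n where n: "inverse (2 ^ n) < \<tau> / e" using real_arch_pow_inv[of "\<tau> / e" "1/2"] \<tau> e
    by (auto simp: power_one_over inverse_eq_divide)
  then have "e / 2 ^ n \<le> \<tau>" using e by (simp add: field_simps)
  moreover have "e / 2 ^ n \<ge> 0" using e by simp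
  moreover obtain \<phi> where \<phi>: "zpoly \<phi>" "\<And>z. Im (\<phi> z) = 0" "\<And>z. cmod z \<le> 1 \<Longrightarrow>
     cmod (\<phi> z - 1) \<le> e - e / 2 ^ n \<and> cmod (db \<phi> z) \<le> 8 * (e - e / 2 ^ n) \<and>
     \<bar>Re (4 * dz (db \<phi>) z) + q z * Re (\<phi> z)\<bar> \<le> e / 2 ^ n"
    using approx_positive_solution_step[OF cont q e, of n] by blast
  ultimately show ?thesis
    by (intro that[OF \<phi>(1,2)]) (use \<phi>(3) in force)+
qed

text \<open>Polynomial data for the Dirichlet problem that $F$ solves, with right-hand side $-qF$. By the
comparison principle its polynomial solution is uniformly close to $F$. In contrast to
$F$, it has derivatives in the closed disc that can be used freely.\<close>

lemma approx_solution:
  fixes q F :: "complex \<Rightarrow> real"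
  assumes contF: "continuous_on (cball 0 1) F"
    and cont: "continuous_on (cball 0 1) q" and q: "\<And>z. cmod z \<le> 1 \<Longrightarrow> \<bar>q z\<bar> \<le> 1"
    and lap: "\<And>z. cmod z < 1 \<Longrightarrow> has_lap F z (- q z * F z)" and \<tau>: "\<tau> > 0"
  obtains f where "zpoly f" "\<And>z. Im (f z) = 0" "\<And>z. cmod z \<le> 1 \<Longrightarrow> \<bar>Re (f z) - F z\<bar> \<le> \<tau>"
    "\<And>z. cmod z \<le> 1 \<Longrightarrow> \<bar>Re (4 * dz (db f) z) + q z * Re (f z)\<bar> \<le> \<tau>"
proof -
  define \<sigma> where "\<sigma> = \<tau> / 3"
  have \<sigma>: "\<sigma> > 0" using \<tau> by (simp add: \<sigma>_def)
  have "continuous_on (cball 0 1) (\<lambda>z. - q z * F z)" by (intro continuous_intros assms)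
  from zpoly_dense_real[OF compact_cball this \<sigma>] obtain p where
    p: "zpoly p" "\<And>z. Im (p z) = 0" "\<And>z. cmod z \<le> 1 \<Longrightarrow> \<bar>- q z * F z - Re (p z)\<bar> \<le> \<sigma>" by auto
  from zpoly_dense_real[OF compact_cball contF \<sigma>] obtain g where
    g: "zpoly g" "\<And>z. Im (g z) = 0" "\<And>z. cmod z \<le> 1 \<Longrightarrow> \<bar>F z - Re (g z)\<bar> \<le> \<sigma>" by auto
  obtain f where f: "zpoly f" "\<And>z. Im (f z) = 0" "\<And>z. 4 * dz (db f) z = p z"
    "\<And>z. cmod z = 1 \<Longrightarrow> f z = g z"
    using zpoly_Dirichlet_real[OF p(1) g(1) p(2) g(2)] by blast
  have lapf: "has_lap (\<lambda>z. Re (f z)) z (Re (p z))" for z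
    using zpoly_has_lap[OF f(1), of z] f(3) by simp
  have contf: "continuous_on (cball 0 1) (\<lambda>z. Re (f z))"
    by (intro continuous_intros zpoly_continuous f)
  have quarter: "\<sigma> * (1 - (cmod z)\<^sup>2) / 4 \<le> \<sigma>" for z
  proof -
    have "\<sigma> * (1 - (cmod z)\<^sup>2) \<le> \<sigma> * 1" using \<sigma> by (intro mult_left_mono) auto
    then show ?thesis using \<sigma> by linarith
  qed
  have close: "\<bar>Re (f z) - F z\<bar> \<le> 2 * \<sigma>" if z: "cmod z \<le> 1" for z
  proof -
    have "Re (f z) - F z \<le> \<sigma> + \<sigma> * (1 - (cmod z)\<^sup>2) / 4"
    proof (rule disc_comparison[OF _ _ _ z])
      show "continuous_on (cball 0 1) (\<lambda>z. Re (f z) - F z)" by (intro continuous_intros contf contF)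
      show "\<exists>L. has_lap (\<lambda>z. Re (f z) - F z) y L \<and> \<bar>L\<bar> \<le> \<sigma>" if "y \<in> ball 0 1" for y
        using has_lap_diff[OF lapf[of y] lap[of y]] p(3)[of y] that by (intro exI[of _ "Re (p y) - - q y * F y"]) auto
      show "Re (f y) - F y \<le> \<sigma>" if "cmod y = 1" for y
        using g(3)[of y] f(4)[OF that] that by auto
    qed
    moreover have "F z - Re (f z) \<le> \<sigma> + \<sigma> * (1 - (cmod z)\<^sup>2) / 4"
    proof (rule disc_comparison[OF _ _ _ z])
      show "continuous_on (cball 0 1) (\<lambda>z. F z - Re (f z))" by (intro continuous_intros contf contF)
      show "\<exists>L. has_lap (\<lambda>z. F z - Re (f z)) y L \<and> \<bar>L\<bar> \<le> \<sigma>" if "y \<in> ball 0 1" for y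
        using has_lap_diff[OF lap[of y] lapf[of y]] p(3)[of y] that by (intro exI[of _ "- q y * F y - Re (p y)"]) auto
      show "F y - Re (f y) \<le> \<sigma>" if "cmod y = 1" for y
        using g(3)[of y] f(4)[OF that] that by auto
    qed
    ultimately show ?thesis using quarter[of z] by linarith
  qed
  have res: "\<bar>Re (4 * dz (db f) z) + q z * Re (f z)\<bar> \<le> \<tau>" if z: "cmod z \<le> 1" for z
  proof -
    have "\<bar>q z * (Re (f z) - F z)\<bar> \<le> 1 * (2 * \<sigma>)"
      unfolding abs_mult using q[OF z] close[OF z] by (intro mult_mono) auto
    moreover have "Re (4 * dz (db f) z) + q z * Re (f z) = (Re (p z) + q z * F z) + q z * (Re (f z) - F z)"
      unfolding f(3) by (simp add: algebra_simps)
    moreover have "\<bar>Re (p z) + q z * F z\<bar> \<le> \<sigma>" using p(3)[OF z] by linarith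
    ultimately show ?thesis
      using abs_triangle_ineq[of "Re (p z) + q z * F z" "q z * (Re (f z) - F z)"] by (simp only:) (simp add: \<sigma>_def)
  qed
  have close': "\<bar>Re (f z) - F z\<bar> \<le> \<tau>" if "cmod z \<le> 1" for z
    using close[OF that] \<tau> by (simp add: \<sigma>_def)
  show ?thesis by (rule that[OF f(1,2) close' res])
qed

text \<open>The Poincare lemma in Wirtinger form: the real one-form $2\,\mathrm{Re}(g\,dz)$ is closed exactly if
$\bar\partial g$ is real. An antiderivative of $g$ for $\partial$ has to be corrected by an
antiholomorphic function only.\<close>

lemma zpoly_real_potential:
  assumes g: "zpoly g" and 0: "\<And>z. Im (db g z) = 0"
  obtains v where "zpoly v" "\<And>z. Im (v z) = 0" "\<And>z. dz v z = g z" "\<And>z. db v z = cnj (g z)" "v 0 = 0"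
proof -
  obtain V where V: "zpoly V" "dz V = g" using zpoly_dz_antiderivative[OF g] by blast
  define \<beta> where "\<beta> z = cnj (g z) - db V z" for z
  have \<beta>: "zpoly \<beta>" unfolding \<beta>_def by (intro zpoly_diff zpoly_cnj zpoly_db V g)
  have "dz \<beta> = (\<lambda>z. cnj (db g z) - dz (db V) z)"
    unfolding \<beta>_def by (simp add: dz_diff zpoly_cnj zpoly_db V g dz_cnj)
  also have "\<dots> = (\<lambda>z. 0)"
    using 0 by (simp add: db_dz_commute[OF V(1), symmetric] V(2) complex_eq_iff fun_eq_iff)
  finally have "db (\<lambda>z. cnj (\<beta> z)) = (\<lambda>z. 0)" by (simp add: db_cnj[OF \<beta>])
  then obtain G where G: "zpoly G" "dz G = (\<lambda>z. cnj (\<beta> z))" "\<And>z. db G z = 0"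
    using zpoly_holomorphic_antiderivative[OF zpoly_cnj[OF \<beta>]] by (auto simp: fun_eq_iff)
  define W where "W z = V z + cnj (G z)" for z
  have W: "zpoly W" "dz W = g" "db W = (\<lambda>z. cnj (g z))"
    unfolding W_def using V G
    by (auto simp: dz_add db_add zpoly_cnj dz_cnj db_cnj \<beta>_def fun_eq_iff intro!: zpoly.add)
  have ReW: "((\<lambda>z. complex_of_real (Re (W z) - Re (W 0))) has_derivative (\<lambda>h. g z * h + cnj (g z) * cnj h)) (at z)" for z
  proof -
    have "((\<lambda>z. complex_of_real (Re (W z) - Re (W 0))) has_derivative (\<lambda>h. of_real (Re (g z * h + cnj (g z) * cnj h) - 0))) (at z)"
      using zpoly_wirtinger[OF W(1)] unfolding W(2,3)
      by (intro has_derivative_of_real has_derivative_diff has_derivative_Re has_derivative_const)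
    then show ?thesis
      by (rule has_derivative_eq_rhs) (simp add: fun_eq_iff complex_eq_iff)
  qed
  show ?thesis
  proof (rule that[of "\<lambda>z. complex_of_real (Re (W z) - Re (W 0))"])
    show "zpoly (\<lambda>z. complex_of_real (Re (W z) - Re (W 0)))"
      using zpoly_diff[OF zpoly_Re[OF W(1)] zpoly_const[of "of_real (Re (W 0))"]] by simp
  qed (use wirtinger_unique[OF ReW] in auto)
qed

lemma real_zpoly_db: 
  assumes "zpoly f" "\<And>z. Im (f z) = 0" shows "db f z = cnj (dz f z)"
proof -
  have "(\<lambda>z. cnj (f z)) = f" using assms by (simp add: fun_eq_iff complex_eq_iff)
  then show ?thesis using db_cnj[OF assms(1)] by simp
qed


lemma gradient_imp_growth_bound:
  assumes v: "zpoly v" and 0: "v 0 = 0" and z: "cmod z \<le> a"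
    and B: "\<And>z. cmod z \<le> a \<Longrightarrow> cmod (dz v z) \<le> B" "\<And>z. cmod z \<le> a \<Longrightarrow> cmod (db v z) \<le> B"
  shows "cmod (v z) \<le> 2 * B * a"
proof -
  have a: "0 \<le> a" using z norm_ge_zero[of z] by linarith
  have B0: "0 \<le> B" using B(1)[OF z] norm_ge_zero[of "dz v z"] by linarith
  have "norm (v z - v 0) \<le> (2 * B) * norm (z - 0)"
  proof (rule differentiable_bound)
    show "(v has_derivative (\<lambda>h. dz v x * h + db v x * cnj h)) (at x within cball 0 a)" for x
      using zpoly_wirtinger[OF v] has_derivative_at_withinI by blast
    show "onorm (\<lambda>h. dz v x * h + db v x * cnj h) \<le> 2 * B" if "x \<in> cball 0 a" for x
    proof (rule onorm_le)
      fix h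
      have "norm (dz v x * h + db v x * cnj h) \<le> cmod (dz v x) * cmod h + cmod (db v x) * cmod h"
        using norm_triangle_ineq[of "dz v x * h" "db v x * cnj h"] by (simp add: norm_mult)
      also have "\<dots> \<le> B * cmod h + B * cmod h"
        using B[of x] that by (intro add_mono mult_right_mono) auto
      finally show "norm (dz v x * h + db v x * cnj h) \<le> 2 * B * norm h" by simp
    qed
  qed (use z a in auto)
  also have "\<dots> \<le> (2 * B) * a" using z B0 by (intro mult_left_mono) auto
  finally show ?thesis using 0 by simp
qed

text \<open>The function $W = \varphi f + i v$, with polynomial approximations $\varphi$ of a positive
solution and $f$ of $F$. The field $\varphi\nabla f - f\nabla\varphi$ has the small divergence
$\kappa = \varphi\Delta f - f\Delta\varphi$; subtracting $\nabla k$ with $\Delta k = \kappa$ makes it exactly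
divergence free, so that $v$ exists, at the price of the error $\bar\partial k$ in the
equation for $W$. The last conclusion is the gradient bound for $f$, integrated from $v(0)=0$.\<close>

lemma approx_pseudoanalytic:
  fixes q F :: "complex \<Rightarrow> real"
  assumes contF: "continuous_on (cball 0 1) F"
    and cont: "continuous_on (cball 0 1) q" and q: "\<And>z. cmod z \<le> 1 \<Longrightarrow> \<bar>q z\<bar> \<le> e"
    and e: "0 < e" "e \<le> 1/2"
    and lap: "\<And>z. cmod z < 1 \<Longrightarrow> has_lap F z (- q z * F z)" and \<tau>: "\<tau> > 0"
  obtains W b \<phi> where "zpoly W" "continuous_on (cball 0 1) b"
    "\<And>z. cmod z \<le> 1 \<Longrightarrow> cmod (b z) \<le> 16 * e"
    "\<And>z. cmod z \<le> 1 \<Longrightarrow> cmod (db W z - b z * (W z + cnj (W z))) \<le> \<tau>"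
    "\<And>z. cmod z \<le> 1 \<Longrightarrow> 1/2 \<le> \<phi> z \<and> \<phi> z \<le> (3/2 :: real)"
    "\<And>z. cmod z \<le> 1 \<Longrightarrow> \<bar>Re (W z) - \<phi> z * F z\<bar> \<le> \<tau>"
    "\<And>\<alpha> \<beta> M z. 0 < \<alpha> \<Longrightarrow> \<alpha> < \<beta> \<Longrightarrow> \<beta> \<le> 1 \<Longrightarrow> (\<And>z. cmod z \<le> \<beta> \<Longrightarrow> \<bar>F z\<bar> \<le> M) \<Longrightarrow>
       cmod z \<le> \<alpha> \<Longrightarrow> cmod (W z) \<le> 20 * \<beta> / (\<beta> - \<alpha>) * (M + \<tau>)"
proof -
  obtain M0 where M0: "\<And>z. cmod z \<le> 1 \<Longrightarrow> \<bar>F z\<bar> \<le> M0"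
    using compact_imp_bounded[OF compact_continuous_image[OF contF compact_cball]]
    unfolding bounded_iff by (metis dist_0_norm image_eqI mem_cball real_norm_def)
  have M00: "M0 \<ge> 0" using M0[of 0] by auto
  \<comment> \<open>the divergence of the approximate field is at most \<open>\<sigma> * (M0 + 3)\<close>, and solving the Poisson
    equation for its correction costs a factor 3\<close>
  define \<sigma> where "\<sigma> = min (\<tau> / (3 * (M0 + 3))) 1"
  have \<sigma>: "0 < \<sigma>" "\<sigma> \<le> 1" "3 * (\<sigma> * (M0 + 3)) \<le> \<tau>"
  proof -
    have "\<sigma> \<le> \<tau> / (3 * (M0 + 3))" by (simp add: \<sigma>_def)
    then show "3 * (\<sigma> * (M0 + 3)) \<le> \<tau>" using M00 by (simp add: field_simps)
  qed (use \<tau> M00 in \<open>auto simp: \<sigma>_def\<close>)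
  have \<sigma>': "9 * \<sigma> \<le> \<tau>" 
  proof -
    have "\<sigma> * 3 \<le> \<sigma> * (M0 + 3)" using \<sigma>(1) M00 by (intro mult_left_mono) auto
    then show ?thesis using \<sigma>(3) by linarith
  qed
  obtain \<phi> where \<phi>: "zpoly \<phi>" "\<And>z. Im (\<phi> z) = 0" "\<And>z. cmod z \<le> 1 \<Longrightarrow> cmod (\<phi> z - 1) \<le> e"
    "\<And>z. cmod z \<le> 1 \<Longrightarrow> cmod (db \<phi> z) \<le> 8 * e"
    "\<And>z. cmod z \<le> 1 \<Longrightarrow> \<bar>Re (4 * dz (db \<phi>) z) + q z * Re (\<phi> z)\<bar> \<le> \<sigma>"
    using approx_positive_solution[OF cont q e \<sigma>(1)] by metis
  have q1: "\<bar>q z\<bar> \<le> 1" if "cmod z \<le> 1" for z using q[OF that] e by linarith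
  obtain f where f: "zpoly f" "\<And>z. Im (f z) = 0" "\<And>z. cmod z \<le> 1 \<Longrightarrow> \<bar>Re (f z) - F z\<bar> \<le> \<sigma>"
    "\<And>z. cmod z \<le> 1 \<Longrightarrow> \<bar>Re (4 * dz (db f) z) + q z * Re (f z)\<bar> \<le> \<sigma>"
    using approx_solution[OF contF cont q1 lap \<sigma>(1)] by metis
  have \<phi>r: "\<phi> z = of_real (Re (\<phi> z))" and fr: "f z = of_real (Re (f z))" for z
    using \<phi>(2) f(2) by (simp_all add: complex_eq_iff)
  have \<phi>b: "1/2 \<le> Re (\<phi> z)" "Re (\<phi> z) \<le> 3/2" "cmod (\<phi> z) \<le> 3/2" "cmod (\<phi> z) \<ge> 1/2" if "cmod z \<le> 1" for z
  proof -
    have "\<bar>Re (\<phi> z) - 1\<bar> \<le> 1/2"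
      using \<phi>(3)[OF that] abs_Re_le_cmod[of "\<phi> z - 1"] e by simp
    then show "1/2 \<le> Re (\<phi> z)" "Re (\<phi> z) \<le> 3/2" by linarith+
    moreover have "cmod (\<phi> z) = \<bar>Re (\<phi> z)\<bar>" using \<phi>(2) by (simp add: cmod_def)
    ultimately show "cmod (\<phi> z) \<le> 3/2" "cmod (\<phi> z) \<ge> 1/2" by linarith+
  qed
  have lap_im: "Im (4 * dz (db g) z) = 0" if "zpoly g" "\<And>z. Im (g z) = 0" for g z
  proof -
    have "(\<lambda>z. of_real (Re (g z))) = g" using that(2) by (simp add: complex_eq_iff fun_eq_iff)
    then have "dz (db g) z = of_real (Re (dz (db g) z))" using lap_Re[OF that(1), of z] by simp
    then have "Im (dz (db g) z) = 0" by (metis Im_complex_of_real)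
    then show ?thesis by simp
  qed
  define \<kappa> where "\<kappa> z = \<phi> z * (4 * dz (db f) z) - f z * (4 * dz (db \<phi>) z)" for z
  have \<kappa>: "zpoly \<kappa>" unfolding \<kappa>_def
    by (intro zpoly_diff zpoly_mult zpoly_const \<phi> f zpoly_dz zpoly_db)
  have \<kappa>im: "Im (\<kappa> z) = 0" for z
    using lap_im[OF \<phi>(1,2), of z] lap_im[OF f(1,2), of z] \<phi>(2) f(2) by (simp add: \<kappa>_def)
  have f_bound: "\<bar>Re (f z)\<bar> \<le> M + \<sigma>" if "cmod z \<le> 1" "\<bar>F z\<bar> \<le> M" for z M
    using f(3)[OF that(1)] that(2) by linarith
  have \<kappa>b: "cmod (\<kappa> z) \<le> \<sigma> * (M0 + 3)" if z: "cmod z \<le> 1" for z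
  proof -
    define A where "A = Re (4 * dz (db f) z) + q z * Re (f z)"
    define B where "B = Re (4 * dz (db \<phi>) z) + q z * Re (\<phi> z)"
    have "cmod (\<kappa> z) = \<bar>Re (\<kappa> z)\<bar>" using \<kappa>im by (simp add: cmod_def)
    also have "Re (\<kappa> z) = Re (\<phi> z) * A - Re (f z) * B"
      unfolding \<kappa>_def A_def B_def using \<phi>(2) f(2) by (simp add: algebra_simps)
    also have "\<bar>\<dots>\<bar> \<le> \<bar>Re (\<phi> z) * A\<bar> + \<bar>Re (f z) * B\<bar>" by (rule abs_triangle_ineq4)
    also have "\<bar>Re (\<phi> z) * A\<bar> \<le> 2 * \<sigma>"
      unfolding abs_mult using \<phi>b[OF z] f(4)[OF z] by (intro mult_mono) (auto simp: A_def)
    also have "\<bar>Re (f z) * B\<bar> \<le> (M0 + 1) * \<sigma>"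
      unfolding abs_mult using f_bound[OF z M0[OF z]] \<phi>(5)[OF z] \<sigma> M00
      by (intro mult_mono) (auto simp: B_def)
    finally show ?thesis by (simp add: algebra_simps)
  qed
  obtain k where k: "zpoly k" "\<And>z. 4 * dz (db k) z = \<kappa> z" "\<And>z. Im (k z) = 0"
    "\<And>z. cmod z \<le> 1 \<Longrightarrow> cmod (dz k z) \<le> \<tau>" "\<And>z. cmod z \<le> 1 \<Longrightarrow> cmod (db k z) \<le> \<tau>"
    using zpoly_Poisson[OF \<kappa> \<kappa>b] \<kappa>im order_trans[OF _ \<sigma>(3)] by metis
  define \<omega> where "\<omega> z = \<phi> z * dz f z - f z * dz \<phi> z - dz k z" for z
  have \<omega>: "zpoly \<omega>" unfolding \<omega>_def
    by (intro zpoly_diff zpoly_mult \<phi> f zpoly_dz k)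
  note db_real = real_zpoly_db[OF \<phi>(1,2)] real_zpoly_db[OF f(1,2)] real_zpoly_db[OF k(1,3)]
  have "db \<omega> z = db \<phi> z * dz f z + \<phi> z * dz (db f) z - (db f z * dz \<phi> z + f z * dz (db \<phi>) z) - dz (db k) z" for z
    unfolding \<omega>_def
    by (simp add: db_diff db_mult zpoly_mult zpoly_diff zpoly_dz \<phi> f k db_dz_commute)
  moreover have "dz (db k) z = \<phi> z * dz (db f) z - f z * dz (db \<phi>) z" for z
  proof -
    have "4 * dz (db k) z = 4 * (\<phi> z * dz (db f) z - f z * dz (db \<phi>) z)"
      unfolding k(2) \<kappa>_def by (simp add: algebra_simps)
    then show ?thesis by (metis mult_cancel_left zero_neq_numeral)
  qed
  ultimately have "db \<omega> z = cnj (dz \<phi> z) * dz f z - cnj (dz f z) * dz \<phi> z" for z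
    by (simp add: db_real)
  then have "Re (db \<omega> z) = 0" for z by simp
  moreover have "db (\<lambda>z. - \<i> * \<omega> z) z = - \<i> * db \<omega> z" for z
    by (simp only: db_cmult[OF \<omega>])
  ultimately have "Im (db (\<lambda>z. - \<i> * \<omega> z) z) = 0" for z by simp
  from zpoly_real_potential[OF zpoly_cmult[OF \<omega>] this]
  obtain v where v: "zpoly v" "\<And>z. Im (v z) = 0" "\<And>z. dz v z = - \<i> * \<omega> z"
    "\<And>z. db v z = cnj (- \<i> * \<omega> z)" "v 0 = 0" by metis
  define W where "W z = \<phi> z * f z + \<i> * v z" for z
  have W: "zpoly W" unfolding W_def by (intro zpoly.add zpoly_mult zpoly_cmult \<phi> f v)
  have ReW: "Re (W z) = Re (\<phi> z) * Re (f z)" for z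
    using \<phi>(2) f(2) v(2) by (simp add: W_def)
  have "db W z = db \<phi> z * f z + \<phi> z * db f z + \<i> * db v z" for z
    unfolding W_def by (simp add: db_add db_mult zpoly_mult \<phi> f v)
  moreover have "cnj (\<phi> z) = \<phi> z" "cnj (f z) = f z" for z using \<phi>(2) f(2) by (simp_all add: complex_eq_iff)
  ultimately have dbW: "db W z = 2 * f z * db \<phi> z + db k z" for z
    by (simp add: v(4) \<omega>_def db_real algebra_simps)
  define b where "b z = db \<phi> z / \<phi> z" for z
  show ?thesis
  proof (rule that[of W b "\<lambda>z. Re (\<phi> z)"])
    show "zpoly W" by (rule W)
    show "continuous_on (cball 0 1) b" unfolding b_def
      using \<phi>b(4) by (intro continuous_intros zpoly_continuous zpoly_db \<phi>) force
    show "cmod (b z) \<le> 16 * e" if "cmod z \<le> 1" for z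
    proof -
      have "cmod (b z) \<le> (8 * e) / (1/2)"
        unfolding b_def norm_divide using \<phi>(4)[OF that] \<phi>b(4)[OF that] e by (intro frac_le) auto
      then show ?thesis by simp
    qed
    show "cmod (db W z - b z * (W z + cnj (W z))) \<le> \<tau>" if z: "cmod z \<le> 1" for z
    proof -
      have "W z + cnj (W z) = 2 * (\<phi> z * f z)"
        using ReW[of z] \<phi>(2)[of z] f(2)[of z] by (simp add: complex_eq_iff)
      then have "b z * (W z + cnj (W z)) = 2 * f z * db \<phi> z"
        using \<phi>b(4)[OF z] by (auto simp: b_def field_simps)
      then show ?thesis using k(5)[OF z] by (simp add: dbW)
    qed
    show "1/2 \<le> Re (\<phi> z) \<and> Re (\<phi> z) \<le> 3/2" if "cmod z \<le> 1" for z using \<phi>b[OF that] by blast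
    show "\<bar>Re (W z) - Re (\<phi> z) * F z\<bar> \<le> \<tau>" if z: "cmod z \<le> 1" for z
    proof -
      have "\<bar>Re (\<phi> z) * (Re (f z) - F z)\<bar> \<le> 2 * \<sigma>"
        unfolding abs_mult using \<phi>b[OF z] f(3)[OF z] by (intro mult_mono) auto
      then show ?thesis using \<sigma>' \<sigma>(1) by (simp add: ReW algebra_simps)
    qed
    fix \<alpha> \<beta> M :: real and z
    assume \<alpha>: "0 < \<alpha>" "\<alpha> < \<beta>" "\<beta> \<le> 1" and M: "\<And>z. cmod z \<le> \<beta> \<Longrightarrow> \<bar>F z\<bar> \<le> M" and z: "cmod z \<le> \<alpha>"
    define d where "d = \<beta> - \<alpha>"
    have d: "0 < d" "d \<le> 1" using \<alpha> by (auto simp: d_def)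
    define T where "T = M + \<tau>"
    have "M \<ge> 0" using M[of 0] \<alpha> by auto
    then have T: "T > 0" "\<sigma> \<le> T" "\<tau> \<le> T" "M + \<sigma> \<le> T" using \<tau> \<sigma>' \<sigma>(1) by (auto simp: T_def)
    have fb: "\<bar>Re (f y)\<bar> \<le> T" "cmod (f y) \<le> T" if "cmod y \<le> \<beta>" for y
    proof -
      show "\<bar>Re (f y)\<bar> \<le> T" using f_bound[OF _ M[OF that]] that \<alpha> T by auto
      moreover have "cmod (f y) = \<bar>Re (f y)\<bar>" using f(2) by (simp add: cmod_def)
      ultimately show "cmod (f y) \<le> T" by simp
    qed
    have lapf: "cmod (4 * dz (db f) y) \<le> 2 * T" if "cmod y \<le> \<beta>" for y
    proof -
      have y1: "cmod y \<le> 1" using that \<alpha> by linarith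
      have "cmod (4 * dz (db f) y) = \<bar>Re (4 * dz (db f) y)\<bar>"
        by (rule cmod_eq_Re[OF lap_im[OF f(1,2)]])
      also have "\<dots> \<le> \<sigma> + \<bar>q y * Re (f y)\<bar>" using f(4)[OF y1] by linarith
      also have "\<bar>q y * Re (f y)\<bar> \<le> 1 * T"
        unfolding abs_mult using q1[OF y1] fb[OF that] by (intro mult_mono) auto
      finally show ?thesis using T by linarith
    qed
    have \<omega>b: "cmod (\<omega> y) \<le> 19 / 2 * (T / d)" if y: "cmod y \<le> \<alpha>" for y
    proof -
      have y1: "cmod y \<le> 1" "cmod y \<le> \<beta>" using y \<alpha> by linarith+
      have rng: "cmod x \<le> \<beta>" if "x \<in> cball y d" for x
        using that y norm_triangle_sub[of x y] by (auto simp: d_def dist_norm norm_minus_commute)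
      have Td: "T \<le> T / d" "T * d \<le> T / d"
        using d T by (auto simp: field_simps mult_le_one)
      have "cmod (dz f y) \<le> 2 * T / d + (2 * T) * d / 2"
        by (rule zpoly_gradient_bound(1)[OF f(1) d(1) fb(2)[OF rng] lapf[OF rng]])
      also have "\<dots> = 2 * (T / d) + T * d" by simp
      finally have g: "cmod (dz f y) \<le> 3 * (T / d)" using Td by linarith
      have "cmod (\<omega> y) \<le> cmod (\<phi> y * dz f y) + cmod (f y * dz \<phi> y) + cmod (dz k y)"
        unfolding \<omega>_def by (meson add_mono_thms_linordered_semiring(3) norm_triangle_ineq4 order_trans)
      also have "cmod (\<phi> y * dz f y) \<le> 3 / 2 * (3 * (T / d))"
        unfolding norm_mult using \<phi>b(3)[OF y1(1)] g by (intro mult_mono) auto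
      also have "cmod (f y * dz \<phi> y) \<le> T * 4"
      proof -
        have "cmod (dz \<phi> y) = cmod (db \<phi> y)" by (simp add: db_real)
        also have "\<dots> \<le> 4" using \<phi>(4)[OF y1(1)] e by linarith
        finally show ?thesis unfolding norm_mult using fb(2)[OF y1(2)] T by (intro mult_mono) auto
      qed
      finally show ?thesis using k(4)[OF y1(1)] T Td(1) by linarith
    qed
    have "cmod (v z) \<le> 2 * (19 / 2 * (T / d)) * \<alpha>"
      by (rule gradient_imp_growth_bound[OF v(1,5) z]) (use \<omega>b in \<open>auto simp: v norm_mult\<close>)
    moreover have "cmod (\<phi> z * f z) \<le> 3/2 * T"
      unfolding norm_mult using \<phi>b(3)[of z] fb(2)[of z] z \<alpha> T by (intro mult_mono) auto
    moreover have "cmod (W z) \<le> cmod (\<phi> z * f z) + cmod (v z)"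
      unfolding W_def using norm_triangle_ineq[of "\<phi> z * f z" "\<i> * v z"] by (simp add: norm_mult)
    ultimately have "cmod (W z) \<le> 3/2 * T + 19 * (T / d) * \<alpha>" by simp
    also have "\<dots> = (T / d) * (3/2 * d + 19 * \<alpha>)" using d by (simp add: field_simps)
    also have "\<dots> \<le> (T / d) * (20 * \<beta>)"
    proof (rule mult_left_mono)
      have "0 < \<beta>" using \<alpha> by linarith
      then show "3/2 * d + 19 * \<alpha> \<le> 20 * \<beta>" using \<alpha> unfolding d_def by argo
    qed (use T d in auto)
    finally show "cmod (W z) \<le> 20 * \<beta> / (\<beta> - \<alpha>) * (M + \<tau>)" by (simp add: T_def d_def mult_ac)
  qed
qed

section \<open>The similarity principle\<close>

text \<open>Partial sums of the exponential series: $\bar\partial$ of one partial sum is $-\bar\partial s$ times the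
preceding one, so they converge together with their $\bar\partial$-derivatives.\<close>

lemma zpoly_exp_approx:
  assumes s: "zpoly s" and \<tau>: "\<tau> > 0"
  obtains X where "zpoly X" "\<And>z. cmod z \<le> 1 \<Longrightarrow> cmod (X z - exp (- s z)) \<le> \<tau>"
    "\<And>z. cmod z \<le> 1 \<Longrightarrow> cmod (db X z + db s z * exp (- s z)) \<le> \<tau>"
proof -
  define X where "X n z = (\<Sum>k<n. (1 / fact k) * (-1 * s z) ^ k)" for n z
  have ms: "zpoly (\<lambda>z. -1 * s z)" by (intro zpoly_cmult s)
  have X: "zpoly (X n)" for n
    unfolding X_def[abs_def] by (intro zpoly_sum zpoly_cmult zpoly_power s)
  have db_pow: "db (\<lambda>z. (-1 * s z) ^ Suc n) = (\<lambda>z. of_nat (Suc n) * (-1 * s z) ^ n * (-1 * db s z))" for n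
  proof (induction n)
    case 0
    then show ?case using db_cmult[OF s, of "-1"] by simp
  next
    case (Suc n)
    have "db (\<lambda>z. (-1 * s z) * (-1 * s z) ^ Suc n) =
      (\<lambda>z. (-1 * db s z) * (-1 * s z) ^ Suc n + (-1 * s z) * (of_nat (Suc n) * (-1 * s z) ^ n * (-1 * db s z)))"
      by (simp only: db_mult[OF ms zpoly_power[OF ms]] db_cmult[OF s] Suc.IH)
    then show ?case by (simp add: algebra_simps)
  qed
  have dbX: "db (X (Suc n)) = (\<lambda>z. - db s z * X n z)" for n
  proof (induction n)
    case 0
    then show ?case by (simp add: X_def[abs_def])
  next
    case (Suc n)
    have "X (Suc (Suc n)) = (\<lambda>z. X (Suc n) z + (1 / fact (Suc n)) * (-1 * s z) ^ Suc n)"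
      by (simp add: X_def[abs_def])
    then have "db (X (Suc (Suc n))) = (\<lambda>z. - db s z * X n z + (1 / fact (Suc n)) * (of_nat (Suc n) * (-1 * s z) ^ n * (-1 * db s z)))"
      by (simp only: db_add[OF X zpoly_cmult[OF zpoly_power[OF ms]]] db_cmult[OF zpoly_power[OF ms]] db_pow Suc.IH)
    also have "\<dots> = (\<lambda>z. - db s z * (X n z + (1 / fact n) * (-1 * s z) ^ n))"
    proof
      fix z
      have c: "(1 / fact (Suc n)) * of_nat (Suc n) = (1 / fact n :: complex)"
        by (simp add: divide_simps del: of_nat_Suc)
      have "(1 / fact (Suc n)) * (of_nat (Suc n) * (-1 * s z) ^ n * (-1 * db s z))
        = (1 / fact (Suc n)) * of_nat (Suc n) * ((-1 * s z) ^ n * (-1 * db s z))"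
        by (simp only: mult.assoc)
      then show "- db s z * X n z + (1 / fact (Suc n)) * (of_nat (Suc n) * (-1 * s z) ^ n * (-1 * db s z))
          = - db s z * (X n z + (1 / fact n) * (-1 * s z) ^ n)"
        unfolding c by (simp add: algebra_simps)
    qed
    also have "\<dots> = (\<lambda>z. - db s z * X (Suc n) z)" by (simp add: X_def[abs_def])
    finally show ?case .
  qed
  obtain R where R: "\<And>z. z \<in> cball 0 1 \<Longrightarrow> cmod (s z) \<le> R"
    using compact_imp_bounded[OF compact_continuous_image[OF zpoly_continuous[OF s] compact_cball]]
    unfolding bounded_iff by (metis image_eqI)
  obtain S where S: "\<And>z. z \<in> cball 0 1 \<Longrightarrow> cmod (db s z) \<le> S"
    using compact_imp_bounded[OF compact_continuous_image[OF zpoly_continuous[OF zpoly_db[OF s]] compact_cball]]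
    unfolding bounded_iff by (metis image_eqI)
  have S0: "S \<ge> 0" using S[of 0] norm_ge_zero[of "db s 0"] by (simp del: norm_ge_zero)
  have "uniform_limit (cball 0 1) (\<lambda>n z. \<Sum>k<n. (1 / fact k) * (-1 * s z) ^ k)
      (\<lambda>z. \<Sum>k. (1 / fact k) * (-1 * s z) ^ k) sequentially"
  proof (rule Weierstrass_m_test)
    show "summable (\<lambda>k. inverse (fact k) * R ^ k)" by (rule summable_exp)
    show "norm ((1 / fact k) * (-1 * s z) ^ k) \<le> inverse (fact k) * R ^ k" if "z \<in> cball 0 1" for k z
      using power_mono[OF R[OF that] norm_ge_zero, of k]
      by (simp add: norm_mult norm_divide norm_power divide_simps)
  qed
  moreover have "(\<Sum>k. (1 / fact k) * (-1 * s z) ^ k) = exp (- s z)" for z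
    using sums_unique[OF exp_converges[of "- s z"]]
    by (simp add: scaleR_conv_of_real field_simps)
  ultimately have ul: "uniform_limit (cball 0 1) X (\<lambda>z. exp (- s z)) sequentially"
    by (simp add: X_def[abs_def])
  define \<tau>' where "\<tau>' = \<tau> / (S + 1)"
  have \<tau>': "\<tau>' > 0" "\<tau>' \<le> \<tau>" "S * \<tau>' \<le> \<tau>"
    using \<tau> S0 by (auto simp: \<tau>'_def field_simps)
  obtain N where N: "\<And>n z. n \<ge> N \<Longrightarrow> z \<in> cball 0 1 \<Longrightarrow> dist (X n z) (exp (- s z)) < \<tau>'"
    using uniform_limitD[OF ul \<tau>'(1)] unfolding eventually_sequentially by blast
  have Nb: "cmod (X n z - exp (- s z)) \<le> \<tau>'" if "n \<ge> N" "cmod z \<le> 1" for n z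
    using N[of n z] that by (simp add: dist_norm)
  show ?thesis
  proof (rule that[of "X (Suc N)"])
    show "cmod (X (Suc N) z - exp (- s z)) \<le> \<tau>" if "cmod z \<le> 1" for z
      using Nb[of "Suc N" z] that \<tau>' by simp
    show "cmod (db (X (Suc N)) z + db s z * exp (- s z)) \<le> \<tau>" if z: "cmod z \<le> 1" for z
    proof -
      have "db (X (Suc N)) z + db s z * exp (- s z) = - (db s z * (X N z - exp (- s z)))"
        unfolding dbX by (simp add: algebra_simps)
      then have "cmod (db (X (Suc N)) z + db s z * exp (- s z)) = cmod (db s z) * cmod (X N z - exp (- s z))"
        by (simp only: norm_minus_cancel norm_mult)
      also have "\<dots> \<le> S * \<tau>'" using S[of z] Nb[of N z] z S0 by (intro mult_mono) auto
      finally show ?thesis using \<tau>' by simp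
    qed
  qed (rule X)
qed

text \<open>A continuous substitute for $b(w + \bar w)/w$, which has no limit at zeros of $w$. It keeps
the bound $2B$, independently of $\delta$.\<close>

lemma regularised_quotient:
  fixes w b :: complex
  assumes \<delta>: "\<delta> > 0" and b: "cmod b \<le> B"
  defines "h \<equiv> b * (1 + cnj w ^ 2 / of_real ((cmod w)\<^sup>2 + \<delta>\<^sup>2))"
  shows "cmod h \<le> 2 * B" "cmod (b * (w + cnj w) - h * w) \<le> B * \<delta>"
proof -
  have B0: "B \<ge> 0" using b norm_ge_zero[of b] by linarith
  define D where "D = (cmod w)\<^sup>2 + \<delta>\<^sup>2"
  have D: "D > 0" "(cmod w)\<^sup>2 \<le> D" using \<delta> by (auto simp: D_def add_nonneg_pos)
  have "cmod (1 + cnj w ^ 2 / of_real D) \<le> 1 + (cmod w)\<^sup>2 / D"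
    using norm_triangle_ineq[of 1 "cnj w ^ 2 / of_real D"] D by (simp add: norm_divide norm_power)
  also have "\<dots> \<le> 2" using D by simp
  finally have "cmod (1 + cnj w ^ 2 / of_real D) \<le> 2" .
  then have "cmod h \<le> B * 2" unfolding h_def norm_mult D_def[symmetric]
    using b B0 by (intro mult_mono) auto
  then show "cmod h \<le> 2 * B" by simp
  have "h * w = b * (w + cnj w * (w * cnj w) / of_real D)"
    unfolding h_def D_def[symmetric] by (simp add: power2_eq_square algebra_simps)
  also have "w * cnj w = of_real ((cmod w)\<^sup>2)" using complex_norm_square[of w] by simp
  finally have "b * (w + cnj w) - h * w = b * (cnj w * (1 - of_real ((cmod w)\<^sup>2) / of_real D))"
    by (simp add: algebra_simps)
  also have "1 - of_real ((cmod w)\<^sup>2) / of_real D = complex_of_real (\<delta>\<^sup>2 / D)"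
  proof -
    have "1 - (cmod w)\<^sup>2 / D = \<delta>\<^sup>2 / D" 
    proof -
      have "1 - (cmod w)\<^sup>2 / D = (D - (cmod w)\<^sup>2) / D" using D(1) by (simp add: diff_divide_distrib)
      also have "D - (cmod w)\<^sup>2 = \<delta>\<^sup>2" by (simp add: D_def)
      finally show ?thesis .
    qed
    then show ?thesis by (metis of_real_1 of_real_diff of_real_divide)
  qed
  finally have "cmod (b * (w + cnj w) - h * w) = cmod b * (cmod w * (\<delta>\<^sup>2 / D))"
    using D by (simp add: norm_mult norm_divide norm_power)
  also have "\<dots> \<le> B * \<delta>"
  proof (rule mult_mono)
    have "2 * (cmod w * \<delta>) \<le> D" using sum_squares_bound[of "cmod w" \<delta>] by (simp add: D_def mult.assoc)
    moreover have "0 \<le> cmod w * \<delta>" using \<delta> by simp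
    ultimately have "cmod w * \<delta> \<le> D" by argo
    then have "\<delta> * (cmod w * \<delta>) \<le> \<delta> * D" using \<delta> by (intro mult_left_mono) auto
    then show "cmod w * (\<delta>\<^sup>2 / D) \<le> \<delta>" using D by (simp add: field_simps power2_eq_square)
  qed (use b B0 D \<delta> in auto)
  finally show "cmod (b * (w + cnj w) - h * w) \<le> B * \<delta>" .
qed

lemma norm_triangle3:
  fixes a b c :: "'a::real_normed_vector"
  shows "norm (a + b + c) \<le> norm a + norm b + norm c"
  using norm_triangle_ineq[of "a + b" c] norm_triangle_ineq[of a b] by linarith

text \<open>With $\bar\partial s$ close to the regularised $\bar\partial W/W$, the product of $W$ and a polynomial $X$ close to
$e^{-s}$ has a uniformly small $\bar\partial$, and one more solution of a $\bar\partial$-equation removes it. It matters that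
the bound for $s$ does not depend on $\tau$; with $1/300$ for $b$ it is at most $1/10$, so that
$|e^{\pm s}| \le 2$.\<close>

lemma similarity_principle:
  assumes W: "zpoly W" and b: "continuous_on (cball 0 1) b"
    and B: "\<And>z. cmod z \<le> 1 \<Longrightarrow> cmod (b z) \<le> 1/300"
    and eq: "\<And>z. cmod z \<le> 1 \<Longrightarrow> cmod (db W z - b z * (W z + cnj (W z))) \<le> \<tau>" and \<tau>: "\<tau> > 0"
  obtains s H where "zpoly s" "\<And>z. cmod z \<le> 1 \<Longrightarrow> cmod (s z) \<le> 1/10"
    "H holomorphic_on UNIV" "\<And>z. cmod z \<le> 1 \<Longrightarrow> cmod (exp (- s z) * W z - H z) \<le> 100 * \<tau>"
proof -
  obtain M where M: "\<And>z. z \<in> cball 0 1 \<Longrightarrow> cmod (W z) \<le> M"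
    using compact_imp_bounded[OF compact_continuous_image[OF zpoly_continuous[OF W] compact_cball]]
    unfolding bounded_iff by (metis image_eqI)
  obtain D where D: "\<And>z. z \<in> cball 0 1 \<Longrightarrow> cmod (db W z) \<le> D"
    using compact_imp_bounded[OF compact_continuous_image[OF zpoly_continuous[OF zpoly_db[OF W]] compact_cball]]
    unfolding bounded_iff by (metis image_eqI)
  have M0: "M \<ge> 0" using M[of 0] norm_ge_zero[of "W 0"] by (simp del: norm_ge_zero)
  have D0: "D \<ge> 0" using D[of 0] norm_ge_zero[of "db W 0"] by (simp del: norm_ge_zero)
  \<comment> \<open>the regularised quotient \<open>b * (W + cnj W) / W\<close>\<close>
  define h where "h z = b z * (1 + cnj (W z) ^ 2 / of_real ((cmod (W z))\<^sup>2 + \<tau>\<^sup>2))" for z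
  have pos: "(cmod (W z))\<^sup>2 + \<tau>\<^sup>2 > 0" for z using \<tau> by (simp add: add_nonneg_pos)
  have cont: "continuous_on (cball 0 1) h" unfolding h_def
    using pos by (intro continuous_intros zpoly_continuous W b) (metis of_real_eq_0_iff less_irrefl)
  have hb: "cmod (h z) \<le> 2 * (1/300)" "cmod (b z * (W z + cnj (W z)) - h z * W z) \<le> (1/300) * \<tau>"
    if "cmod z \<le> 1" for z
    unfolding h_def by (rule regularised_quotient[OF \<tau> B[OF that]])+
  \<comment> \<open>small against \<open>\<tau>\<close> after multiplication by \<open>W\<close>, and small absolutely for the bound on \<open>s\<close>\<close>
  define \<eta> where "\<eta> = min (1/1000) (\<tau> / (4 * (M + 1)))"
  have \<eta>: "0 < \<eta>" using \<tau> M0 by (auto simp: \<eta>_def)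
  have \<eta>2: "\<eta> \<le> 1/1000" unfolding \<eta>_def by (rule min.cobounded1)
  have \<eta>M: "\<eta> * M \<le> \<tau> / 4"
  proof -
    have "\<eta> \<le> \<tau> / (4 * (M + 1))" by (simp add: \<eta>_def)
    then have "\<eta> * (4 * (M + 1)) \<le> \<tau>" using M0 pos_le_divide_eq[of "4 * (M + 1)" \<eta> \<tau>] by simp
    then show ?thesis using \<eta> by (simp add: algebra_simps)
  qed
  obtain g where g: "zpoly g" "\<And>z. cmod z \<le> 1 \<Longrightarrow> cmod (h z - g z) \<le> \<eta>"
    using zpoly_dense[OF compact_cball cont \<eta>] by auto
  have "cmod (g z) \<le> 1/120" if "cmod z \<le> 1" for z
    using hb(1)[OF that] g(2)[OF that] \<eta>2 norm_triangle_ineq4[of "h z" "h z - g z"] by simp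
  from zpoly_dbar[OF g(1) this] obtain s where
    s: "zpoly s" "\<And>z. db s z = g z" "\<And>z. cmod z \<le> 1 \<Longrightarrow> cmod (s z) \<le> 12 * (1/120)" by metis
  have exps: "cmod (exp (- s z)) \<le> 2" if "cmod z \<le> 1" for z
  proof -
    have "cmod (exp (- s z)) \<le> exp (cmod (- s z))" by (rule norm_exp)
    also have "\<dots> \<le> exp (1/2)" using s(3)[OF that] by simp
    also have "\<dots> \<le> 2" using exp_half_le2 by simp
    finally show ?thesis .
  qed
  define \<xi> where "\<xi> = \<tau> / (M + D + 1)"
  have \<xi>: "\<xi> > 0" using \<tau> M0 D0 by (simp add: \<xi>_def)
  have \<xi>MD: "\<xi> * M + \<xi> * D \<le> \<tau>"
  proof -
    have "\<xi> * (M + D + 1) = \<tau>" using M0 D0 by (simp add: \<xi>_def)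
    then show ?thesis using \<xi> by (simp add: algebra_simps)
  qed
  obtain X where X: "zpoly X" "\<And>z. cmod z \<le> 1 \<Longrightarrow> cmod (X z - exp (- s z)) \<le> \<xi>"
    "\<And>z. cmod z \<le> 1 \<Longrightarrow> cmod (db X z + db s z * exp (- s z)) \<le> \<xi>"
    using zpoly_exp_approx[OF s(1) \<xi>] by metis
  have XW: "zpoly (\<lambda>z. X z * W z)" by (intro zpoly_mult X W)
  have dbXW: "db (\<lambda>z. X z * W z) z = db X z * W z + X z * db W z" for z
    by (simp add: db_mult X W)
  have small: "cmod (db (\<lambda>z. X z * W z) z) \<le> 5 * \<tau>" if z: "cmod z \<le> 1" for z
  proof -
    have Wz: "cmod (W z) \<le> M" "cmod (db W z) \<le> D" using M D z by auto
    have "db W z - g z * W z = (db W z - b z * (W z + cnj (W z)))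
       + (b z * (W z + cnj (W z)) - h z * W z) + (h z - g z) * W z" by (simp add: algebra_simps)
    then have "cmod (db W z - g z * W z) \<le> cmod (db W z - b z * (W z + cnj (W z)))
       + cmod (b z * (W z + cnj (W z)) - h z * W z) + cmod ((h z - g z) * W z)"
      by (simp only: norm_triangle3)
    moreover have "cmod ((h z - g z) * W z) \<le> \<eta> * M"
      unfolding norm_mult using g(2)[OF z] Wz \<eta> by (intro mult_mono) auto
    ultimately have 1: "cmod (db W z - g z * W z) \<le> 2 * \<tau>"
      using eq[OF z] hb(2)[OF z] \<eta>M \<tau> by linarith
    have "db (\<lambda>z. X z * W z) z = exp (- s z) * (db W z - g z * W z)
      + (db X z + db s z * exp (- s z)) * W z + (X z - exp (- s z)) * db W z"
      unfolding dbXW s(2) by (simp add: algebra_simps)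
    then have "cmod (db (\<lambda>z. X z * W z) z) \<le> cmod (exp (- s z) * (db W z - g z * W z))
      + cmod ((db X z + db s z * exp (- s z)) * W z) + cmod ((X z - exp (- s z)) * db W z)"
      by (simp only: norm_triangle3)
    moreover have "cmod (exp (- s z) * (db W z - g z * W z)) \<le> 2 * (2 * \<tau>)"
      unfolding norm_mult using exps[OF z] 1 by (intro mult_mono) auto
    moreover have "cmod ((db X z + db s z * exp (- s z)) * W z) \<le> \<xi> * M"
      unfolding norm_mult using X(3)[OF z] Wz \<xi> by (intro mult_mono) auto
    moreover have "cmod ((X z - exp (- s z)) * db W z) \<le> \<xi> * D"
      unfolding norm_mult using X(2)[OF z] Wz \<xi> by (intro mult_mono) auto
    ultimately show ?thesis using \<xi>MD by linarith
  qed
  obtain E where E: "zpoly E" "\<And>z. db E z = db (\<lambda>z. X z * W z) z" "\<And>z. cmod z \<le> 1 \<Longrightarrow> cmod (E z) \<le> 12 * (5 * \<tau>)"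
    using zpoly_dbar[OF zpoly_db[OF XW] small] by metis
  show ?thesis
  proof (rule that[of s "\<lambda>z. X z * W z - E z"])
    show "cmod (s z) \<le> 1/10" if "cmod z \<le> 1" for z using s(3)[OF that] by simp
    show "(\<lambda>z. X z * W z - E z) holomorphic_on UNIV"
      by (rule db_zero_holomorphic[OF zpoly_diff[OF XW E(1)]]) (simp add: db_diff[OF XW E(1)] E(2))
    show "cmod (exp (- s z) * W z - (X z * W z - E z)) \<le> 100 * \<tau>" if z: "cmod z \<le> 1" for z
    proof -
      have "exp (- s z) * W z - (X z * W z - E z) = E z - (X z - exp (- s z)) * W z"
        by (simp add: algebra_simps)
      then have "cmod (exp (- s z) * W z - (X z * W z - E z)) \<le> cmod (E z) + cmod ((X z - exp (- s z)) * W z)"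
        by (simp only: norm_triangle_ineq4)
      moreover have "cmod ((X z - exp (- s z)) * W z) \<le> \<xi> * M"
        unfolding norm_mult using X(2)[OF z] M[of z] z \<xi> by (intro mult_mono) auto
      moreover have "\<xi> * D \<ge> 0" using \<xi> D0 by simp
      ultimately show ?thesis using E(3)[OF z] \<xi>MD \<tau> by linarith
    qed
  qed (rule s)
qed

text \<open>On the circle $c\,\bar z^l$ has the same imaginary part as $-\bar c\,z^l$.\<close>

lemma holomorphic_conjugate_extension:
  assumes "zpoly s"
  shows "\<exists>K. K holomorphic_on UNIV \<and> (\<forall>z. cmod z = 1 \<longrightarrow> Im (K z) = Im (s z))"
  using assms
proof induction
  case (monom c j k)
  show ?case
  proof (cases "k \<le> j")
    case True
    show ?thesis
      by (rule exI[of _ "\<lambda>z. c * z ^ (j - k)"])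
        (auto intro!: holomorphic_intros simp: mult.assoc circle_monom True)
  next
    case False
    have "Im (- cnj c * z ^ (k - j)) = Im (c * cnj z ^ (k - j))" for z
    proof -
      have "- cnj c * z ^ (k - j) = - cnj (c * cnj z ^ (k - j))" by simp
      also have "Im \<dots> = Im (c * cnj z ^ (k - j))" by (simp del: complex_cnj_mult)
      finally show ?thesis .
    qed
    then show ?thesis
      by (intro exI[of _ "\<lambda>z. - cnj c * z ^ (k - j)"])
        (auto intro!: holomorphic_intros simp: mult.assoc circle_monom False)
  qed
next
  case (add f g)
  then obtain K L where "K holomorphic_on UNIV" "L holomorphic_on UNIV"
    "\<forall>z. cmod z = 1 \<longrightarrow> Im (K z) = Im (f z)" "\<forall>z. cmod z = 1 \<longrightarrow> Im (L z) = Im (g z)" by blast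
  then show ?case
    by (intro exI[of _ "\<lambda>z. K z + L z"]) (auto intro!: holomorphic_intros)
qed

section \<open>Holomorphic functions whose real part has few sign changes on the circle\<close>

definition circ :: "real \<Rightarrow> complex" where "circ t = exp (2 * of_real pi * \<i> * of_real t)"

lemma norm_circ [simp]: "cmod (circ t) = 1"
  by (simp add: circ_def)

lemma circ_continuous: "continuous_on A circ"
  unfolding circ_def[abs_def] by (intro continuous_intros)

lemma circ_integrable:
  fixes f :: "complex \<Rightarrow> 'a::banach"
  assumes "continuous_on (sphere 0 1) f"
  shows "(\<lambda>t. f (circ t)) integrable_on {0..1}"
  by (intro integrable_continuous_real continuous_on_compose2[OF assms circ_continuous]) auto

text \<open>Cauchy's formula for the Taylor coefficients, as a mean over the unit circle.\<close>

lemma circ_coefficient0: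
  assumes L: "L holomorphic_on UNIV"
  shows "integral {0..1} (\<lambda>t. L (circ t) * cnj (circ t) ^ k) = (deriv ^^ k) L 0 / fact k"
proof -
  have "(deriv ^^ k) L 0 = fact k / (2 * pi * \<i>) * contour_integral (circlepath 0 1) (\<lambda>u. L u / (u - 0) ^ Suc k)"
    by (rule Cauchy_higher_derivative_integral_circlepath(2))
      (use L in \<open>auto intro: holomorphic_on_imp_continuous_on holomorphic_on_subset\<close>)
  also have "contour_integral (circlepath 0 1) (\<lambda>u. L u / (u - 0) ^ Suc k)
      = integral {0..1} (\<lambda>t. (2 * pi * \<i>) * (L (circ t) * cnj (circ t) ^ k))"
    unfolding contour_integral_integral
  proof (rule integral_cong)
    fix t
    have c: "circlepath 0 1 t = circ t" by (simp add: circlepath circ_def)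
    have v: "vector_derivative (circlepath 0 1) (at t) = 2 * pi * \<i> * circ t"
      unfolding vector_derivative_circlepath by (simp add: circ_def)
    have nz: "circ t \<noteq> 0" by (simp add: circ_def)
    have "circ t * cnj (circ t) = 1" using complex_norm_square[of "circ t"] by simp
    then have "(circ t) ^ k * cnj (circ t) ^ k = 1" by (simp flip: power_mult_distrib)
    then have i: "cnj (circ t) ^ k = 1 / circ t ^ k" using nz by (simp add: field_simps)
    show "L (circlepath 0 1 t) / (circlepath 0 1 t - 0) ^ Suc k * vector_derivative (circlepath 0 1) (at t)
      = (2 * pi * \<i>) * (L (circ t) * cnj (circ t) ^ k)"
      unfolding c v i using nz by simp
  qed
  also have "\<dots> = (2 * pi * \<i>) * integral {0..1} (\<lambda>t. L (circ t) * cnj (circ t) ^ k)"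
    by (rule integral_mult_right)
  finally show ?thesis by simp
qed

lemma circ_coefficient:
  assumes L: "L holomorphic_on UNIV"
  shows "integral {0..1} (\<lambda>t. L (circ t) * (circ t ^ a * cnj (circ t) ^ k))
     = (if a \<le> k then (deriv ^^ (k - a)) L 0 / fact (k - a) else 0)"
proof (cases "a \<le> k")
  case True
  then have "circ t ^ a * cnj (circ t) ^ k = cnj (circ t) ^ (k - a)" for t
    by (cases "k = a") (auto simp: circle_monom)
  then show ?thesis using circ_coefficient0[OF L, of "k - a"] True by simp
next
  case False
  have "(\<lambda>z. L z * z ^ (a - k)) holomorphic_on UNIV" by (intro holomorphic_intros L)
  from circ_coefficient0[OF this, of 0] False
  show ?thesis by (auto simp: circle_monom mult.commute)
qed

lemma coefficient_bound_imp_bound: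
  assumes L: "L holomorphic_on UNIV" and B: "\<And>k. cmod ((deriv ^^ k) L 0 / fact k) \<le> B"
    and w: "cmod w \<le> 1/2"
  shows "cmod (L w) \<le> 2 * B"
proof -
  have B0: "B \<ge> 0" using order_trans[OF norm_ge_zero B] .
  have "(\<lambda>n. (deriv ^^ n) L 0 / fact n * (w - 0) ^ n) sums L w"
    by (rule holomorphic_power_series[of _ _ 1]) (use L w in \<open>auto intro: holomorphic_on_subset\<close>)
  moreover have "(\<lambda>n. B * (1/2) ^ n) sums (B * (1 / (1 - 1/2)))"
    by (intro sums_mult geometric_sums) simp
  moreover have "norm ((deriv ^^ n) L 0 / fact n * (w - 0) ^ n) \<le> B * (1/2) ^ n" for n
    unfolding norm_mult norm_power using B[of n] w B0
    by (intro mult_mono power_mono) auto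
  ultimately have "cmod (L w) \<le> B * (1 / (1 - 1/2))" by (rule norm_sums_le)
  then show ?thesis by simp
qed

lemma mean_bound_imp_bound:
  assumes f: "f holomorphic_on UNIV" and B: "integral {0..1} (\<lambda>t. cmod (f (circ t))) \<le> B"
    and w: "cmod w \<le> 1/2"
  shows "cmod (f w) \<le> 2 * B"
proof (rule coefficient_bound_imp_bound[OF f _ w])
  fix k
  have cf: "continuous_on S f" for S using f holomorphic_on_imp_continuous_on holomorphic_on_subset by blast
  have "cmod (integral {0..1} (\<lambda>t. f (circ t) * cnj (circ t) ^ k)) \<le> integral {0..1} (\<lambda>t. cmod (f (circ t)))"
    by (intro integral_norm_bound_integral circ_integrable[where f = "\<lambda>z. f z * cnj z ^ k"]
        circ_integrable[where f = "\<lambda>z. cmod (f z)"] continuous_intros cf)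
      (simp add: norm_mult norm_power)
  then show "cmod ((deriv ^^ k) f 0 / fact k) \<le> B" unfolding circ_coefficient0[OF f] using B by linarith
qed

text \<open>If $|\mathrm{Im}\,K| \le 1$ then $|e^K| \le 2\,\mathrm{Re}\,e^K$, and the mean of $\mathrm{Re}\,e^K$
is its value at the centre. A bound on $\mathrm{Im}\,K$ gives no pointwise bound on
$\mathrm{Re}\,K$ on the circle, hence the mean.\<close>

lemma exp_mean_bound:
  assumes K: "K holomorphic_on UNIV" and 0: "Re (K 0) = 0"
    and im: "\<And>z. cmod z = 1 \<Longrightarrow> \<bar>Im (K z)\<bar> \<le> 1"
  shows "integral {0..1} (\<lambda>t. cmod (exp (K (circ t)))) \<le> 2"
proof -
  have cK: "continuous_on S K" for S using K holomorphic_on_imp_continuous_on holomorphic_on_subset by blast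
  have cos_half: "cos x \<ge> 1/2" if "\<bar>x\<bar> \<le> 1" for x :: real
  proof -
    have "cos (pi / 3) \<le> cos \<bar>x\<bar>"
      by (rule cos_monotone_0_pi_le) (use that pi_gt3 in auto)
    then show ?thesis by (simp add: cos_60)
  qed
  have "integral {0..1} (\<lambda>t. cmod (exp (K (circ t)))) \<le> integral {0..1} (\<lambda>t. 2 * Re (exp (K (circ t))))"
  proof (rule integral_le)
    show "(\<lambda>t. cmod (exp (K (circ t)))) integrable_on {0..1}"
      by (intro circ_integrable[where f = "\<lambda>z. cmod (exp (K z))"] continuous_intros cK)
    show "(\<lambda>t. 2 * Re (exp (K (circ t)))) integrable_on {0..1}"
      by (intro circ_integrable[where f = "\<lambda>z. 2 * Re (exp (K z))"] continuous_intros cK)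
    show "cmod (exp (K (circ t))) \<le> 2 * Re (exp (K (circ t)))" for t
      using mult_left_mono[OF cos_half[OF im[of "circ t"]], of "exp (Re (K (circ t)))"] by (simp add: Re_exp)
  qed
  also have "\<dots> = 2 * Re (integral {0..1} (\<lambda>t. exp (K (circ t)) * cnj (circ t) ^ 0))"
  proof -
    have "(\<lambda>t. exp (K (circ t))) integrable_on {0..1}"
      by (intro circ_integrable[where f = "\<lambda>z. exp (K z)"] continuous_intros cK)
    from integral_linear[OF this bounded_linear_Re] show ?thesis by (simp add: o_def)
  qed
  also have "integral {0..1} (\<lambda>t. exp (K (circ t)) * cnj (circ t) ^ 0) = exp (K 0)"
    using circ_coefficient0[of "\<lambda>z. exp (K z)" 0] K by (simp add: holomorphic_on_exp' )
  also have "Re (exp (K 0)) \<le> 1" using complex_Re_le_cmod[of "exp (K 0)"] 0 by simp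
  finally show ?thesis by simp
qed

text \<open>The factor $e^K$ that makes $e^{s-K}$ positive on the circle. Inside the disc it is bounded above
and below because the means of $|e^K|$ and $|e^{-K}|$ on the circle are.\<close>

lemma outer_correction:
  assumes s: "zpoly s" and sb: "\<And>z. cmod z \<le> 1 \<Longrightarrow> cmod (s z) \<le> 1"
  obtains K where "K holomorphic_on UNIV" "\<And>z. cmod z = 1 \<Longrightarrow> Im (K z) = Im (s z)"
    "integral {0..1} (\<lambda>t. cmod (exp (K (circ t)))) \<le> 2"
    "\<And>z. cmod z \<le> 1/2 \<Longrightarrow> cmod (exp (K z)) \<le> 4" "\<And>z. cmod z \<le> 1/2 \<Longrightarrow> cmod (exp (- K z)) \<le> 4"
proof -
  obtain K0 where K0: "K0 holomorphic_on UNIV" "\<And>z. cmod z = 1 \<Longrightarrow> Im (K0 z) = Im (s z)"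
    using holomorphic_conjugate_extension[OF s] by blast
  define K where "K z = K0 z - of_real (Re (K0 0))" for z
  have K: "K holomorphic_on UNIV" unfolding K_def by (intro holomorphic_intros K0)
  have imK: "Im (K z) = Im (s z)" if "cmod z = 1" for z using K0(2)[OF that] by (simp add: K_def)
  have imK1: "\<bar>Im (K z)\<bar> \<le> 1" if "cmod z = 1" for z
    using imK[OF that] sb[of z] that abs_Im_le_cmod[of "s z"] by linarith
  have mK: "(\<lambda>z. - K z) holomorphic_on UNIV" by (intro holomorphic_intros K)
  have 1: "integral {0..1} (\<lambda>t. cmod (exp (K (circ t)))) \<le> 2"
    by (rule exp_mean_bound[OF K _ imK1]) (simp_all add: K_def)
  have 2: "integral {0..1} (\<lambda>t. cmod (exp (- K (circ t)))) \<le> 2"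
    by (rule exp_mean_bound[OF mK]) (use imK1 in \<open>simp_all add: K_def\<close>)
  have "(\<lambda>z. exp (K z)) holomorphic_on UNIV" "(\<lambda>z. exp (- K z)) holomorphic_on UNIV"
    by (intro holomorphic_intros K)+
  from mean_bound_imp_bound[OF this(1) 1] mean_bound_imp_bound[OF this(2) 2] that[OF K imK 1]
  show ?thesis by simp
qed

lemma prod_half_le_1:
  assumes "\<And>\<zeta>. \<zeta> \<in> S \<Longrightarrow> cmod \<zeta> = 1" "cmod z \<le> 1"
  shows "cmod (\<Prod>\<zeta>\<in>S. (z - \<zeta>) / 2) \<le> 1"
  unfolding prod_norm[symmetric]
proof (rule prod_le_1)
  fix \<zeta> assume "\<zeta> \<in> S"
  then show "0 \<le> cmod ((z - \<zeta>) / 2) \<and> cmod ((z - \<zeta>) / 2) \<le> 1"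
    using norm_triangle_ineq4[of z \<zeta>] assms by (simp add: norm_divide)
qed

text \<open>On the circle, the Fourier coefficient of $2\,\mathrm{Re}(z^{-m}L)$ at $j>0$ is the sum of the Taylor coefficient of $L$
at $m+j$ and the conjugate of the one at $m-j$, where the latter is absent for $j>m$. So the high
coefficients are controlled by the mean and the low ones.\<close>

lemma real_part_coefficient_bound:
  assumes L: "L holomorphic_on UNIV"
    and A: "integral {0..1} (\<lambda>t. \<bar>Re (cnj (circ t) ^ m * L (circ t))\<bar>) \<le> A"
    and B: "\<And>k. k \<le> m \<Longrightarrow> cmod ((deriv ^^ k) L 0 / fact k) \<le> B"
  shows "cmod ((deriv ^^ k) L 0 / fact k) \<le> 2 * A + B"
proof -
  define l where "l k = (deriv ^^ k) L 0 / fact k" for k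
  have cL: "continuous_on S L" for S using L holomorphic_on_imp_continuous_on holomorphic_on_subset by blast
  have "0 \<le> integral {0..1} (\<lambda>t. \<bar>Re (cnj (circ t) ^ m * L (circ t))\<bar>)"
    by (intro integral_nonneg circ_integrable[where f = "\<lambda>z. \<bar>Re (cnj z ^ m * L z)\<bar>"] continuous_intros cL)
      simp
  then have A0: "A \<ge> 0" using A by linarith
  have B0: "B \<ge> 0" using order_trans[OF norm_ge_zero B[of m]] by simp
  show ?thesis
  proof (cases "k \<le> m")
    case True
    then show ?thesis using B[OF True] A0 by linarith
  next
    case False
    then obtain j where j: "k = m + j" "j > 0" by (metis le_add_diff_inverse nat_le_linear not_less_iff_gr_or_eq zero_less_diff add.commute linorder_not_le)
    define g where "g z = complex_of_real (Re (cnj z ^ m * L z)) * cnj z ^ j" for z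
    have gi: "(\<lambda>t. g (circ t)) integrable_on {0..1}"
      unfolding g_def by (intro circ_integrable[where f = "\<lambda>z. complex_of_real (Re (cnj z ^ m * L z)) * cnj z ^ j"] continuous_intros cL)
    have i1: "(\<lambda>t. L (circ t) * (circ t ^ 0 * cnj (circ t) ^ k)) integrable_on {0..1}"
      by (intro circ_integrable[where f = "\<lambda>z. L z * (z ^ 0 * cnj z ^ k)"] continuous_intros cL)
    have i2: "(\<lambda>t. L (circ t) * (circ t ^ j * cnj (circ t) ^ m)) integrable_on {0..1}"
      by (intro circ_integrable[where f = "\<lambda>z. L z * (z ^ j * cnj z ^ m)"] continuous_intros cL)
    have i3: "(\<lambda>t. cnj (L (circ t) * (circ t ^ j * cnj (circ t) ^ m))) integrable_on {0..1}"
      by (intro circ_integrable[where f = "\<lambda>z. cnj (L z * (z ^ j * cnj z ^ m))"] continuous_intros cL)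
    have "2 * g z = L z * (z ^ 0 * cnj z ^ k) + cnj (L z * (z ^ j * cnj z ^ m))" for z
    proof -
      have "2 * complex_of_real (Re (cnj z ^ m * L z)) = cnj z ^ m * L z + cnj (cnj z ^ m * L z)"
        unfolding complex_add_cnj by simp
      then have "2 * g z = (cnj z ^ m * L z + cnj (cnj z ^ m * L z)) * cnj z ^ j"
        by (simp add: g_def mult.assoc[symmetric])
      then show ?thesis by (simp add: j power_add algebra_simps)
    qed
    then have "2 * integral {0..1} (\<lambda>t. g (circ t)) =
      integral {0..1} (\<lambda>t. L (circ t) * (circ t ^ 0 * cnj (circ t) ^ k) + cnj (L (circ t) * (circ t ^ j * cnj (circ t) ^ m)))"
      by (simp flip: integral_mult_right)
    also have "\<dots> = integral {0..1} (\<lambda>t. L (circ t) * (circ t ^ 0 * cnj (circ t) ^ k))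
       + integral {0..1} (\<lambda>t. cnj (L (circ t) * (circ t ^ j * cnj (circ t) ^ m)))"
      by (rule integral_add[OF i1 i3])
    also have "integral {0..1} (\<lambda>t. cnj (L (circ t) * (circ t ^ j * cnj (circ t) ^ m)))
       = cnj (integral {0..1} (\<lambda>t. L (circ t) * (circ t ^ j * cnj (circ t) ^ m)))"
      using integral_linear[OF i2 bounded_linear_cnj] by (simp add: o_def)
    finally have eq: "l k = 2 * integral {0..1} (\<lambda>t. g (circ t)) - cnj (if j \<le> m then l (m - j) else 0)"
      unfolding circ_coefficient[OF L] by (simp add: l_def)
    have "cmod (integral {0..1} (\<lambda>t. g (circ t))) \<le> integral {0..1} (\<lambda>t. \<bar>Re (cnj (circ t) ^ m * L (circ t))\<bar>)"
      by (rule integral_norm_bound_integral[OF gi circ_integrable[where f = "\<lambda>z. \<bar>Re (cnj z ^ m * L z)\<bar>"]])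
        (auto simp: g_def norm_mult norm_power simp del: times_complex.sel intro!: continuous_intros cL)
    then have "cmod (2 * integral {0..1} (\<lambda>t. g (circ t))) \<le> 2 * A" using A by (simp add: norm_mult)
    moreover have "cmod (cnj (if j \<le> m then l (m - j) else 0)) \<le> B" using B[of "m - j"] B0 by (simp add: l_def)
    ultimately show ?thesis unfolding l_def[symmetric] eq
      by (smt (verit) norm_triangle_ineq4)
  qed
qed

text \<open>On the circle $L = c\,p\,H$ satisfies $\bar z^m L = P H$, so its $m$-th Taylor coefficient is the mean of
$P H$, and the sign condition turns the mean of $P\,\mathrm{Re}\,H$ into that of its absolute value.
The coefficients of $L$ up to order $m$ are bounded through $H$ on the disc of radius
$\delta$ by Cauchy's inequality, the others by \<open>real_part_coefficient_bound\<close>. Finally each factor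
$(w-\zeta)/2$ is at least $1/4$ on the half disc, which gives $16^m$.\<close>

lemma few_sign_changes_bound:
  assumes H: "H holomorphic_on UNIV"
    and S: "finite S" "\<And>\<zeta>. \<zeta> \<in> S \<Longrightarrow> cmod \<zeta> = 1" "card S = 2 * m" and c: "cmod c = 1"
  defines "P \<equiv> \<lambda>z. c * cnj z ^ m * (\<Prod>\<zeta>\<in>S. (z - \<zeta>) / 2)"
  assumes P: "\<And>z. cmod z = 1 \<Longrightarrow> Im (P z) = 0"
    and e: "continuous_on (sphere 0 1) e" "\<And>z. cmod z = 1 \<Longrightarrow> 0 \<le> e z"
      "integral {0..1} (\<lambda>t. e (circ t)) \<le> \<eta>"
    and sign: "\<And>z. cmod z = 1 \<Longrightarrow> - e z \<le> Re (P z) * Re (H z)"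
    and M: "\<And>z. cmod z \<le> \<delta> \<Longrightarrow> cmod (H z) \<le> M" and \<delta>: "0 < \<delta>" "\<delta> \<le> 1"
    and w: "cmod w \<le> 1/2"
  shows "cmod (H w) \<le> 2 * 16 ^ m * (3 * M / \<delta> ^ m + 4 * \<eta>)"
proof -
  define p where "p z = (\<Prod>\<zeta>\<in>S. (z - \<zeta>) / 2)" for z
  define L where "L z = c * p z * H z" for z
  have p_hol: "p holomorphic_on UNIV" unfolding p_def by (intro holomorphic_intros) auto
  have L: "L holomorphic_on UNIV" unfolding L_def by (intro holomorphic_intros p_hol H)
  have cL: "continuous_on S L" for S using L holomorphic_on_imp_continuous_on holomorphic_on_subset by blast
  have M0: "M \<ge> 0" using order_trans[OF norm_ge_zero M[of 0]] \<delta> by simp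
  have p_le: "cmod (p z) \<le> 1" if "cmod z \<le> 1" for z
    unfolding p_def by (rule prod_half_le_1[OF S(2) that])
  have low: "cmod ((deriv ^^ k) L 0 / fact k) \<le> M / \<delta> ^ m" if k: "k \<le> m" for k
  proof -
    have "cmod ((deriv ^^ k) L 0) \<le> fact k * M / \<delta> ^ k"
    proof (rule Cauchy_inequality)
      show "cmod (L x) \<le> M" if "cmod (0 - x) = \<delta>" for x
      proof -
        have "cmod (L x) = cmod (p x) * cmod (H x)" by (simp add: L_def norm_mult c)
        also have "\<dots> \<le> 1 * M" using p_le[of x] M[of x] that \<delta> by (intro mult_mono) auto
        finally show ?thesis by simp
      qed
    qed (use L \<delta> cL in \<open>auto intro: holomorphic_on_subset\<close>)
    then have "cmod ((deriv ^^ k) L 0 / fact k) \<le> M / \<delta> ^ k" by (simp add: norm_divide field_simps)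
    also have "\<dots> \<le> M / \<delta> ^ m"
      using M0 \<delta> k by (intro divide_left_mono power_decreasing) auto
    finally show ?thesis .
  qed
  have PH: "Re (cnj z ^ m * L z) = Re (P z) * Re (H z)" if "cmod z = 1" for z
  proof -
    have "cnj z ^ m * L z = P z * H z" by (simp add: P_def L_def p_def mult_ac)
    then have "Re (cnj z ^ m * L z) = Re (P z * H z)" by (rule arg_cong)
    also have "\<dots> = Re (P z) * Re (H z) - Im (P z) * Im (H z)" by (rule times_complex.sel)
    finally show ?thesis unfolding P[OF that] by simp
  qed
  have iL: "(\<lambda>t. cnj (circ t) ^ m * L (circ t)) integrable_on {0..1}"
    by (intro circ_integrable[where f = "\<lambda>z. cnj z ^ m * L z"] continuous_intros cL)
  have iR: "(\<lambda>t. Re (cnj (circ t) ^ m * L (circ t))) integrable_on {0..1}"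
    by (intro circ_integrable[where f = "\<lambda>z. Re (cnj z ^ m * L z)"] continuous_intros cL)
  have ie: "(\<lambda>t. e (circ t)) integrable_on {0..1}" by (rule circ_integrable[OF e(1)])
  have "integral {0..1} (\<lambda>t. Re (cnj (circ t) ^ m * L (circ t)))
     = Re (integral {0..1} (\<lambda>t. cnj (circ t) ^ m * L (circ t)))"
    using integral_linear[OF iL bounded_linear_Re] by (simp add: o_def)
  also have "integral {0..1} (\<lambda>t. cnj (circ t) ^ m * L (circ t)) = (deriv ^^ m) L 0 / fact m"
    using circ_coefficient0[OF L, of m] by (simp add: mult.commute)
  also have "Re \<dots> \<le> M / \<delta> ^ m" using low[OF order_refl] complex_Re_le_cmod order_trans by blast
  finally have mean: "integral {0..1} (\<lambda>t. Re (cnj (circ t) ^ m * L (circ t))) \<le> M / \<delta> ^ m" .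
  have "integral {0..1} (\<lambda>t. \<bar>Re (cnj (circ t) ^ m * L (circ t))\<bar>)
     \<le> integral {0..1} (\<lambda>t. Re (cnj (circ t) ^ m * L (circ t)) + 2 * e (circ t))"
  proof (rule integral_le)
    show "(\<lambda>t. \<bar>Re (cnj (circ t) ^ m * L (circ t))\<bar>) integrable_on {0..1}"
      by (intro circ_integrable[where f = "\<lambda>z. \<bar>Re (cnj z ^ m * L z)\<bar>"] continuous_intros cL)
    show "(\<lambda>t. Re (cnj (circ t) ^ m * L (circ t)) + 2 * e (circ t)) integrable_on {0..1}"
      by (intro integrable_add iR integrable_on_mult_right ie)
    show "\<bar>Re (cnj (circ t) ^ m * L (circ t))\<bar> \<le> Re (cnj (circ t) ^ m * L (circ t)) + 2 * e (circ t)" for t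
    proof -
      have "- e (circ t) \<le> Re (cnj (circ t) ^ m * L (circ t))"
        using sign[OF norm_circ] unfolding PH[OF norm_circ] .
      with e(2)[OF norm_circ, of t] show ?thesis by (intro abs_leI) argo+
    qed
  qed
  also have "\<dots> = integral {0..1} (\<lambda>t. Re (cnj (circ t) ^ m * L (circ t))) + 2 * integral {0..1} (\<lambda>t. e (circ t))"
    using integral_add[OF iR integrable_on_mult_right[OF ie, of 2]] by simp
  finally have A: "integral {0..1} (\<lambda>t. \<bar>Re (cnj (circ t) ^ m * L (circ t))\<bar>) \<le> M / \<delta> ^ m + 2 * \<eta>"
    using mean e(3) by linarith
  have "cmod (L w) \<le> 2 * (2 * (M / \<delta> ^ m + 2 * \<eta>) + M / \<delta> ^ m)"
    by (rule coefficient_bound_imp_bound[OF L real_part_coefficient_bound[OF L A low] w])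
  then have Lw: "cmod (L w) \<le> 2 * (3 * M / \<delta> ^ m + 4 * \<eta>)" by simp
  have p_ge: "cmod (p w) \<ge> 1 / 16 ^ m"
  proof -
    have "(1/4) ^ card S \<le> (\<Prod>\<zeta>\<in>S. cmod ((w - \<zeta>) / 2))"
    proof -
      have "(\<Prod>\<zeta>\<in>S. 1/4) \<le> (\<Prod>\<zeta>\<in>S. cmod ((w - \<zeta>) / 2))"
      proof (rule prod_mono)
        fix \<zeta> assume "\<zeta> \<in> S"
        then show "0 \<le> (1/4::real) \<and> 1/4 \<le> cmod ((w - \<zeta>) / 2)"
          using norm_triangle_ineq2[of \<zeta> w] S(2) w by (simp add: norm_divide norm_minus_commute)
      qed
      then show ?thesis by simp
    qed
    moreover have "(1/4::real) ^ card S = 1 / 16 ^ m" by (simp add: S(3) power_mult power_divide)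
    ultimately show ?thesis unfolding p_def prod_norm by simp
  qed
  have "1 / 16 ^ m * cmod (H w) \<le> cmod (p w) * cmod (H w)" by (intro mult_right_mono p_ge) auto
  also have "\<dots> = cmod (L w)" by (simp add: L_def norm_mult c)
  finally have "cmod (H w) \<le> 16 ^ m * cmod (L w)" by (simp add: field_simps)
  also have "\<dots> \<le> 16 ^ m * (2 * (3 * M / \<delta> ^ m + 4 * \<eta>))" by (intro mult_left_mono Lw) auto
  finally show ?thesis by (simp only: mult_ac)
qed

section \<open>Sign changes of a function on the circle\<close>

lemma nonzero_constant_sign:
  fixes g :: "real \<Rightarrow> real"
  assumes g: "continuous_on {a<..<b} g" and nz: "\<And>t. t \<in> {a<..<b} \<Longrightarrow> g t \<noteq> 0"
  shows "\<exists>\<sigma>\<in>{1, -1}. \<forall>t\<in>{a<..<b}. \<sigma> * g t > 0"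
proof (rule ccontr)
  assume neg: "\<not> ?thesis"
  obtain s where s: "s \<in> {a<..<b}" "\<not> g s > 0" using neg by force
  obtain t where t: "t \<in> {a<..<b}" "\<not> g t < 0" using neg by force
  have "is_interval (g ` {a<..<b})"
    using connected_continuous_image[OF g] is_interval_connected_1 by auto
  moreover have "g s \<le> 0" "0 \<le> g t" using s t by auto
  ultimately have "0 \<in> g ` {a<..<b}" unfolding is_interval_1
    using s t by blast
  then show False using nz by force
qed

text \<open>Induction on the largest candidate $s$: on the right of $s$ there are no zeros, so the sign is
constant there, and $s$ joins $U$ exactly if this sign differs from the one that
the polynomial for the left part predicts.\<close>

lemma sign_change_product:
  fixes g :: "real \<Rightarrow> real"
  assumes "finite T" and "continuous_on {a<..<b} g"
    and "\<And>t. t \<in> {a<..<b} \<Longrightarrow> g t = 0 \<Longrightarrow> t \<in> T"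
  shows "\<exists>U \<sigma>. U \<subseteq> {t \<in> {a<..<b}. g t = 0} \<and> U \<subseteq> T \<and> \<sigma> \<in> {1, -1} \<and> (\<forall>t\<in>{a<..<b}. 0 \<le> \<sigma> * g t * (\<Prod>u\<in>U. t - u))"
  using assms
proof (induction T arbitrary: b rule: finite_linorder_max_induct)
  case empty
  then have "\<exists>\<sigma>\<in>{1, -1}. \<forall>t\<in>{a<..<b}. \<sigma> * g t > 0" by (intro nonzero_constant_sign) auto
  then show ?case by (intro exI[of _ "{}"]) force
next
  case (insert s A)
  show ?case
  proof (cases "s \<in> {a<..<b} \<and> g s = 0")
    case False
    have "\<exists>U \<sigma>. U \<subseteq> {t \<in> {a<..<b}. g t = 0} \<and> U \<subseteq> A \<and> \<sigma> \<in> {1, -1} \<and> (\<forall>t\<in>{a<..<b}. 0 \<le> \<sigma> * g t * (\<Prod>u\<in>U. t - u))"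
      by (rule insert.IH) (use insert.prems False in auto)
    then show ?thesis by (meson subset_insertI2)
  next
    case True
    have "\<exists>U \<sigma>. U \<subseteq> {t \<in> {a<..<s}. g t = 0} \<and> U \<subseteq> A \<and> \<sigma> \<in> {1, -1} \<and> (\<forall>t\<in>{a<..<s}. 0 \<le> \<sigma> * g t * (\<Prod>u\<in>U. t - u))"
    proof (rule insert.IH)
      show "continuous_on {a<..<s} g" by (rule continuous_on_subset[OF insert.prems(1)]) (use True in auto)
      show "t \<in> A" if "t \<in> {a<..<s}" "g t = 0" for t using insert.prems(2)[of t] that True by auto
    qed
    then obtain U \<sigma> where U: "U \<subseteq> {t \<in> {a<..<s}. g t = 0}" "U \<subseteq> A" "\<sigma> \<in> {1, -1}"
      "\<And>t. t \<in> {a<..<s} \<Longrightarrow> 0 \<le> \<sigma> * g t * (\<Prod>u\<in>U. t - u)" by blast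
    have fU: "finite U" using U(2) insert.hyps(1) finite_subset by blast
    have "\<exists>\<tau>\<in>{1, -1}. \<forall>t\<in>{s<..<b}. \<tau> * g t > 0"
    proof (rule nonzero_constant_sign)
      show "continuous_on {s<..<b} g" by (rule continuous_on_subset[OF insert.prems(1)]) (use True in auto)
      show "g t \<noteq> 0" if "t \<in> {s<..<b}" for t
        using insert.prems(2)[of t] insert.hyps(2) that True by force
    qed
    then obtain \<tau> where \<tau>: "\<tau> \<in> {1, -1}" "\<And>t. t \<in> {s<..<b} \<Longrightarrow> \<tau> * g t > 0" by blast
    have pos: "(\<Prod>u\<in>U. t - u) > 0" if "t > s" for t
      by (rule prod_pos) (use U(1) that in force)
    show ?thesis
    proof (cases "\<tau> = \<sigma>")
      case eq: True
      have "0 \<le> \<sigma> * g t * (\<Prod>u\<in>U. t - u)" if t: "t \<in> {a<..<b}" for t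
      proof -
        consider "t < s" | "t = s" | "t > s" by linarith
        then show ?thesis
        proof cases
          case 3
          then show ?thesis using mult_pos_pos[OF \<tau>(2)[of t] pos[of t]] t eq by (simp add: less_imp_le)
        qed (use U(4)[of t] t True in auto)
      qed
      then show ?thesis using U True by (intro exI[of _ U] exI[of _ \<sigma>]) auto
    next
      case False
      then have \<tau>\<sigma>: "\<tau> = - \<sigma>" using \<tau>(1) U(3) by auto
      have sU: "s \<notin> U" using U(1) by auto
      have "0 \<le> \<tau> * g t * (\<Prod>u\<in>insert s U. t - u)" if t: "t \<in> {a<..<b}" for t
      proof -
        have e: "\<tau> * g t * (\<Prod>u\<in>insert s U. t - u) = (s - t) * (\<sigma> * g t * (\<Prod>u\<in>U. t - u))"
          "\<tau> * g t * (\<Prod>u\<in>insert s U. t - u) = (t - s) * (\<tau> * g t * (\<Prod>u\<in>U. t - u))"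
          using sU fU \<tau>\<sigma> by (auto simp: algebra_simps)
        consider "t < s" | "t = s" | "t > s" by linarith
        then show ?thesis
        proof cases
          case 1
          then show ?thesis unfolding e(1) using mult_nonneg_nonneg[OF _ U(4)[of t], of "s - t"] t by simp
        next
          case 3
          then show ?thesis unfolding e(2)
            using mult_pos_pos[OF _ mult_pos_pos[OF \<tau>(2)[of t] pos[of t]], of "t - s"] t by (simp add: less_imp_le)
        qed (use True in auto)
      qed
      then show ?thesis using U True \<tau>(1) by (intro exI[of _ "insert s U"] exI[of _ \<tau>]) auto
    qed
  qed
qed

text \<open>Start the parametrisation at a point $z_0$ with $F(z_0)\ne 0$. Periodicity forces an even
number of sign changes on $[0,2\pi]$, and half-angle sines have the signs of the linear factors. For an
even number of factors, the product of the sines is $\prod(z-\zeta)/2$ times a constant multiple of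
$\bar z^m$.\<close>

lemma sign_change_polynomial:
  fixes F :: "complex \<Rightarrow> real"
  assumes F: "continuous_on (sphere 0 1) F" and fin: "finite {z \<in> sphere 0 1. F z = 0}"
  obtains S m c where "S \<subseteq> {z \<in> sphere 0 1. F z = 0}" "card S = 2 * m" "cmod c = 1"
    "\<And>z. cmod z = 1 \<Longrightarrow> Im (c * cnj z ^ m * (\<Prod>\<zeta>\<in>S. (z - \<zeta>) / 2)) = 0"
    "\<And>z. cmod z = 1 \<Longrightarrow> 0 \<le> Re (c * cnj z ^ m * (\<Prod>\<zeta>\<in>S. (z - \<zeta>) / 2)) * F z"
proof -
  have uncircle: "\<exists>t. 0 \<le> t \<and> t < 2 * pi \<and> z = exp (\<i> * of_real t)" if "cmod z = 1" for z
    using that Arg2pi[of z] complex_norm_eq_1_exp[of z] by metis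
  have inj: "inj_on (\<lambda>t. exp (\<i> * complex_of_real t)) {0..<2*pi}"
  proof (rule inj_onI)
    fix s t :: real assume st: "s \<in> {0..<2*pi}" "t \<in> {0..<2*pi}" "exp (\<i> * of_real s) = exp (\<i> * of_real t)"
    have "Arg2pi (exp (\<i> * of_real t)) = t" by (rule Arg2pi_unique[of 1]) (use st in auto)
    moreover have "Arg2pi (exp (\<i> * of_real t)) = s" by (rule Arg2pi_unique[of 1]) (use st in auto)
    ultimately show "s = t" by simp
  qed
  have "infinite (sphere (0::complex) 1)"
  proof
    assume "finite (sphere (0::complex) 1)"
    moreover have "(\<lambda>t. exp (\<i> * complex_of_real t)) ` {0..<2*pi} \<subseteq> sphere 0 1" by auto
    ultimately have "finite {0..<2*pi}" using inj finite_subset finite_imageD by metis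
    then show False by (simp add: infinite_Ico)
  qed
  then obtain z0 where z0: "cmod z0 = 1" "F z0 \<noteq> 0"
    using fin by (metis (mono_tags, lifting) finite_subset mem_Collect_eq mem_sphere_0 subsetI)
  have z00: "z0 \<noteq> 0" using z0 by auto
  define p where "p t = z0 * exp (\<i> * complex_of_real t)" for t
  have np: "cmod (p t) = 1" for t by (simp add: p_def norm_mult z0)
  have pinj: "inj_on p {0..<2*pi}" using inj z00 by (auto simp: p_def inj_on_def)
  have pcont: "continuous_on A p" for A unfolding p_def by (intro continuous_intros)
  define g where "g t = F (p t)" for t
  have gcont: "continuous_on A g" for A unfolding g_def
    by (rule continuous_on_compose2[OF F pcont]) (auto simp: np)
  define T where "T = {t \<in> {0<..<2*pi}. g t = 0}"
  have pT: "p ` T \<subseteq> {z \<in> sphere 0 1. F z = 0}" by (auto simp: T_def g_def np)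
  have Tinj: "inj_on p T" by (rule inj_on_subset[OF pinj]) (auto simp: T_def)
  have fT: "finite T" using pT fin Tinj by (meson finite_imageD finite_subset)
  obtain U \<sigma> where U: "U \<subseteq> {t \<in> {0<..<2*pi}. g t = 0}" "\<sigma> \<in> {1, -1::real}"
    "\<And>t. t \<in> {0<..<2*pi} \<Longrightarrow> 0 \<le> \<sigma> * g t * (\<Prod>u\<in>U. t - u)"
    using sign_change_product[OF fT gcont, of 0 "2 * pi"] unfolding T_def by blast
  have fU: "finite U" using U(1) fT unfolding T_def by (rule finite_subset)
  have closed: "0 \<le> \<sigma> * g t * (\<Prod>u\<in>U. t - u)" if "t \<in> {0..2*pi}" for t
  proof (rule continuous_ge_on_closure[of "{0<..<2*pi}" "\<lambda>t. \<sigma> * g t * (\<Prod>u\<in>U. t - u)" t 0])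
    show "continuous_on (closure {0<..<2*pi}) (\<lambda>t. \<sigma> * g t * (\<Prod>u\<in>U. t - u))"
      by (intro continuous_intros gcont)
  qed (use U(3) that in auto)
  have g0: "g 0 = F z0" "g (2 * pi) = F z0"
    by (simp_all add: g_def p_def) (metis exp_two_pi_i mult.commute mult.right_neutral mult.assoc)
  have "even (card U)"
  proof -
    have "(\<Prod>u\<in>U. 0 - u) = (-1) ^ card U * (\<Prod>u\<in>U. u)"
      by (simp add: prod_uminus)
    moreover have "(\<Prod>u\<in>U. u) > 0" "(\<Prod>u\<in>U. 2 * pi - u) > 0"
      by (rule prod_pos; use U(1) in force)+
    moreover have "\<sigma> * F z0 * (\<Prod>u\<in>U. 0 - u) \<ge> 0" "\<sigma> * F z0 * (\<Prod>u\<in>U. 2 * pi - u) \<ge> 0"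
      using closed[of 0] closed[of "2 * pi"] unfolding g0 by auto
    ultimately have "\<sigma> * F z0 * (-1) ^ card U \<ge> 0" "\<sigma> * F z0 \<ge> 0"
      by (auto simp: zero_le_mult_iff)
    moreover have "\<sigma> * F z0 \<noteq> 0" using U(2) z0 by auto
    ultimately show ?thesis by (cases "even (card U)") auto
  qed
  then obtain m where m: "card U = 2 * m" by blast
  have sines: "0 \<le> \<sigma> * g t * (\<Prod>u\<in>U. sin ((t - u) / 2))" if t: "t \<in> {0..<2*pi}" for t
  proof (cases "t \<in> U")
    case True
    then show ?thesis using U(1) by auto
  next
    case False
    have "0 < (t - u) * sin ((t - u) / 2)" if u: "u \<in> U" for u
    proof -
      have u': "0 < u" "u < 2 * pi" "u \<noteq> t" using U(1) u False by auto
      consider "t < u" | "t > u" using u' by linarith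
      then show ?thesis
      proof cases
        case 1
        then have "sin ((u - t) / 2) > 0" using t u' by (intro sin_gt_zero) auto
        moreover have "sin ((u - t) / 2) = - sin ((t - u) / 2)"
          using sin_minus[of "(t - u) / 2"] by (simp add: minus_divide_left)
        then have "(t - u) * sin ((t - u) / 2) = (u - t) * sin ((u - t) / 2)"
          by (simp add: left_diff_distrib)
        ultimately show ?thesis using 1 by simp
      next
        case 2
        then have "sin ((t - u) / 2) > 0" using t u' by (intro sin_gt_zero) auto
        then show ?thesis using 2 by simp
      qed
    qed
    then have "0 < (\<Prod>u\<in>U. (t - u) * sin ((t - u) / 2))" by (intro prod_pos)
    then have "0 < (\<Prod>u\<in>U. t - u) * (\<Prod>u\<in>U. sin ((t - u) / 2))" by (simp add: prod.distrib)
    then show ?thesis using closed[of t] t by (auto simp: zero_le_mult_iff zero_less_mult_iff)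
  qed
  define E where "E = (\<Prod>u\<in>U. exp (\<i> * complex_of_real (u / 2)))"
  define X where "X = (- z0) ^ m * E"
  have "cmod E = 1" unfolding E_def prod_norm[symmetric] by (intro prod.neutral) simp
  then have nX: "cmod X = 1" by (simp add: X_def norm_mult norm_power z0)
  define S where "S = p ` U"
  have Up: "inj_on p U" by (rule inj_on_subset[OF pinj]) (use U(1) in auto)
  have main: "of_real \<sigma> * cnj X * cnj z ^ m * (\<Prod>\<zeta>\<in>S. (z - \<zeta>) / 2) = of_real (\<sigma> * (\<Prod>u\<in>U. sin ((t - u) / 2)))"
    if z: "z = p t" for z t
  proof -
    have "(\<Prod>\<zeta>\<in>S. (z - \<zeta>) / 2) = (\<Prod>u\<in>U. (z - p u) / 2)"
      unfolding S_def by (simp add: prod.reindex[OF Up])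
    also have "\<dots> = (\<Prod>u\<in>U. (\<i> * z0 * exp (\<i> * of_real (t / 2))) * exp (\<i> * of_real (u / 2)) * of_real (sin ((t - u) / 2)))"
    proof (rule prod.cong[OF refl])
      fix u
      have "of_real (sin ((t - u) / 2)) = (exp (\<i> * of_real ((t - u) / 2)) - exp (- (\<i> * of_real ((t - u) / 2)))) / (2 * \<i>)"
        by (simp only: sin_of_real[symmetric] sin_exp_eq)
      also have "exp (\<i> * of_real ((t - u) / 2)) = exp (\<i> * of_real (t/2)) / exp (\<i> * of_real (u/2))"
        by (simp add: diff_divide_distrib algebra_simps flip: exp_diff)
      also have "exp (- (\<i> * of_real ((t - u) / 2))) = exp (\<i> * of_real (u/2)) / exp (\<i> * of_real (t/2))"
        by (simp add: diff_divide_distrib algebra_simps flip: exp_diff)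
      finally have s: "of_real (sin ((t - u) / 2)) =
        (exp (\<i> * of_real (t/2)) / exp (\<i> * of_real (u/2)) - exp (\<i> * of_real (u/2)) / exp (\<i> * of_real (t/2))) / (2 * \<i>)" .
      have sq: "exp (\<i> * complex_of_real r) = exp (\<i> * of_real (r/2)) * exp (\<i> * of_real (r/2))" for r
        by (simp flip: exp_add distrib_left)
      show "(z - p u) / 2 = (\<i> * z0 * exp (\<i> * of_real (t / 2))) * exp (\<i> * of_real (u / 2)) * of_real (sin ((t - u) / 2))"
        unfolding s z p_def sq[of t] sq[of u] by (simp add: field_simps)
    qed
    also have "\<dots> = (\<i> * z0 * exp (\<i> * of_real (t / 2))) ^ (2 * m) * E * of_real (\<Prod>u\<in>U. sin ((t - u) / 2))"
      by (simp add: prod.distrib E_def m)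
    also have "(\<i> * z0 * exp (\<i> * of_real (t / 2))) ^ (2 * m) = ((- z0) * z) ^ m"
      unfolding power_mult z p_def
      by (simp add: power2_eq_square algebra_simps flip: exp_add)
    finally have 1: "(\<Prod>\<zeta>\<in>S. (z - \<zeta>) / 2) = X * z ^ m * of_real (\<Prod>u\<in>U. sin ((t - u) / 2))"
      by (simp only: power_mult_distrib X_def mult_ac)
    have 2: "cnj X * X = 1" "cnj z ^ m * z ^ m = 1"
      using complex_norm_square[of X] complex_norm_square[of "z ^ m"] nX np[of t] z
      by (simp_all add: norm_power mult.commute)
    have "of_real \<sigma> * cnj X * cnj z ^ m * (X * z ^ m * complex_of_real (\<Prod>u\<in>U. sin ((t - u) / 2)))
       = of_real \<sigma> * (cnj X * X) * (cnj z ^ m * z ^ m) * complex_of_real (\<Prod>u\<in>U. sin ((t - u) / 2))"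
      by (simp only: mult_ac)
    then show ?thesis unfolding 1 2 by simp
  qed
  have par: "\<exists>t\<in>{0..<2*pi}. z = p t" if z: "cmod z = 1" for z
  proof -
    have "cmod (z / z0) = 1" using z z0 by (simp add: norm_divide)
    from uncircle[OF this] obtain t where "0 \<le> t" "t < 2 * pi" "z / z0 = exp (\<i> * of_real t)" by blast
    then show ?thesis using z00 by (intro bexI[of _ t]) (auto simp: p_def field_simps)
  qed
  show ?thesis
  proof (rule that[of S m "of_real \<sigma> * cnj X"])
    show "S \<subseteq> {z \<in> sphere 0 1. F z = 0}" unfolding S_def using U(1) pT by (auto simp: T_def)
    show "card S = 2 * m" unfolding S_def using card_image[OF Up] m by simp
    show "cmod (of_real \<sigma> * cnj X) = 1" using U(2) nX by (auto simp: norm_mult)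
    fix z :: complex assume "cmod z = 1"
    from par[OF this] obtain t where t: "t \<in> {0..<2*pi}" "z = p t" by blast
    show "Im (of_real \<sigma> * cnj X * cnj z ^ m * (\<Prod>\<zeta>\<in>S. (z - \<zeta>) / 2)) = 0"
      unfolding main[OF t(2)] by (rule Im_complex_of_real)
    show "0 \<le> Re (of_real \<sigma> * cnj X * cnj z ^ m * (\<Prod>\<zeta>\<in>S. (z - \<zeta>) / 2)) * F z"
      unfolding main[OF t(2)] Re_complex_of_real using sines[OF t(1)] by (simp add: t(2) g_def mult_ac)
  qed
qed

section \<open>Estimates on the unit disc\<close>

lemma le_if_le_add_small:
  fixes x a b :: real
  assumes "\<And>t. 0 < t \<Longrightarrow> t \<le> 1 \<Longrightarrow> x \<le> a + t * b" and b: "b \<ge> 0"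
  shows "x \<le> a"
proof (rule field_le_epsilon)
  fix e :: real assume e: "e > 0"
  define t where "t = min 1 (e / (b + 1))"
  have t: "0 < t" "t \<le> 1" "t \<le> e / (b + 1)" using e b by (auto simp: t_def)
  have "t * b \<le> t * (b + 1)" using t by simp
  also have "\<dots> \<le> e" using t(3) b pos_le_divide_eq[of "b + 1" t e] by simp
  finally show "x \<le> a + e" using assms(1)[OF t(1,2)] by linarith
qed

lemma exp_small_bounds:
  assumes "cmod s \<le> 1/10" shows "cmod (exp s) \<le> 2" "cmod (exp (- s)) \<le> 2"
proof -
  have e: "exp (1/10 :: real) \<le> 2"
  proof -
    have "exp (1/10::real) \<le> exp (1/2)" by simp
    also have "\<dots> \<le> 2" by (rule exp_half_le2)
    finally show ?thesis .
  qed
  have h: "exp (cmod s) \<le> 2" using assms order_trans[OF _ e] by simp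
  show "cmod (exp s) \<le> 2" by (rule order_trans[OF norm_exp h])
  show "cmod (exp (- s)) \<le> 2" by (rule order_trans[OF norm_exp]) (use h in simp)
qed

text \<open>The reduction from $F$ to a holomorphic function, with all constants absolute.\<close>

lemma holomorphic_representation:
  fixes q F :: "complex \<Rightarrow> real"
  assumes contF: "continuous_on (cball 0 1) F"
    and cont: "continuous_on (cball 0 1) q" and q: "\<And>z. cmod z \<le> 1 \<Longrightarrow> \<bar>q z\<bar> \<le> 1/10000"
    and lap: "\<And>z. cmod z < 1 \<Longrightarrow> has_lap F z (- q z * F z)" and \<tau>: "\<tau> > 0"
  obtains W s H \<phi> where "zpoly s" "\<And>z. cmod z \<le> 1 \<Longrightarrow> cmod (s z) \<le> 1/10"
    "H holomorphic_on UNIV" "\<And>z. cmod z \<le> 1 \<Longrightarrow> cmod (exp (- s z) * W z - H z) \<le> 100 * \<tau>"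
    "\<And>z. cmod z \<le> 1 \<Longrightarrow> 1/2 \<le> \<phi> z \<and> \<phi> z \<le> (3/2 :: real)"
    "\<And>z. cmod z \<le> 1 \<Longrightarrow> \<bar>Re (W z) - \<phi> z * F z\<bar> \<le> \<tau>"
    "\<And>\<alpha> \<beta> M z. 0 < \<alpha> \<Longrightarrow> \<alpha> < \<beta> \<Longrightarrow> \<beta> \<le> 1 \<Longrightarrow> (\<And>z. cmod z \<le> \<beta> \<Longrightarrow> \<bar>F z\<bar> \<le> M) \<Longrightarrow>
       cmod z \<le> \<alpha> \<Longrightarrow> cmod (H z) \<le> 40 * \<beta> / (\<beta> - \<alpha>) * (M + \<tau>) + 100 * \<tau>"
    "\<And>z. cmod z \<le> 1 \<Longrightarrow> \<bar>F z\<bar> \<le> 4 * cmod (H z) + 402 * \<tau>"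
proof -
  have e: "(0::real) < 1/10000" "(1/10000::real) \<le> 1/2" by simp_all
  show ?thesis
  proof (rule approx_pseudoanalytic[OF contF cont q e lap \<tau>], goal_cases)
    \<comment> \<open>cases 1 and 2 are the trivial bounds on the arguments of \<open>q\<close> and \<open>F\<close>\<close>
    case (3 W b \<phi>)
    note W = 3(1-4) and \<phi> = 3(5) and ReW = 3(6) and Wb = 3(7)
    have b300: "cmod (b z) \<le> 1/300" if "cmod z \<le> 1" for z using W(3)[OF that] by simp
    obtain s H where s: "zpoly s" "\<And>z. cmod z \<le> 1 \<Longrightarrow> cmod (s z) \<le> 1/10"
      and H: "H holomorphic_on UNIV" "\<And>z. cmod z \<le> 1 \<Longrightarrow> cmod (exp (- s z) * W z - H z) \<le> 100 * \<tau>"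
      using similarity_principle[OF W(1,2) b300 W(4) \<tau>] by metis
    have H_le: "cmod (H z) \<le> 2 * cmod (W z) + 100 * \<tau>" if z: "cmod z \<le> 1" for z
    proof -
      have "cmod (H z) \<le> cmod (exp (- s z) * W z) + cmod (exp (- s z) * W z - H z)"
        using norm_triangle_ineq4[of "exp (- s z) * W z" "exp (- s z) * W z - H z"] by simp
      also have "cmod (exp (- s z) * W z) \<le> 2 * cmod (W z)"
        unfolding norm_mult using exp_small_bounds(2)[OF s(2)[OF z]] by (intro mult_right_mono) auto
      finally show ?thesis using H(2)[OF z] by linarith
  qed
  have W_le: "cmod (W z) \<le> 2 * (cmod (H z) + 100 * \<tau>)" if z: "cmod z \<le> 1" for z
  proof -
    have "W z = exp (s z) * (exp (- s z) * W z)" by (simp add: mult.assoc[symmetric] flip: exp_add)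
    then have "cmod (W z) = cmod (exp (s z)) * cmod (exp (- s z) * W z)" by (metis norm_mult)
    also have "\<dots> \<le> 2 * cmod (exp (- s z) * W z)"
      using exp_small_bounds(1)[OF s(2)[OF z]] by (intro mult_right_mono) auto
    also have "cmod (exp (- s z) * W z) \<le> cmod (H z) + 100 * \<tau>"
      using norm_triangle_ineq[of "H z" "exp (- s z) * W z - H z"] H(2)[OF z] by simp
    finally show ?thesis by simp
  qed
  show ?thesis
  proof (rule that[OF s H \<phi> ReW])
    show "cmod (H z) \<le> 40 * \<beta> / (\<beta> - \<alpha>) * (M + \<tau>) + 100 * \<tau>"
      if "0 < \<alpha>" "\<alpha> < \<beta>" "\<beta> \<le> 1" "\<And>z. cmod z \<le> \<beta> \<Longrightarrow> \<bar>F z\<bar> \<le> M" "cmod z \<le> \<alpha>" for \<alpha> \<beta> M z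
    proof -
      have z1: "cmod z \<le> 1" using that by linarith
      have "2 * cmod (W z) \<le> 2 * (20 * \<beta> / (\<beta> - \<alpha>) * (M + \<tau>))"
        using Wb[OF that] by simp
      also have "\<dots> = 40 * \<beta> / (\<beta> - \<alpha>) * (M + \<tau>)" by simp
      finally show ?thesis using H_le[OF z1] by linarith
    qed
    show "\<bar>F z\<bar> \<le> 4 * cmod (H z) + 402 * \<tau>" if z: "cmod z \<le> 1" for z
    proof -
      have "1/2 * \<bar>F z\<bar> \<le> \<phi> z * \<bar>F z\<bar>" using \<phi>[OF z] by (intro mult_right_mono) auto
      also have "\<dots> = \<bar>\<phi> z * F z\<bar>" using \<phi>[OF z] by (simp add: abs_mult)
      also have "\<dots> \<le> \<bar>Re (W z)\<bar> + \<tau>" using ReW[OF z] by linarith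
      also have "\<dots> \<le> cmod (W z) + \<tau>" using abs_Re_le_cmod[of "W z"] by simp
      finally have "1/2 * \<bar>F z\<bar> \<le> cmod (W z) + \<tau>" .
      with W_le[OF z] show ?thesis by argo
    qed
  qed
  qed
qed

text \<open>Apply \<open>few_sign_changes_bound\<close> to $H = e^K H_0$. The errors in its sign condition carry the factor
$|e^K|$, of which only the mean is bounded; they disappear as $\tau$ tends to 0, while $\eta$ is a given defect of
sign of $F$ itself.\<close>

lemma disc_estimate:
  fixes q F :: "complex \<Rightarrow> real"
  assumes contF: "continuous_on (cball 0 1) F"
    and cont: "continuous_on (cball 0 1) q" and q: "\<And>z. cmod z \<le> 1 \<Longrightarrow> \<bar>q z\<bar> \<le> 1/10000"
    and lap: "\<And>z. cmod z < 1 \<Longrightarrow> has_lap F z (- q z * F z)"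
    and S: "finite S" "\<And>\<zeta>. \<zeta> \<in> S \<Longrightarrow> cmod \<zeta> = 1" "card S = 2 * m" and c: "cmod c = 1"
  defines "P \<equiv> \<lambda>z. c * cnj z ^ m * (\<Prod>\<zeta>\<in>S. (z - \<zeta>) / 2)"
  assumes P: "\<And>z. cmod z = 1 \<Longrightarrow> Im (P z) = 0"
    and sign: "\<And>z. cmod z = 1 \<Longrightarrow> - \<eta> \<le> Re (P z) * F z" and \<eta>: "\<eta> \<ge> 0"
    and \<delta>: "0 < \<delta>" "\<delta> \<le> 1/2" and M: "\<And>z. cmod z \<le> 2 * \<delta> \<Longrightarrow> \<bar>F z\<bar> \<le> M"
    and w: "cmod w \<le> 1/2"
  shows "\<bar>F w\<bar> \<le> 16 ^ m * (30720 * M / \<delta> ^ m + 768 * \<eta>)"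
proof (rule le_if_le_add_small)
  show "0 \<le> 16 ^ m * (69120 / \<delta> ^ m + 26112) + (402::real)" using \<delta> by simp
  fix \<tau> :: real assume \<tau>: "0 < \<tau>" "\<tau> \<le> 1"
  show "\<bar>F w\<bar> \<le> 16 ^ m * (30720 * M / \<delta> ^ m + 768 * \<eta>) + \<tau> * (16 ^ m * (69120 / \<delta> ^ m + 26112) + 402)"
  proof (rule holomorphic_representation[OF contF cont q lap \<tau>(1)], goal_cases)
    case (3 W s H0 \<phi>)
    note s = 3(1,2) and H0 = 3(3,4) and \<phi> = 3(5) and ReW = 3(6) and H0b = 3(7) and Fb = 3(8)
    have s1: "cmod (s z) \<le> 1" if "cmod z \<le> 1" for z using s(2)[OF that] by simp
    obtain K where K: "K holomorphic_on UNIV" "\<And>z. cmod z = 1 \<Longrightarrow> Im (K z) = Im (s z)"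
      "integral {0..1} (\<lambda>t. cmod (exp (K (circ t)))) \<le> 2"
      "\<And>z. cmod z \<le> 1/2 \<Longrightarrow> cmod (exp (K z)) \<le> 4" "\<And>z. cmod z \<le> 1/2 \<Longrightarrow> cmod (exp (- K z)) \<le> 4"
      using outer_correction[OF s(1) s1] by metis
    have cK: "continuous_on A K" for A using K(1) holomorphic_on_imp_continuous_on holomorphic_on_subset by blast
    define H where "H z = exp (K z) * H0 z" for z
    define e where "e z = (3 * \<eta> + 102 * \<tau>) * cmod (exp (K z))" for z
    have P1: "\<bar>Re (P z)\<bar> \<le> 1" if z: "cmod z = 1" for z
    proof -
      have "cmod (P z) = cmod (\<Prod>\<zeta>\<in>S. (z - \<zeta>) / 2)"
      by (simp only: P_def norm_mult norm_power complex_mod_cnj z c) simp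
    also have "\<dots> \<le> 1" by (rule prod_half_le_1[OF S(2)]) (simp_all add: z)
    finally show ?thesis using abs_Re_le_cmod[of "P z"] by linarith
  qed
  have H_sign: "- e z \<le> Re (P z) * Re (H z)" if z: "cmod z = 1" for z
  proof -
    have z1: "cmod z \<le> 1" using z by simp
    define p where "p = Re (P z)"
    define \<kappa> where "\<kappa> = cmod (exp (K z))"
    define E1 where "E1 = exp (- s z) * W z - H0 z"
    define R where "R = exp (Re (K z) - Re (s z))"
    have "exp (K z) * exp (- s z) = of_real R"
    proof -
      have "K z - s z = of_real (Re (K z) - Re (s z))" using K(2)[OF z] by (simp add: complex_eq_iff)
      then show ?thesis by (simp add: R_def exp_of_real[symmetric] flip: exp_add)
    qed
    then have "H z = of_real R * W z - exp (K z) * E1"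
      unfolding H_def E1_def by (simp add: right_diff_distrib mult.assoc[symmetric])
    then have ReH: "Re (H z) = R * Re (W z) - Re (exp (K z) * E1)" by (simp del: times_complex.sel add: Re_complex_of_real) simp
    have R: "0 \<le> R" "R \<le> 2 * \<kappa>"
    proof -
      have "R = exp (Re (K z)) * exp (- Re (s z))" by (simp add: R_def exp_diff exp_minus field_simps)
      also have "\<dots> = \<kappa> * cmod (exp (- s z))" by (simp add: \<kappa>_def)
      also have "\<dots> \<le> \<kappa> * 2" using exp_small_bounds(2)[OF s(2)[OF z1]] by (intro mult_left_mono) (auto simp: \<kappa>_def)
      finally show "R \<le> 2 * \<kappa>" by simp
    qed (simp add: R_def)
    have pF: "- (3/2 * \<eta>) \<le> \<phi> z * (p * F z)"
    proof -
      have "\<phi> z * (- \<eta>) \<le> \<phi> z * (p * F z)" using sign[OF z] \<phi>[OF z1] by (intro mult_left_mono) (auto simp: p_def)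
      moreover have "\<phi> z * \<eta> \<le> 3/2 * \<eta>" using \<phi>[OF z1] \<eta> by (intro mult_right_mono) auto
      ultimately show ?thesis by simp
    qed
    have "\<bar>p * (Re (W z) - \<phi> z * F z)\<bar> \<le> 1 * \<tau>"
      unfolding abs_mult using P1[OF z] ReW[OF z1] by (intro mult_mono) (auto simp: p_def)
    then have "- (3/2 * \<eta> + \<tau>) \<le> \<phi> z * (p * F z) + p * (Re (W z) - \<phi> z * F z)" using pF by linarith
    also have "\<dots> = p * Re (W z)" by (simp add: algebra_simps)
    finally have "R * (- (3/2 * \<eta> + \<tau>)) \<le> R * (p * Re (W z))" using R by (intro mult_left_mono) auto
    moreover have "R * (3/2 * \<eta> + \<tau>) \<le> 2 * \<kappa> * (3/2 * \<eta> + \<tau>)" using R \<eta> \<tau> by (intro mult_right_mono) auto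
    moreover have "\<bar>p * Re (exp (K z) * E1)\<bar> \<le> 1 * (\<kappa> * (100 * \<tau>))"
    proof -
      have "\<bar>Re (exp (K z) * E1)\<bar> \<le> cmod (exp (K z) * E1)" by (rule abs_Re_le_cmod)
      also have "\<dots> \<le> \<kappa> * (100 * \<tau>)" unfolding norm_mult \<kappa>_def E1_def
        using H0(2)[OF z1] by (intro mult_left_mono) auto
      finally show ?thesis unfolding abs_mult using P1[OF z] by (intro mult_mono) (auto simp: p_def)
    qed
    moreover have "p * Re (H z) = R * (p * Re (W z)) - p * Re (exp (K z) * E1)"
      unfolding ReH by (simp add: right_diff_distrib mult.left_commute)
    moreover have "e z = 2 * \<kappa> * (3/2 * \<eta> + \<tau>) + \<kappa> * (100 * \<tau>)"
      by (simp add: e_def \<kappa>_def algebra_simps)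
    ultimately have "- e z \<le> p * Re (H z)" by (simp only: mult_minus_right)
    then show ?thesis by (simp only: p_def)
  qed
  have e_int: "integral {0..1} (\<lambda>t. e (circ t)) \<le> 6 * \<eta> + 204 * \<tau>"
  proof -
    have "integral {0..1} (\<lambda>t. e (circ t)) = (3 * \<eta> + 102 * \<tau>) * integral {0..1} (\<lambda>t. cmod (exp (K (circ t))))"
      unfolding e_def by (rule integral_mult_right)
    also have "\<dots> \<le> (3 * \<eta> + 102 * \<tau>) * 2" using K(3) \<eta> \<tau> by (intro mult_left_mono) auto
    finally show ?thesis by simp
  qed
  have H_small: "cmod (H z) \<le> 320 * M + 720 * \<tau>" if z: "cmod z \<le> \<delta>" for z
  proof -
    have "cmod (H0 z) \<le> 40 * (2 * \<delta>) / (2 * \<delta> - \<delta>) * (M + \<tau>) + 100 * \<tau>"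
      by (rule H0b[OF \<delta>(1) _ _ M z]) (use \<delta> in auto)
    then have "cmod (H0 z) \<le> 80 * (M + \<tau>) + 100 * \<tau>" using \<delta> by simp
    moreover have "cmod (H z) \<le> 4 * cmod (H0 z)"
      unfolding H_def norm_mult using K(4)[of z] z \<delta> by (intro mult_right_mono) auto
    ultimately show ?thesis by argo
  qed
  have "cmod (H w) \<le> 2 * 16 ^ m * (3 * (320 * M + 720 * \<tau>) / \<delta> ^ m + 4 * (6 * \<eta> + 204 * \<tau>))"
  proof (rule few_sign_changes_bound[where H = H and w = w and e = e and \<delta> = \<delta>, OF _ S c])
    show "H holomorphic_on UNIV" unfolding H_def by (intro holomorphic_intros K H0)
    show "continuous_on (sphere 0 1) e" unfolding e_def by (intro continuous_intros cK)
    show "0 \<le> e z" for z unfolding e_def using \<eta> \<tau> by simp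
  qed (use P H_sign e_int H_small \<delta> w in \<open>auto simp: P_def\<close>)
  moreover have "cmod (H0 w) \<le> 4 * cmod (H w)"
  proof -
    have "H0 w = exp (- K w) * H w" by (simp add: H_def mult.assoc[symmetric] flip: exp_add)
    then have "cmod (H0 w) = cmod (exp (- K w)) * cmod (H w)" by (metis norm_mult)
    also have "\<dots> \<le> 4 * cmod (H w)" using K(5)[OF w] by (intro mult_right_mono) auto
    finally show ?thesis .
  qed
  ultimately have "\<bar>F w\<bar> \<le> 16 * (2 * 16 ^ m * (3 * (320 * M + 720 * \<tau>) / \<delta> ^ m + 4 * (6 * \<eta> + 204 * \<tau>))) + 402 * \<tau>"
    using Fb[of w] w by argo
  also have "\<dots> = 16 ^ m * (30720 * M / \<delta> ^ m + 768 * \<eta>) + \<tau> * (16 ^ m * (69120 / \<delta> ^ m + 26112) + 402)"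
    using \<delta> by (simp add: field_simps)
  finally show "\<bar>F w\<bar> \<le> 16 ^ m * (30720 * M / \<delta> ^ m + 768 * \<eta>) + \<tau> * (16 ^ m * (69120 / \<delta> ^ m + 26112) + 402)" .
  qed
qed

text \<open>Both bounds on $H$ give bounds on its Taylor coefficients: the one by $A$ is used from order $n$ on, the one by
$\epsilon$ below.\<close>

lemma small_on_disc_imp_small:
  assumes H: "H holomorphic_on UNIV" and a: "0 < a" and r: "0 < r" and \<rho>: "0 \<le> \<rho>" "\<rho> < r"
    and small: "\<And>z. cmod z \<le> a \<Longrightarrow> cmod (H z) \<le> \<epsilon>" and big: "\<And>z. cmod z \<le> r \<Longrightarrow> cmod (H z) \<le> A"
    and w: "cmod w = \<rho>"
  shows "cmod (H w) \<le> A * (\<rho> / r) ^ n / (1 - \<rho> / r) + \<epsilon> * (\<Sum>k<n. (\<rho> / a) ^ k)"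
proof -
  define f where "f k = (deriv ^^ k) H 0 / fact k * (w - 0) ^ k" for k
  have cH: "continuous_on A H" for A using H holomorphic_on_imp_continuous_on holomorphic_on_subset by blast
  have coef: "cmod (f k) \<le> B * (\<rho> / R) ^ k" if R: "R > 0" and B: "\<And>z. cmod z \<le> R \<Longrightarrow> cmod (H z) \<le> B" for k R B
  proof -
    have "cmod ((deriv ^^ k) H 0) \<le> fact k * B / R ^ k"
      by (rule Cauchy_inequality) (use H cH R B in \<open>auto intro: holomorphic_on_subset\<close>)
    then have "cmod ((deriv ^^ k) H 0 / fact k) \<le> B / R ^ k" by (simp add: norm_divide field_simps)
    from mult_right_mono[OF this, of "\<rho> ^ k"] have "cmod (f k) \<le> B / R ^ k * \<rho> ^ k"
      unfolding f_def norm_mult norm_power using w \<rho> by simp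
    then show ?thesis by (simp add: power_divide)
  qed
  have A0: "A \<ge> 0" using order_trans[OF norm_ge_zero big[of 0]] r by simp
  define x where "x = \<rho> / r"
  have x: "0 \<le> x" "x < 1" using \<rho> r by (auto simp: x_def)
  have "f sums H w" unfolding f_def
    by (rule holomorphic_power_series[of _ _ "r + 1"]) (use H w \<rho> in \<open>auto intro: holomorphic_on_subset\<close>)
  from sums_split_initial_segment[OF this, of n]
  have tail: "(\<lambda>i. f (i + n)) sums (H w - (\<Sum>i<n. f i))" .
  have geo: "(\<lambda>i. A * x ^ n * x ^ i) sums (A * x ^ n * (1 / (1 - x)))"
    using x by (intro sums_mult geometric_sums) simp
  have "cmod (f (i + n)) \<le> A * x ^ n * x ^ i" for i
    using coef[OF r big, of "i + n"] by (simp add: x_def power_add mult_ac)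
  from norm_sums_le[OF tail geo this]
  have "cmod (H w - (\<Sum>i<n. f i)) \<le> A * x ^ n / (1 - x)" by simp
  moreover have "cmod (\<Sum>i<n. f i) \<le> \<epsilon> * (\<Sum>k<n. (\<rho> / a) ^ k)"
    unfolding sum_distrib_left by (rule sum_norm_le) (rule coef[OF a small])
  ultimately show ?thesis using norm_triangle_ineq[of "H w - (\<Sum>i<n. f i)" "\<Sum>i<n. f i"]
    by (simp add: x_def)
qed

text \<open>If $F$ vanishes near 0, then the holomorphic functions that represent it have size of order $\tau$ there and
stay bounded on a larger disc as $\tau$ tends to 0.\<close>

lemma unique_continuation:
  fixes q F :: "complex \<Rightarrow> real"
  assumes contF: "continuous_on (cball 0 1) F"
    and cont: "continuous_on (cball 0 1) q" and q: "\<And>z. cmod z \<le> 1 \<Longrightarrow> \<bar>q z\<bar> \<le> 1/10000"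
    and lap: "\<And>z. cmod z < 1 \<Longrightarrow> has_lap F z (- q z * F z)"
    and \<delta>: "0 < \<delta>" "\<delta> \<le> 1" and 0: "\<And>z. cmod z \<le> \<delta> \<Longrightarrow> F z = 0"
    and w: "cmod w < 1"
  shows "F w = 0"
proof -
  obtain M where M: "\<And>z. cmod z \<le> 1 \<Longrightarrow> \<bar>F z\<bar> \<le> M"
    using compact_imp_bounded[OF compact_continuous_image[OF contF compact_cball]]
    unfolding bounded_iff by (metis dist_0_norm image_eqI mem_cball real_norm_def)
  have M0: "M \<ge> 0" using M[of 0] by auto
  define \<rho> where "\<rho> = cmod w"
  \<comment> \<open>strictly between \<open>w\<close> and the circle, where the bounds on \<open>H\<close> are still uniform in \<open>\<tau>\<close>\<close>
  define r where "r = (1 + \<rho>) / 2"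
  have r: "0 < r" "\<rho> < r" "r < 1" "0 \<le> \<rho>" using w norm_ge_zero[of w] unfolding r_def \<rho>_def by argo+
  define A where "A = 40 / (1 - r) * (M + 1) + 100"
  have A0: "A \<ge> 0" using r M0 by (simp add: A_def)
  have bound: "\<bar>F w\<bar> \<le> 4 * (A * (\<rho> / r) ^ n / (1 - \<rho> / r))" for n
  proof (rule le_if_le_add_small)
    show "0 \<le> 4 * (180 * (\<Sum>k<n. (\<rho> / (\<delta> / 2)) ^ k)) + 402"
      using r \<delta> by (intro add_nonneg_nonneg mult_nonneg_nonneg sum_nonneg) auto
    fix \<tau> :: real assume \<tau>: "0 < \<tau>" "\<tau> \<le> 1"
    show "\<bar>F w\<bar> \<le> 4 * (A * (\<rho> / r) ^ n / (1 - \<rho> / r)) + \<tau> * (4 * (180 * (\<Sum>k<n. (\<rho> / (\<delta> / 2)) ^ k)) + 402)"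
    proof (rule holomorphic_representation[OF contF cont q lap \<tau>(1)], goal_cases)
      case (3 W s H \<phi>)
      note H = 3(3) and Hb = 3(7) and Fb = 3(8)
      have small: "cmod (H z) \<le> 180 * \<tau>" if z: "cmod z \<le> \<delta> / 2" for z
      proof -
        have "cmod (H z) \<le> 40 * \<delta> / (\<delta> - \<delta> / 2) * (0 + \<tau>) + 100 * \<tau>"
          by (rule Hb[OF _ _ _ _ z]) (use \<delta> 0 in auto)
        moreover have "40 * \<delta> / (\<delta> - \<delta> / 2) = 80" using \<delta> by (simp add: field_simps)
        ultimately show ?thesis by simp
    qed
    have big: "cmod (H z) \<le> A" if z: "cmod z \<le> r" for z
    proof -
      have "cmod (H z) \<le> 40 * 1 / (1 - r) * (M + \<tau>) + 100 * \<tau>"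
        by (rule Hb[OF _ _ _ _ z]) (use r M in auto)
      also have "40 * 1 / (1 - r) * (M + \<tau>) \<le> 40 / (1 - r) * (M + 1)"
        using r \<tau> by (simp add: divide_right_mono)
      finally show ?thesis using \<tau> by (simp add: A_def)
    qed
    have "cmod (H w) \<le> A * (\<rho> / r) ^ n / (1 - \<rho> / r) + (180 * \<tau>) * (\<Sum>k<n. (\<rho> / (\<delta> / 2)) ^ k)"
      by (rule small_on_disc_imp_small[OF H _ r(1,4,2) small big]) (use \<delta> in \<open>auto simp: \<rho>_def\<close>)
    then have "\<bar>F w\<bar> \<le> 4 * (A * (\<rho> / r) ^ n / (1 - \<rho> / r) + (180 * \<tau>) * (\<Sum>k<n. (\<rho> / (\<delta> / 2)) ^ k)) + 402 * \<tau>"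
      using Fb[OF less_imp_le[OF w]] by argo
    also have "\<dots> = 4 * (A * (\<rho> / r) ^ n / (1 - \<rho> / r)) + \<tau> * (4 * (180 * (\<Sum>k<n. (\<rho> / (\<delta> / 2)) ^ k)) + 402)"
      by (simp only: distrib_left mult_ac)
    finally show "\<bar>F w\<bar> \<le> 4 * (A * (\<rho> / r) ^ n / (1 - \<rho> / r)) + \<tau> * (4 * (180 * (\<Sum>k<n. (\<rho> / (\<delta> / 2)) ^ k)) + 402)" .
    qed
  qed
  have x: "\<bar>\<rho> / r\<bar> < 1" using r by simp
  have "(\<lambda>n. 4 * (A * (\<rho> / r) ^ n / (1 - \<rho> / r))) \<longlonglongrightarrow> 4 * (A * 0 / (1 - \<rho> / r))"
    using r x by (intro tendsto_intros LIMSEQ_power_zero) auto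
  from LIMSEQ_le_const[OF this, of "\<bar>F w\<bar>"] bound have "\<bar>F w\<bar> \<le> 0" by auto
  then show ?thesis by simp
qed

section \<open>The doubling estimate\<close>

definition to_plane :: "complex \<Rightarrow> real ^ 2" where
  "to_plane z = Re z *\<^sub>R axis 1 1 + Im z *\<^sub>R axis 2 1"

lemma to_plane_nth [simp]: "to_plane z $ 1 = Re z" "to_plane z $ 2 = Im z"
  by (simp_all add: to_plane_def axis_def)

lemma to_plane_surj: "\<exists>z. x = to_plane z"
  by (rule exI[of _ "Complex (x $ 1) (x $ 2)"]) (simp add: vec_eq_iff forall_2)

lemma to_plane_inj: "to_plane w = to_plane z \<Longrightarrow> w = z"
  by (metis complex_eqI to_plane_nth)

lemma norm_to_plane [simp]: "norm (to_plane z) = cmod z"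
  by (simp add: norm_vec_def L2_set_def sum_2 cmod_def)

lemma continuous_on_to_plane: "continuous_on A to_plane"
  unfolding to_plane_def[abs_def] by (intro continuous_intros)

lemma Basis_plane: "(Basis :: (real ^ 2) set) = {axis 1 1, axis 2 1}"
  by (auto simp: Basis_vec_def UNIV_2)

lemma second_deriv_on_line:
  fixes F :: "'a::euclidean_space \<Rightarrow> real"
  assumes C2: "Ck_on 2 F S" and S: "open S" "x \<in> S" and b: "b \<in> Basis"
  shows "second_deriv (\<lambda>t. F (x + t *\<^sub>R b)) (partial_deriv b (partial_deriv b F) x)"
proof -
  have d: "((\<lambda>t. G (x + t *\<^sub>R b)) has_real_derivative partial_deriv b G (x + t *\<^sub>R b)) (at t)"
    if "G differentiable (at (x + t *\<^sub>R b))" for G :: "'a \<Rightarrow> real" and t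
  proof -
    have 1: "((\<lambda>t. x + t *\<^sub>R b) has_derivative (\<lambda>h. h *\<^sub>R b)) (at t)"
      by (auto intro!: derivative_eq_intros)
    have 2: "(G has_derivative frechet_derivative G (at (x + t *\<^sub>R b))) (at (x + t *\<^sub>R b))"
      using that by (simp add: frechet_derivative_works)
    have "((\<lambda>t. G (x + t *\<^sub>R b)) has_derivative (\<lambda>h. frechet_derivative G (at (x + t *\<^sub>R b)) (h *\<^sub>R b))) (at t)"
      using has_derivative_compose[OF 1 2] .
    then show ?thesis unfolding has_field_derivative_def partial_deriv_def
      by (rule has_derivative_eq_rhs)
        (simp add: fun_eq_iff linear_scale[OF has_derivative_linear[OF 2]])
  qed
  have diff: "\<And>y. y \<in> S \<Longrightarrow> F differentiable (at y)"
    "\<And>y. y \<in> S \<Longrightarrow> partial_deriv b F differentiable (at y)"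
    using C2 b by (simp_all add: numeral_2_eq_2)
  have "filterlim (\<lambda>t. x + t *\<^sub>R b) (nhds x) (nhds 0)"
    using isCont_filterlim_nhds[of 0 "\<lambda>t. x + t *\<^sub>R b"] by simp
  from eventually_compose_filterlim[OF eventually_nhds_in_open[OF S] this]
  have "\<forall>\<^sub>F t in nhds 0. x + t *\<^sub>R b \<in> S" .
  then have "\<forall>\<^sub>F t in nhds 0. ((\<lambda>t. F (x + t *\<^sub>R b)) has_real_derivative partial_deriv b F (x + t *\<^sub>R b)) (at t)"
    by eventually_elim (rule d[OF diff(1)])
  moreover have "((\<lambda>t. partial_deriv b F (x + t *\<^sub>R b)) has_real_derivative partial_deriv b (partial_deriv b F) x) (at 0)"
    using d[of "partial_deriv b F" 0] diff(2)[OF S(2)] by simp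
  ultimately show ?thesis unfolding second_deriv_def by (intro exI conjI)
qed

lemma has_lap_rescaled:
  fixes F :: "real ^ 2 \<Rightarrow> real"
  assumes C2: "Ck_on 2 F S" and S: "open S" "r *\<^sub>R to_plane z \<in> S"
  shows "has_lap (\<lambda>z. F (r *\<^sub>R to_plane z)) z (r\<^sup>2 * laplacian F (r *\<^sub>R to_plane z))"
proof -
  define x where "x = r *\<^sub>R to_plane z"
  have "(\<lambda>t. F (r *\<^sub>R to_plane (z + of_real t))) = (\<lambda>t. F (x + (r * t) *\<^sub>R axis 1 1))"
    "(\<lambda>t. F (r *\<^sub>R to_plane (z + \<i> * of_real t))) = (\<lambda>t. F (x + (r * t) *\<^sub>R axis 2 1))"
    by (simp_all add: x_def to_plane_def algebra_simps)
  moreover have "second_deriv (\<lambda>t. F (x + (r * t) *\<^sub>R b)) (r\<^sup>2 * partial_deriv b (partial_deriv b F) x)"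
    if "b \<in> Basis" for b
    using second_deriv_scale[OF second_deriv_on_line[OF C2 S that]] by (simp add: x_def)
  moreover have "laplacian F x = partial_deriv (axis 1 1) (partial_deriv (axis 1 1) F) x
      + partial_deriv (axis 2 1) (partial_deriv (axis 2 1) F) x"
    by (simp add: laplacian_def Basis_plane axis_eq_axis)
  ultimately show ?thesis unfolding has_lap_def x_def[symmetric]
    by (intro exI[of _ "r\<^sup>2 * partial_deriv (axis 1 1) (partial_deriv (axis 1 1) F) x"]
        exI[of _ "r\<^sup>2 * partial_deriv (axis 2 1) (partial_deriv (axis 2 1) F) x"])
      (simp add: Basis_plane distrib_left)
qed

lemma shrink_less:
  fixes r y \<rho> :: real
  assumes "0 < r" "r < 1" "y \<le> \<rho>" "0 < \<rho>"
  shows "r * y < \<rho>"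
proof -
  have "r * y \<le> r * \<rho>" using assms by (intro mult_left_mono) auto
  also have "\<dots> < 1 * \<rho>" using assms by (intro mult_strict_right_mono) auto
  finally show ?thesis by simp
qed

locale small_potential_solution =
  fixes F q :: "real ^ 2 \<Rightarrow> real"
  assumes contF: "continuous_on (cball 0 1) F"
    and nonzero: "\<exists>x\<in>cball 0 1. F x \<noteq> 0"
    and contq: "continuous_on (ball 0 1) q"
    and small: "\<And>x. x \<in> ball 0 1 \<Longrightarrow> \<bar>q x\<bar> \<le> 1/10000"
    and solves: "solves_schroedinger_on q F (ball 0 1)"
begin

lemma rescaled:
  assumes r: "0 < r" "r < 1"
  shows "continuous_on (cball 0 1) (\<lambda>z. F (r *\<^sub>R to_plane z))"
    "continuous_on (cball 0 1) (\<lambda>z. r\<^sup>2 * q (r *\<^sub>R to_plane z))"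
    "cmod z \<le> 1 \<Longrightarrow> \<bar>r\<^sup>2 * q (r *\<^sub>R to_plane z)\<bar> \<le> 1/10000"
    "cmod z < 1 \<Longrightarrow> has_lap (\<lambda>z. F (r *\<^sub>R to_plane z)) z (- (r\<^sup>2 * q (r *\<^sub>R to_plane z)) * F (r *\<^sub>R to_plane z))"
proof -
  have rng: "r *\<^sub>R to_plane z \<in> ball 0 1" if "cmod z \<le> 1" for z
    using shrink_less[OF r that] r by simp
  have c: "continuous_on (cball 0 1) (\<lambda>z. r *\<^sub>R to_plane z)"
    by (intro continuous_intros continuous_on_to_plane)
  show "continuous_on (cball 0 1) (\<lambda>z. F (r *\<^sub>R to_plane z))"
    by (rule continuous_on_compose2[OF contF c]) (use rng in \<open>force intro: less_imp_le\<close>)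
  show "continuous_on (cball 0 1) (\<lambda>z. r\<^sup>2 * q (r *\<^sub>R to_plane z))"
    by (intro continuous_on_mult_left continuous_on_compose2[OF contq c]) (use rng in force)
  show "\<bar>r\<^sup>2 * q (r *\<^sub>R to_plane z)\<bar> \<le> 1/10000" if "cmod z \<le> 1"
  proof -
    have "\<bar>r\<^sup>2 * q (r *\<^sub>R to_plane z)\<bar> \<le> 1 * (1/10000)"
      unfolding abs_mult using small[OF rng[OF that]] r
      by (intro mult_mono) (auto simp: power_le_one)
    then show ?thesis by simp
  qed
  show "has_lap (\<lambda>z. F (r *\<^sub>R to_plane z)) z (- (r\<^sup>2 * q (r *\<^sub>R to_plane z)) * F (r *\<^sub>R to_plane z))" if z: "cmod z < 1"
  proof -
    have x: "r *\<^sub>R to_plane z \<in> ball 0 1" using rng z by simp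
    have "laplacian F (r *\<^sub>R to_plane z) = - q (r *\<^sub>R to_plane z) * F (r *\<^sub>R to_plane z)"
      using solves x unfolding solves_schroedinger_on_def by (simp add: eq_neg_iff_add_eq_0)
    then show ?thesis
      using has_lap_rescaled[of F "ball 0 1" r z] solves x
      unfolding solves_schroedinger_on_def by (simp add: mult.assoc)
  qed
qed

lemma bdd: "\<rho> \<le> 1 \<Longrightarrow> bdd_above ((\<lambda>x. \<bar>F x\<bar>) ` ball 0 \<rho>)"
proof -
  assume "\<rho> \<le> 1"
  have "bounded (F ` cball 0 1)"
    by (rule compact_imp_bounded[OF compact_continuous_image[OF contF compact_cball]])
  then obtain M where "\<And>x. x \<in> cball 0 1 \<Longrightarrow> \<bar>F x\<bar> \<le> M" unfolding bounded_iff by (metis image_eqI real_norm_def)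
  then show ?thesis using \<open>\<rho> \<le> 1\<close> by (intro bdd_aboveI2[of _ _ M]) auto
qed

lemma sup_pos:
  assumes \<rho>: "0 < \<rho>" "\<rho> \<le> 1"
  shows "0 < (SUP x\<in>ball 0 \<rho>. \<bar>F x\<bar>)"
proof (rule ccontr)
  assume neg: "\<not> ?thesis"
  have zero: "F x = 0" if "x \<in> ball 0 \<rho>" for x
    using cSUP_upper[OF that bdd[OF \<rho>(2)]] neg by auto
  have ball0: "F x = 0" if x: "x \<in> ball 0 1" for x
  proof -
    define r where "r = (1 + norm x) / 2"
    have r: "0 < r" "r < 1" "norm x < r" using x norm_ge_zero[of x] unfolding r_def by (auto simp: add_pos_nonneg)
    obtain z where z: "(1 / r) *\<^sub>R x = to_plane z" using to_plane_surj by blast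
    have x': "x = r *\<^sub>R to_plane z" using r by (simp flip: z)
    have "F (r *\<^sub>R to_plane z) = 0"
    proof (rule unique_continuation[OF rescaled(1)[OF r(1,2)] rescaled(2)[OF r(1,2)] rescaled(3)[OF r(1,2)] rescaled(4)[OF r(1,2)] \<rho>])
      show "F (r *\<^sub>R to_plane y) = 0" if y: "cmod y \<le> \<rho>" for y
      proof (rule zero)
        show "r *\<^sub>R to_plane y \<in> ball 0 \<rho>" using shrink_less[OF r(1,2) y \<rho>(1)] r by simp
      qed
      have "cmod z = norm x / r" using r by (simp flip: norm_to_plane z)
      then show "cmod z < 1" using r by simp
    qed
    then show ?thesis using x' by simp
  qed
  have "F x = 0" if "x \<in> cball 0 1" for x
  proof -
    have "x \<in> closure (ball 0 1)" using that by simp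
    moreover have "continuous_on (closure (ball 0 1)) F" using contF by simp
    ultimately show ?thesis using continuous_constant_on_closure[of "ball 0 1" F 0] ball0 by blast
  qed
  then show False using nonzero by blast
qed

text \<open>Signs of $x \mapsto F(rx)$ on the circle agree with those of $F$ up to an error that tends to 0 as $r$ tends to
1, by uniform continuity.\<close>

lemma growth_bound:
  assumes fin: "finite (zero_set F (sphere 0 1))" and \<rho>: "0 < \<rho>" "\<rho> \<le> 1"
  obtains m where "2 * m \<le> card (zero_set F (sphere 0 1))"
    "\<And>x. x \<in> ball 0 (1/4) \<Longrightarrow> \<bar>F x\<bar> \<le> 30720 * (32 / \<rho>) ^ m * (SUP x\<in>ball 0 \<rho>. \<bar>F x\<bar>)"
proof -
  define Z where "Z = {z \<in> sphere 0 1. F (to_plane z) = 0}"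
  have Zsub: "to_plane ` Z \<subseteq> zero_set F (sphere 0 1)" by (auto simp: Z_def zero_set_def)
  have Zinj: "inj_on to_plane Z" using to_plane_inj by (auto intro: inj_onI)
  have finZ: "finite Z" using Zsub fin Zinj by (meson finite_imageD finite_subset)
  have cardZ: "card Z \<le> card (zero_set F (sphere 0 1))"
    using card_mono[OF fin Zsub] card_image[OF Zinj] by simp
  have cont1: "continuous_on (cball 0 1) (\<lambda>z. F (to_plane z))"
    by (rule continuous_on_compose2[OF contF continuous_on_to_plane]) auto
  have cont2: "continuous_on (sphere 0 1) (\<lambda>z. F (to_plane z))"
    by (rule continuous_on_subset[OF cont1]) auto
  obtain S m c where S: "S \<subseteq> Z" "card S = 2 * m" and c: "cmod c = 1"
    and P: "\<And>z. cmod z = 1 \<Longrightarrow> Im (c * cnj z ^ m * (\<Prod>\<zeta>\<in>S. (z - \<zeta>) / 2)) = 0"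
    "\<And>z. cmod z = 1 \<Longrightarrow> 0 \<le> Re (c * cnj z ^ m * (\<Prod>\<zeta>\<in>S. (z - \<zeta>) / 2)) * F (to_plane z)"
    using sign_change_polynomial[OF cont2] finZ unfolding Z_def by blast
  define M where "M = (SUP x\<in>ball 0 \<rho>. \<bar>F x\<bar>)"
  define p where "p z = c * cnj z ^ m * (\<Prod>\<zeta>\<in>S. (z - \<zeta>) / 2)" for z
  have finS: "finite S" using S(1) finZ finite_subset by blast
  have Scirc: "cmod \<zeta> = 1" if "\<zeta> \<in> S" for \<zeta> using that S(1) by (auto simp: Z_def)
  have p1: "\<bar>Re (p z)\<bar> \<le> 1" if z: "cmod z = 1" for z
  proof -
    have "cmod (p z) = cmod (\<Prod>\<zeta>\<in>S. (z - \<zeta>) / 2)"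
      by (simp only: p_def norm_mult norm_power complex_mod_cnj z c) simp
    also have "\<dots> \<le> 1" by (rule prod_half_le_1[OF Scirc]) (simp_all add: z)
    finally show ?thesis using abs_Re_le_cmod[of "p z"] by linarith
  qed
  show ?thesis
  proof (rule that)
    show "2 * m \<le> card (zero_set F (sphere 0 1))"
      using card_mono[OF finZ S(1)] S(2) cardZ by simp
    fix x :: "real ^ 2" assume x: "x \<in> ball 0 (1/4)"
    show "\<bar>F x\<bar> \<le> 30720 * (32 / \<rho>) ^ m * (SUP x\<in>ball 0 \<rho>. \<bar>F x\<bar>)"
    proof (rule le_if_le_add_small)
      show "0 \<le> 16 ^ m * (768::real)" by simp
      fix \<eta> :: real assume \<eta>: "0 < \<eta>" "\<eta> \<le> 1"
      have "uniformly_continuous_on (cball 0 1) F"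
        by (rule compact_uniformly_continuous[OF contF compact_cball])
      then obtain d where d: "d > 0" "\<And>x y. x \<in> cball 0 1 \<Longrightarrow> y \<in> cball 0 1 \<Longrightarrow> dist y x < d \<Longrightarrow> dist (F y) (F x) < \<eta>"
        unfolding uniformly_continuous_on_def using \<eta>(1) by metis
      define r where "r = max (1/2) (1 - d/2)"
      have r: "1/2 \<le> r" "0 < r" "r < 1" "1 - r < d" using d(1) by (auto simp: r_def)
      obtain w where w: "(1 / r) *\<^sub>R x = to_plane w" using to_plane_surj by blast
      have x': "x = r *\<^sub>R to_plane w" using r by (simp flip: w)
      have "cmod w = norm x / r" using r by (simp flip: norm_to_plane w)
      also have "\<dots> \<le> 1/2" using r x by (simp add: field_simps)
      finally have w2: "cmod w \<le> 1/2" .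
      have "\<bar>F (r *\<^sub>R to_plane w)\<bar> \<le> 16 ^ m * (30720 * M / (\<rho> / 2) ^ m + 768 * \<eta>)"
      proof (rule disc_estimate[OF rescaled(1)[OF r(2,3)] rescaled(2)[OF r(2,3)] rescaled(3)[OF r(2,3)] rescaled(4)[OF r(2,3)]
            finS Scirc S(2) c P(1) _ _ _ _ _ w2])
        show "- \<eta> \<le> Re (c * cnj z ^ m * (\<Prod>\<zeta>\<in>S. (z - \<zeta>) / 2)) * F (r *\<^sub>R to_plane z)" if z: "cmod z = 1" for z
        proof -
          have "to_plane z - r *\<^sub>R to_plane z = (1 - r) *\<^sub>R to_plane z" by (simp add: scaleR_left_diff_distrib)
          then have "dist (r *\<^sub>R to_plane z) (to_plane z) = 1 - r"
            using r z by (simp add: dist_norm norm_minus_commute)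
          then have "\<bar>F (r *\<^sub>R to_plane z) - F (to_plane z)\<bar> \<le> \<eta>"
            using d(2)[of "to_plane z" "r *\<^sub>R to_plane z"] r z by (simp add: dist_real_def)
          then have "\<bar>Re (p z) * (F (r *\<^sub>R to_plane z) - F (to_plane z))\<bar> \<le> 1 * \<eta>"
            unfolding abs_mult using p1[OF z] by (intro mult_mono) auto
          moreover have "0 \<le> Re (p z) * F (to_plane z)" using P(2)[OF z] by (simp only: p_def)
          moreover have "Re (p z) * F (r *\<^sub>R to_plane z) = Re (p z) * F (to_plane z) + Re (p z) * (F (r *\<^sub>R to_plane z) - F (to_plane z))"
            by (simp add: algebra_simps)
          ultimately have "- \<eta> \<le> Re (p z) * F (r *\<^sub>R to_plane z)" by linarith
          then show ?thesis by (simp only: p_def)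
        qed
        show "\<bar>F (r *\<^sub>R to_plane z)\<bar> \<le> M" if z: "cmod z \<le> 2 * (\<rho> / 2)" for z
        proof -
          have "r *\<^sub>R to_plane z \<in> ball 0 \<rho>" using shrink_less[OF r(2,3) _ \<rho>(1), of "cmod z"] z r by simp
          then show ?thesis unfolding M_def by (rule cSUP_upper[OF _ bdd[OF \<rho>(2)]])
        qed
      qed (use \<eta> \<rho> in auto)
      also have "\<dots> = 30720 * (32 / \<rho>) ^ m * M + \<eta> * (16 ^ m * 768)"
      proof -
        have "(32 / \<rho>) ^ m = 16 ^ m / (\<rho> / 2) ^ m" by (simp flip: power_divide)
        then show ?thesis by (simp add: algebra_simps)
      qed
      finally show "\<bar>F x\<bar> \<le> 30720 * (32 / \<rho>) ^ m * (SUP x\<in>ball 0 \<rho>. \<bar>F x\<bar>) + \<eta> * (16 ^ m * 768)"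
        unfolding x'[symmetric] M_def .
    qed
  qed
qed

lemma doubling_bound:
  assumes \<rho>: "0 < \<rho>" "\<rho> \<le> 1"
  shows "ereal (ln ((SUP x\<in>ball 0 (1/4). \<bar>F x\<bar>) / (SUP x\<in>ball 0 \<rho>. \<bar>F x\<bar>)))
     \<le> ereal (ln 30720 + ln (32 / \<rho>)) * (1 + num_elements (zero_set F (sphere 0 1)))"
proof (cases "finite (zero_set F (sphere 0 1))")
  case True
  define N where "N = card (zero_set F (sphere 0 1))"
  define M where "M = (SUP x\<in>ball 0 \<rho>. \<bar>F x\<bar>)"
  have M: "M > 0" unfolding M_def by (rule sup_pos[OF \<rho>])
  obtain m where m: "2 * m \<le> N"
    "\<And>x. x \<in> ball 0 (1/4) \<Longrightarrow> \<bar>F x\<bar> \<le> 30720 * (32 / \<rho>) ^ m * M"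
    using growth_bound[OF True \<rho>] unfolding N_def M_def by metis
  have "(SUP x\<in>ball 0 (1/4). \<bar>F x\<bar>) \<le> 30720 * (32 / \<rho>) ^ m * M"
    by (rule cSUP_least) (use m(2) in auto)
  then have q: "(SUP x\<in>ball 0 (1/4). \<bar>F x\<bar>) / M \<le> 30720 * (32 / \<rho>) ^ m"
    using M by (simp add: field_simps)
  have "0 < (SUP x\<in>ball 0 (1/4). \<bar>F x\<bar>) / M" using sup_pos[of "1/4"] M by simp
  then have "ln ((SUP x\<in>ball 0 (1/4). \<bar>F x\<bar>) / M) \<le> ln (30720 * (32 / \<rho>) ^ m)"
    using q by (subst ln_le_cancel_iff) auto
  also have "\<dots> = ln 30720 + real m * ln (32 / \<rho>)" using \<rho> by (simp add: ln_mult ln_realpow)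
  also have "\<dots> \<le> (ln 30720 + ln (32 / \<rho>)) * (1 + real N)"
  proof -
    have "0 \<le> ln (32 / \<rho>)" "0 \<le> ln (30720::real)" using \<rho> by (auto simp: field_simps)
    then have "real m * ln (32 / \<rho>) \<le> (1 + real N) * ln (32 / \<rho>)" "1 * ln 30720 \<le> (1 + real N) * ln (30720::real)"
      using m(1) by (intro mult_right_mono; simp)+
    moreover have "(a + b) * c = c * a + c * b" for a b c :: real by (simp add: algebra_simps)
    then have "(ln 30720 + ln (32 / \<rho>)) * (1 + real N) = (1 + real N) * ln 30720 + (1 + real N) * ln (32 / \<rho>)"
      by blast
    ultimately show ?thesis by linarith
  qed
  finally have "ln ((SUP x\<in>ball 0 (1/4). \<bar>F x\<bar>) / M) \<le> (ln 30720 + ln (32 / \<rho>)) * (1 + real N)" .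
  then show ?thesis using True unfolding M_def num_elements_def N_def by (simp add: one_ereal_def)
next
  case False
  have "0 < ln 30720 + ln (32 / \<rho>)" using \<rho> by (intro add_pos_pos ln_gt_zero) (auto simp: field_simps)
  then show ?thesis using False by (simp add: num_elements_def)
qed

end

theorem theorem3p1p1:
  shows "\<exists>\<epsilon>1::real. \<exists>\<rho>p::real. 0 < \<epsilon>1 \<and> 0 < \<rho>p \<and> \<rho>p < 1/2 \<and>
    (\<exists>c4::real \<Rightarrow> real. (\<forall>t. 0 < t \<and> t < 1 \<longrightarrow> 0 < c4 t) \<and>
      (\<forall>qm qp :: real. 0 < qm \<and> qm < qp \<longrightarrow>
        (let \<rho>m = \<rho>p / 5 * (qm / qp)\<^sup>2 in
         \<forall>(F :: real^2 \<Rightarrow> real) (q :: real^2 \<Rightarrow> real).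
           continuous_on (cball 0 1) F \<and>
           (\<exists>x\<in>cball 0 1. F x \<noteq> 0) \<and>
           smooth_on q (ball 0 1) \<and>
           sup_norm_on q (ball 0 1) < ereal \<epsilon>1 \<and>
           solves_schroedinger_on q F (ball 0 1) \<longrightarrow>
             0 < (SUP x\<in>ball 0 \<rho>m. \<bar>F x\<bar>) \<and>
             ereal (ln ((SUP x\<in>ball 0 \<rho>p. \<bar>F x\<bar>) / (SUP x\<in>ball 0 \<rho>m. \<bar>F x\<bar>)))
               \<le> ereal (c4 (qm / qp)) * (1 + num_elements (zero_set F (sphere 0 1))))))"
proof -
  define c4 where "c4 t = ln 30720 + ln (32 / ((1/4) / 5 * t\<^sup>2))" for t :: real
  have range: "0 < (1/4) / 5 * t\<^sup>2 \<and> (1/4) / 5 * t\<^sup>2 \<le> 1" if "0 < t" "t < 1" for t :: real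
    using that power_le_one[of t 2] by simp
  have c4_pos: "0 < c4 t" if "0 < t" "t < 1" for t
    unfolding c4_def using range[OF that] by (intro add_pos_pos ln_gt_zero) (auto simp: field_simps)
  have main: "0 < (SUP x\<in>ball 0 ((1/4) / 5 * (qm / qp)\<^sup>2). \<bar>F x\<bar>) \<and>
      ereal (ln ((SUP x\<in>ball 0 (1/4). \<bar>F x\<bar>) / (SUP x\<in>ball 0 ((1/4) / 5 * (qm / qp)\<^sup>2). \<bar>F x\<bar>)))
        \<le> ereal (c4 (qm / qp)) * (1 + num_elements (zero_set F (sphere 0 1)))"
    if q0: "0 < qm \<and> qm < qp"
      and F: "continuous_on (cball 0 1) F \<and> (\<exists>x\<in>cball 0 1. F x \<noteq> 0) \<and> smooth_on q (ball 0 1) \<and>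
        sup_norm_on q (ball 0 1) < ereal (1/10000) \<and> solves_schroedinger_on q F (ball 0 1)"
    for qm qp :: real and F q :: "real ^ 2 \<Rightarrow> real"
  proof -
    have t: "0 < qm / qp" "qm / qp < 1" using q0 by auto
    interpret small_potential_solution F q
    proof
      show "continuous_on (ball 0 1) q" using F unfolding smooth_on_def by (metis Ck_on.simps(1))
      show "\<bar>q x\<bar> \<le> 1/10000" if "x \<in> ball 0 1" for x
      proof -
        have "ereal \<bar>q x\<bar> \<le> sup_norm_on q (ball 0 1)"
          unfolding sup_norm_on_def using that by (rule SUP_upper)
        then have "ereal \<bar>q x\<bar> < ereal (1/10000)" using F by (meson le_less_trans)
        then show ?thesis by simp
      qed
    qed (use F in auto)
    show ?thesis
      using sup_pos doubling_bound range[OF t] unfolding c4_def by blast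
  qed
  show ?thesis
    unfolding Let_def
  proof (rule exI[of _ "1/10000"], rule exI[of _ "1/4"], intro conjI exI[of _ c4] allI impI, goal_cases)
    case (4 t)
    then show ?case using c4_pos by blast
  next
    case (5 qm qp F q)
    show ?case by (rule main[OF 5, THEN conjunct1])
  next
    case (6 qm qp F q)
    show ?case by (rule main[OF 6, THEN conjunct2])
  qed simp_all
qed

end
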